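(* Let $f:\mathbb B\to\mathbb H$ be a slice regular function such that $f(0)=0$, $f'(0)=1$ and $$\|f\|_{\mathcal B_r}:=\sup_{q\in\mathbb B}(1-|q|^2)|f'(q)|\le 1 .$$ Then: (a) the inequality $$\mathrm{Re}\, f'(q)\ \ge\ \frac{1-\sqrt3\,|q|}{(1-|q|/\sqrt3)^3}$$ holds for all $q\in B(0,1/\sqrt3)$. In particular, for every $I\in\mathbb S$ the restriction $f|_{B(0,1/\sqrt3)_I}:B(0,1/\sqrt3)_I\to\mathbb H$ is injective. (b) $f$ is injective on $B(0,r_{\mathbb B})$ and $B(0,R_{\mathbb B})\subset f\big(B(0,r_{\mathbb B})\big)$, where $$r_{\mathbb B}=\sup_{0<r<1}\bigg\{\frac12\log\frac{1+r}{1-r}-\sqrt{\frac14\Big(\log\frac{1+r}{1-r}\Big)^2-r^2}\bigg\}\approx 0.3552$$ and $$R_{\mathbb B}=\sup_{0<r<1}\bigg\{\frac{1}{2r^2}\log\frac{1+r}{1-r}\bigg(\frac12\log\frac{1+r}{1-r}-\sqrt{\frac14\Big(\log\frac{1+r}{1-r}\Big)^2-r^2}\bigg)^2\bigg\}\approx 0.2308 .$$ Moreover, $$B(0,\sqrt3/4)\subset f\big(B(0,1/\sqrt3)\big).$$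
   Context: $\mathbb H$ is the skew field of quaternions, $|\cdot|$ its Euclidean norm, $\mathrm{Re}$ the real part, $\mathbb S=\{q\in\mathbb H:q^2=-1\}$. For $I\in\mathbb S$, $\mathbb C_I=\mathbb R+\mathbb R I$, and for $\Omega\subset\mathbb H$, $\Omega_I=\Omega\cap\mathbb C_I$. $B(q_0,R)=\{q\in\mathbb H:|q-q_0|<R\}$ and $\mathbb B=B(0,1)$. A function $f:\Omega\to\mathbb H$ on a domain $\Omega\subset\mathbb H$ is slice regular if for every $I\in\mathbb S$ its restriction $f_I$ to $\Omega_I$ has continuous partial derivatives and satisfies $\frac12\big(\frac{\partial}{\partial x}+I\frac{\partial}{\partial y}\big)f_I(x+yI)=0$ for all $x+yI\in\Omega_I$. On $\mathbb B$ this is equivalent to $f(q)=\sum_{n\ge0}q^na_n$ with $a_n\in\mathbb H$, the series converging absolutely and uniformly on compact subsets of $\mathbb B$. The slice derivative $f'$ is defined on each $\mathbb B_I$ by $f'(x+yI)=\frac12\big(\frac{\partial}{\partial x}-I\frac{\partial}{\partial y}\big)f_I(x+yI)$; equivalently $f'(q)=\sum_{n\ge1}q^{n-1}na_n$. It is well defined and slice regular. *)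

theory Defs
  imports "HOL-Analysis.Analysis"
begin

section \<open>Quaternions\<close>

datatype quat = Quat (qRe: real) (qIm1: real) (qIm2: real) (qIm3: real)

lemma quat_eq_iff:
  "p = q \<longleftrightarrow> qRe p = qRe q \<and> qIm1 p = qIm1 q \<and> qIm2 p = qIm2 q \<and> qIm3 p = qIm3 q"
  by (cases p; cases q) simp

instantiation quat :: real_vector
begin

definition zero_quat :: quat where
  "0 = Quat 0 0 0 0"

definition plus_quat :: "quat \<Rightarrow> quat \<Rightarrow> quat" where
  "p + q = Quat (qRe p + qRe q) (qIm1 p + qIm1 q) (qIm2 p + qIm2 q) (qIm3 p + qIm3 q)"

definition uminus_quat :: "quat \<Rightarrow> quat" where
  "- q = Quat (- qRe q) (- qIm1 q) (- qIm2 q) (- qIm3 q)"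

definition minus_quat :: "quat \<Rightarrow> quat \<Rightarrow> quat" where
  "p - q = Quat (qRe p - qRe q) (qIm1 p - qIm1 q) (qIm2 p - qIm2 q) (qIm3 p - qIm3 q)"

definition scaleR_quat :: "real \<Rightarrow> quat \<Rightarrow> quat" where
  "r *\<^sub>R q = Quat (r * qRe q) (r * qIm1 q) (r * qIm2 q) (r * qIm3 q)"

instance
  by standard
    (simp_all add: quat_eq_iff zero_quat_def plus_quat_def uminus_quat_def minus_quat_def
      scaleR_quat_def algebra_simps)

end

lemma quat_vector_sel [simp]:
  "qRe 0 = 0" "qIm1 0 = 0" "qIm2 0 = 0" "qIm3 0 = 0"
  "qRe (p + q) = qRe p + qRe q" "qIm1 (p + q) = qIm1 p + qIm1 q"
  "qIm2 (p + q) = qIm2 p + qIm2 q" "qIm3 (p + q) = qIm3 p + qIm3 q"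
  "qRe (- q) = - qRe q" "qIm1 (- q) = - qIm1 q" "qIm2 (- q) = - qIm2 q" "qIm3 (- q) = - qIm3 q"
  "qRe (p - q) = qRe p - qRe q" "qIm1 (p - q) = qIm1 p - qIm1 q"
  "qIm2 (p - q) = qIm2 p - qIm2 q" "qIm3 (p - q) = qIm3 p - qIm3 q"
  "qRe (r *\<^sub>R q) = r * qRe q" "qIm1 (r *\<^sub>R q) = r * qIm1 q"
  "qIm2 (r *\<^sub>R q) = r * qIm2 q" "qIm3 (r *\<^sub>R q) = r * qIm3 q"
  by (simp_all add: zero_quat_def plus_quat_def uminus_quat_def minus_quat_def scaleR_quat_def)

instantiation quat :: real_algebra_1
begin

definition one_quat :: quat where
  "1 = Quat 1 0 0 0"

definition times_quat :: "quat \<Rightarrow> quat \<Rightarrow> quat" where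
  "p * q = Quat
     (qRe p * qRe q - qIm1 p * qIm1 q - qIm2 p * qIm2 q - qIm3 p * qIm3 q)
     (qRe p * qIm1 q + qIm1 p * qRe q + qIm2 p * qIm3 q - qIm3 p * qIm2 q)
     (qRe p * qIm2 q - qIm1 p * qIm3 q + qIm2 p * qRe q + qIm3 p * qIm1 q)
     (qRe p * qIm3 q + qIm1 p * qIm2 q - qIm2 p * qIm1 q + qIm3 p * qRe q)"

lemma quat_ring_sel [simp]:
  "qRe 1 = 1" "qIm1 1 = 0" "qIm2 1 = 0" "qIm3 1 = 0"
  "qRe (p * q) = qRe p * qRe q - qIm1 p * qIm1 q - qIm2 p * qIm2 q - qIm3 p * qIm3 q"
  "qIm1 (p * q) = qRe p * qIm1 q + qIm1 p * qRe q + qIm2 p * qIm3 q - qIm3 p * qIm2 q"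
  "qIm2 (p * q) = qRe p * qIm2 q - qIm1 p * qIm3 q + qIm2 p * qRe q + qIm3 p * qIm1 q"
  "qIm3 (p * q) = qRe p * qIm3 q + qIm1 p * qIm2 q - qIm2 p * qIm1 q + qIm3 p * qRe q"
  by (simp_all add: one_quat_def times_quat_def)

instance
  by standard (simp_all add: quat_eq_iff algebra_simps)

end

lemma quat_sum_squares_eq_0:
  "(qRe q)\<^sup>2 + (qIm1 q)\<^sup>2 + (qIm2 q)\<^sup>2 + (qIm3 q)\<^sup>2 = 0 \<longleftrightarrow> q = 0"
  by (simp add: quat_eq_iff add_nonneg_eq_0_iff)

instantiation quat :: real_div_algebra
begin

definition inverse_quat :: "quat \<Rightarrow> quat" where
  "inverse q = inverse ((qRe q)\<^sup>2 + (qIm1 q)\<^sup>2 + (qIm2 q)\<^sup>2 + (qIm3 q)\<^sup>2) *\<^sub>R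
     Quat (qRe q) (- qIm1 q) (- qIm2 q) (- qIm3 q)"

definition divide_quat :: "quat \<Rightarrow> quat \<Rightarrow> quat" where
  "p div q = p * inverse (q :: quat)"

instance
proof
  fix p q :: quat
  let ?n = "\<lambda>q. (qRe q)\<^sup>2 + (qIm1 q)\<^sup>2 + (qIm2 q)\<^sup>2 + (qIm3 q)\<^sup>2"
  let ?c = "Quat (qRe q) (- qIm1 q) (- qIm2 q) (- qIm3 q)"
  have "?c * q = ?n q *\<^sub>R 1" "q * ?c = ?n q *\<^sub>R 1"
    by (simp_all add: quat_eq_iff power2_eq_square)
  moreover assume "q \<noteq> 0"
  then have "?n q \<noteq> 0"
    by (simp only: quat_sum_squares_eq_0) simp
  ultimately show "inverse q * q = 1" "q * inverse q = 1"
    by (simp_all add: inverse_quat_def)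
next
  fix p q :: quat
  show "p div q = p * inverse q"
    by (rule divide_quat_def)
  show "inverse (0::quat) = 0"
    by (simp add: inverse_quat_def quat_eq_iff)
qed

end

instantiation quat :: real_inner
begin

definition inner_quat :: "quat \<Rightarrow> quat \<Rightarrow> real" where
  "inner p q = qRe p * qRe q + qIm1 p * qIm1 q + qIm2 p * qIm2 q + qIm3 p * qIm3 q"

definition norm_quat :: "quat \<Rightarrow> real" where
  "norm q = sqrt ((qRe q)\<^sup>2 + (qIm1 q)\<^sup>2 + (qIm2 q)\<^sup>2 + (qIm3 q)\<^sup>2)"

definition sgn_quat :: "quat \<Rightarrow> quat" where
  "sgn (q :: quat) = q /\<^sub>R norm q"

definition dist_quat :: "quat \<Rightarrow> quat \<Rightarrow> real" where
  "dist (p :: quat) q = norm (p - q)"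

definition uniformity_quat :: "(quat \<times> quat) filter" where
  "uniformity = (INF e\<in>{0 <..}. principal {(x :: quat, y). dist x y < e})"

definition open_quat :: "quat set \<Rightarrow> bool" where
  "open (U :: quat set) \<longleftrightarrow>
     (\<forall>x\<in>U. eventually (\<lambda>(x', y). x' = x \<longrightarrow> y \<in> U) uniformity)"

instance
proof
  fix x y z :: quat and r :: real and U :: "quat set"
  show "inner x y = inner y x"
    by (simp add: inner_quat_def mult.commute)
  show "inner (x + y) z = inner x z + inner y z"
    by (simp add: inner_quat_def algebra_simps)
  show "inner (r *\<^sub>R x) y = r * inner x y"
    by (simp add: inner_quat_def algebra_simps)
  show "0 \<le> inner x x"
    by (simp add: inner_quat_def)
  show "inner x x = 0 \<longleftrightarrow> x = 0"
    using quat_sum_squares_eq_0[of x] by (simp add: inner_quat_def power2_eq_square)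
  show "norm x = sqrt (inner x x)"
    by (simp add: inner_quat_def norm_quat_def power2_eq_square)
  show "sgn x = x /\<^sub>R norm x"
    by (rule sgn_quat_def)
  show "dist x y = norm (x - y)"
    by (rule dist_quat_def)
  show "(uniformity :: (quat \<times> quat) filter) = (INF e\<in>{0 <..}. principal {(x, y). dist x y < e})"
    by (rule uniformity_quat_def)
  show "open U \<longleftrightarrow> (\<forall>x\<in>U. eventually (\<lambda>(x', y). x' = x \<longrightarrow> y \<in> U) uniformity)"
    by (rule open_quat_def)
qed

end

instance quat :: real_normed_div_algebra
proof
  fix p q :: quat
  show "norm (p * q) = norm p * norm q"
    unfolding norm_quat_def real_sqrt_mult[symmetric] quat_ring_sel
    by (rule arg_cong[where f = sqrt]) algebra
qed

instantiation quat :: euclidean_space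
begin

definition Basis_quat :: "quat set" where
  "Basis = {Quat 1 0 0 0, Quat 0 1 0 0, Quat 0 0 1 0, Quat 0 0 0 1}"

instance
proof
  fix u v :: quat
  show "Basis \<noteq> ({} :: quat set)" "finite (Basis :: quat set)"
    by (simp_all add: Basis_quat_def)
  show "inner u v = (if u = v then 1 else 0)" if "u \<in> Basis" "v \<in> Basis"
    using that unfolding Basis_quat_def by (elim insertE emptyE; simp add: inner_quat_def)
  show "(\<forall>v\<in>Basis. inner u v = 0) \<longleftrightarrow> u = 0"
    by (simp add: Basis_quat_def inner_quat_def quat_eq_iff[of u])
qed

end


section \<open>Slices and slice regular functions\<close>

definition imag_sphere :: "quat set" where
  "imag_sphere = {q. q\<^sup>2 = - 1}"

definition slice_plane :: "quat \<Rightarrow> quat set" where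
  "slice_plane I = {of_real x + of_real y * I | x y. True}"

definition slice :: "quat set \<Rightarrow> quat \<Rightarrow> quat set" where
  "slice \<Omega> I = \<Omega> \<inter> slice_plane I"

text \<open>
  The two partial derivatives of the restriction of \<open>f\<close> to the plane of \<open>I\<close>, with
  respect to the real coordinates \<open>x\<close> and \<open>y\<close> of the point \<open>q = x + y I\<close>. For
  \<open>q\<close> in an open set \<open>\<Omega>\<close> they depend only on the values of \<open>f\<close> on
  \<open>slice \<Omega> I\<close>.
\<close>

definition slice_dx :: "(quat \<Rightarrow> quat) \<Rightarrow> quat \<Rightarrow> quat" where
  "slice_dx f q = vector_derivative (\<lambda>t::real. f (q + of_real t)) (at 0)"

definition slice_dy :: "quat \<Rightarrow> (quat \<Rightarrow> quat) \<Rightarrow> quat \<Rightarrow> quat" where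
  "slice_dy I f q = vector_derivative (\<lambda>t::real. f (q + of_real t * I)) (at 0)"

definition slice_dbar :: "quat \<Rightarrow> (quat \<Rightarrow> quat) \<Rightarrow> quat \<Rightarrow> quat" where
  "slice_dbar I f q = (1/2) *\<^sub>R (slice_dx f q + I * slice_dy I f q)"

definition slice_del :: "quat \<Rightarrow> (quat \<Rightarrow> quat) \<Rightarrow> quat \<Rightarrow> quat" where
  "slice_del I f q = (1/2) *\<^sub>R (slice_dx f q - I * slice_dy I f q)"

definition slice_regular_on :: "quat set \<Rightarrow> (quat \<Rightarrow> quat) \<Rightarrow> bool" where
  "slice_regular_on \<Omega> f \<longleftrightarrow> open \<Omega> \<and> connected \<Omega> \<and>
     (\<forall>I\<in>imag_sphere.
        (\<forall>q\<in>slice \<Omega> I.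
           (\<lambda>t::real. f (q + of_real t)) differentiable (at 0) \<and>
           (\<lambda>t::real. f (q + of_real t * I)) differentiable (at 0)) \<and>
        continuous_on (slice \<Omega> I) (slice_dx f) \<and>
        continuous_on (slice \<Omega> I) (slice_dy I f) \<and>
        (\<forall>q\<in>slice \<Omega> I. slice_dbar I f q = 0))"

text \<open>
  A point may lie in several planes (\<open>I\<close> and \<open>- I\<close> span the same one, and the real
  points lie in all of them); for slice regular \<open>f\<close> the value does not depend on the
  choice, as \<open>slice_deriv_eq\<close> shows.
\<close>

definition slice_deriv :: "(quat \<Rightarrow> quat) \<Rightarrow> quat \<Rightarrow> quat" where
  "slice_deriv f q =
     (THE d. \<forall>I\<in>imag_sphere. q \<in> slice_plane I \<longrightarrow> d = slice_del I f q)"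

lemma slice_del_eq_dx:
  assumes "slice_regular_on \<Omega> f" "I \<in> imag_sphere" "q \<in> slice \<Omega> I"
  shows "slice_del I f q = slice_dx f q"
proof -
  have "slice_dbar I f q = 0"
    using assms by (auto simp: slice_regular_on_def)
  then have "I * slice_dy I f q = - slice_dx f q"
    by (simp add: slice_dbar_def add_eq_0_iff)
  then show ?thesis
    by (simp add: slice_del_def scaleR_2[symmetric])
qed

lemma slice_deriv_eq:
  assumes "slice_regular_on \<Omega> f" "I \<in> imag_sphere" "q \<in> slice \<Omega> I"
  shows "slice_deriv f q = slice_del I f q"
  unfolding slice_deriv_def
proof (rule the_equality)
  show "\<forall>J\<in>imag_sphere. q \<in> slice_plane J \<longrightarrow> slice_del I f q = slice_del J f q"
    using assms by (auto simp: slice_del_eq_dx slice_def)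
  show "d = slice_del I f q"
    if "\<forall>J\<in>imag_sphere. q \<in> slice_plane J \<longrightarrow> d = slice_del J f q" for d
    using that assms by (auto simp: slice_def)
qed


section \<open>The Bloch seminorm and the two constants\<close>

text \<open>Extended real, so that an unbounded supremum is \<open>\<infinity>\<close>.\<close>

definition bloch_norm :: "(quat \<Rightarrow> quat) \<Rightarrow> ereal" where
  "bloch_norm f = (SUP q\<in>ball 0 1. ereal ((1 - (norm q)\<^sup>2) * norm (slice_deriv f q)))"

text \<open>
  Both suprema are over bounded sets: with \<open>L = ln ((1 + r) / (1 - r)) / 2 \<ge> r\<close> the
  quantity \<open>L - sqrt (L\<^sup>2 - r\<^sup>2)\<close> is at most \<open>r\<^sup>2 / L\<close>.
\<close>

definition bloch_radius_dom :: real where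
  "bloch_radius_dom = (SUP r\<in>{0<..<1::real}.
     1/2 * ln ((1 + r) / (1 - r)) - sqrt (1/4 * (ln ((1 + r) / (1 - r)))\<^sup>2 - r\<^sup>2))"

definition bloch_radius_img :: real where
  "bloch_radius_img = (SUP r\<in>{0<..<1::real}.
     1 / (2 * r\<^sup>2) * ln ((1 + r) / (1 - r)) *
       (1/2 * ln ((1 + r) / (1 - r)) - sqrt (1/4 * (ln ((1 + r) / (1 - r)))\<^sup>2 - r\<^sup>2))\<^sup>2)"

end

theory Submission
  imports Defs "HOL-Complex_Analysis.Complex_Analysis"
begin

text \<open>
  Except for one Hardy space argument, everything is reduced to one complex variable. For an
  imaginary unit \<open>I\<close> the plane
  \<open>\<real> + \<real> I\<close> is a copy of \<open>\<complex>\<close>, and composing a slice regular \<open>f\<close> on that plane with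
  the orthogonal projection to the plane (after a right multiplication by a quaternion \<open>p\<close>)
  gives a holomorphic function on the unit disc whose derivative is the projection of
  \<open>slice_deriv f\<close>; this is \<open>slice_component_has_field_derivative\<close>. With \<open>p = 1\<close> the
  real part is not changed, and moduli do not increase.

  (a) The projection of \<open>f'\<close> satisfies the hypotheses of Bonk's distortion theorem
  \<open>bonk_distortion\<close>, which is proved here by Julia's boundary version of the Schwarz-Pick
  lemma. The estimate makes \<open>Re f'\<close> positive on the disc of radius \<open>1 / sqrt 3\<close>, so \<open>f\<close> is
  injective on each slice. Integrated along a ray it gives
  \<open>\<langle>q, f q\<rangle> \<ge> |q| sqrt 3 / 4\<close> on the sphere \<open>|q| = 1 / sqrt 3\<close>, and Brouwer's fixed point
  theorem, in the form \<open>covering_from_inner_ge\<close>, yields the covering of the ball of radius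
  \<open>sqrt 3 / 4\<close>.

  (b) Integrating \<open>|f' q| \<le> 1 / (1 - |q|\<^sup>2)\<close> gives \<open>|f q| \<le> artanh |q|\<close>. Hence, for
  \<open>0 < r < 1\<close>, the function \<open>\<phi> q = f (r q) / artanh r\<close> maps the ball to itself, with \<open>\<phi> 0 = 0\<close>
  and \<open>\<phi>' 0 = \<alpha> = r / artanh r\<close>, and a Landau theorem applies to it. It rests on two estimates.
  The Schwarz-Pick lemma on each slice gives
  \<open>\<langle>q, \<phi> q\<rangle> \<ge> |q|\<^sup>2 (\<alpha> - |q|) / (1 - \<alpha> |q|)\<close>.
  In the other direction, \<open>equal_values_norm_le\<close> says that \<open>\<phi> a = \<phi> b = c\<close> with \<open>a \<noteq> b\<close> forces
  \<open>|c| \<le> |a| |b|\<close>, even if \<open>a\<close> and \<open>b\<close> lie in different slices. The two are incompatible when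
  \<open>a\<close> and \<open>b\<close> both have modulus less than the solution \<open>\<rho> < 1\<close> of \<open>\<alpha> (1 + \<rho>\<^sup>2) = 2 \<rho>\<close>. So
  \<open>f\<close> is injective on the ball of radius \<open>r \<rho>\<close>; by the first estimate and Brouwer's theorem its
  image contains the ball of radius \<open>\<rho>\<^sup>2 artanh r\<close>. Taking suprema over \<open>r\<close> gives the two
  constants.

  The bound \<open>equal_values_norm_le\<close> is a Hardy space argument. Convolution with the coefficients of
  \<open>\<phi>\<close> is a contraction \<open>T\<close> of the quaternionic sequence space \<open>\<ell>\<^sup>2\<close> (\<open>conv_contraction\<close>). The sequences
  \<open>(conj a)\<^sup>n\<close> and \<open>(conj b)\<^sup>n\<close> span a space on which the adjoint of \<open>T\<close> is left multiplication by
  \<open>conj c\<close>; as \<open>\<phi> 0 = 0\<close>, the adjoint does not see the entry with index \<open>0\<close>. Applied to the vector of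
  that space that is orthogonal to \<open>(conj a)\<^sup>n - (conj b)\<^sup>n\<close>, this is the claimed inequality.
\<close>

section \<open>Quaternions and their slices\<close>

text \<open>
  The conjugate quaternion, written \<open>conj\<close> in the comments.
\<close>

definition qcnj :: "quat \<Rightarrow> quat" where
  "qcnj q = Quat (qRe q) (- qIm1 q) (- qIm2 q) (- qIm3 q)"

lemma qcnj_sel [simp]:
  "qRe (qcnj q) = qRe q" "qIm1 (qcnj q) = - qIm1 q"
  "qIm2 (qcnj q) = - qIm2 q" "qIm3 (qcnj q) = - qIm3 q"
  by (simp_all add: qcnj_def)

lemma quat_of_real_sel [simp]:
  "qRe (of_real x) = x" "qIm1 (of_real x) = 0" "qIm2 (of_real x) = 0" "qIm3 (of_real x) = 0"
  by (simp_all add: of_real_def)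

lemma quat_norm_power2: "(norm q)\<^sup>2 = (qRe q)\<^sup>2 + (qIm1 q)\<^sup>2 + (qIm2 q)\<^sup>2 + (qIm3 q)\<^sup>2"
  by (simp add: norm_quat_def)

lemma qcnj_simps [simp]:
  "qcnj 0 = 0" "qcnj 1 = 1" "qcnj (of_real r) = of_real r" "qcnj (qcnj q) = q"
  "qcnj (p + q) = qcnj p + qcnj q" "qcnj (p - q) = qcnj p - qcnj q"
  "qcnj (- q) = - qcnj q" "norm (qcnj q) = norm q"
  by (simp_all add: quat_eq_iff norm_quat_def)

lemma qcnj_mult: "qcnj (p * q) = qcnj q * qcnj p"
  by (simp add: quat_eq_iff algebra_simps)

lemma qcnj_power: "qcnj (q ^ n) = qcnj q ^ n"
  by (induction n) (simp_all add: qcnj_mult power_commutes)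

lemma bounded_linear_qcnj: "bounded_linear qcnj"
  by (rule bounded_linear_intro[of _ 1]) (auto simp: quat_eq_iff norm_quat_def)

lemma qcnj_mult_self: "q * qcnj q = of_real ((norm q)\<^sup>2)" "qcnj q * q = of_real ((norm q)\<^sup>2)"
  by (simp_all only: quat_norm_power2) (simp_all add: quat_eq_iff algebra_simps power2_eq_square)

lemma qinner_eq_Re: "inner p q = qRe (qcnj p * q)" "inner p q = qRe (p * qcnj q)"
  by (simp_all add: inner_quat_def)

lemma qinner_mult:
  "inner (p * q) r = inner q (qcnj p * r)" "inner (q * p) r = inner q (r * qcnj p)"
  by (simp_all add: inner_quat_def algebra_simps)

lemma qRe_mult_commute: "qRe (p * q) = qRe (q * p)"
  by (simp add: algebra_simps)

lemma bounded_linear_qRe: "bounded_linear qRe"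
proof (rule bounded_linear_intro[of _ 1])
  show "norm (qRe q) \<le> norm q * 1" for q
    using Basis_le_norm[of "1::quat" q] by (simp add: Basis_quat_def one_quat_def inner_quat_def)
qed auto

lemma qRe_le_norm: "\<bar>qRe q\<bar> \<le> norm q"
  using Basis_le_norm[of "1::quat" q] by (simp add: Basis_quat_def one_quat_def inner_quat_def)

lemma imag_sphere_iff: "I \<in> imag_sphere \<longleftrightarrow> qRe I = 0 \<and> norm I = 1"
proof
  assume "I \<in> imag_sphere"
  then have sq: "I * I = - 1" by (simp add: imag_sphere_def power2_eq_square)
  have "norm I * norm I = 1"
    using arg_cong[OF sq, of norm] by (simp add: norm_mult)
  then have n: "norm I = 1"
    by (metis norm_ge_zero abs_of_nonneg power2_eq_square real_sqrt_abs real_sqrt_one)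
  have "(norm I)\<^sup>2 = 1" by (simp add: n)
  then have "(qRe I)\<^sup>2 + (qIm1 I)\<^sup>2 + (qIm2 I)\<^sup>2 + (qIm3 I)\<^sup>2 = 1" by (simp add: quat_norm_power2)
  moreover have "(qRe I)\<^sup>2 - (qIm1 I)\<^sup>2 - (qIm2 I)\<^sup>2 - (qIm3 I)\<^sup>2 = - 1"
    using arg_cong[OF sq, of qRe] by (simp add: power2_eq_square)
  ultimately have "(qRe I)\<^sup>2 = 0" by linarith
  then show "qRe I = 0 \<and> norm I = 1" using n by simp
next
  assume a: "qRe I = 0 \<and> norm I = 1"
  then have "(qIm1 I)\<^sup>2 + (qIm2 I)\<^sup>2 + (qIm3 I)\<^sup>2 = 1"
    using quat_norm_power2[of I] by simp
  then show "I \<in> imag_sphere"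
    using a by (simp add: imag_sphere_def quat_eq_iff power2_eq_square)
qed

lemma imag_sphereD:
  assumes "I \<in> imag_sphere"
  shows "I * I = - 1" "qRe I = 0" "norm I = 1" "qcnj I = - I"
  using assms imag_sphere_iff[of I] by (auto simp: imag_sphere_def power2_eq_square quat_eq_iff)

text \<open>
  The embedding of \<open>\<complex>\<close> onto the plane spanned by \<open>1\<close> and \<open>I\<close>, and the orthogonal projection back.
  Both are linear over the complex numbers, acting on quaternions from the left through \<open>emb I\<close>.
\<close>

definition emb :: "quat \<Rightarrow> complex \<Rightarrow> quat" where
  "emb I z = of_real (Re z) + of_real (Im z) * I"

definition proj :: "quat \<Rightarrow> quat \<Rightarrow> complex" where
  "proj I q = Complex (qRe q) (inner q I)"

lemma emb_simps [simp]: "emb I 0 = 0" "emb I 1 = 1" "emb I (of_real x) = of_real x"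
  "emb I \<i> = I"
  by (simp_all add: emb_def)

lemma emb_mult:
  assumes "I \<in> imag_sphere"
  shows "emb I (z * w) = emb I z * emb I w"
proof -
  have "I * I = - 1" by (rule imag_sphereD(1)[OF assms])
  then show ?thesis
    by (simp add: emb_def of_real_def algebra_simps)
qed

lemma emb_power:
  assumes "I \<in> imag_sphere"
  shows "emb I (z ^ n) = emb I z ^ n"
  by (induction n) (simp_all add: emb_mult[OF assms])

lemma norm_emb:
  assumes "I \<in> imag_sphere"
  shows "norm (emb I z) = cmod z"
proof -
  have i: "(qIm1 I)\<^sup>2 + (qIm2 I)\<^sup>2 + (qIm3 I)\<^sup>2 = 1" "qRe I = 0"
    using quat_norm_power2[of I] imag_sphereD(2,3)[OF assms] by auto
  have "(norm (emb I z))\<^sup>2 = (Re z)\<^sup>2 + (Im z)\<^sup>2 * ((qIm1 I)\<^sup>2 + (qIm2 I)\<^sup>2 + (qIm3 I)\<^sup>2)"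
    unfolding quat_norm_power2 emb_def by (simp add: i(2) power_mult_distrib algebra_simps)
  then have "(norm (emb I z))\<^sup>2 = (cmod z)\<^sup>2"
    by (simp add: i cmod_power2)
  then show ?thesis by simp
qed

lemma bounded_linear_emb: "bounded_linear (emb I)"
proof -
  have "bounded_linear (\<lambda>z. of_real (Re z) + of_real (Im z) * I)"
    by (intro bounded_linear_add bounded_linear_mult_const
        bounded_linear_compose[OF bounded_linear_of_real] bounded_linear_Re bounded_linear_Im)
  then show ?thesis by (simp add: emb_def[abs_def])
qed

lemma slice_plane_eq: "slice_plane I = range (emb I)"
proof -
  have "of_real x + of_real y * I = emb I (Complex x y)" for x y
    by (simp add: emb_def)
  then have "of_real x + of_real y * I \<in> range (emb I)" for x y
    by (metis rangeI)
  then show ?thesis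
    unfolding slice_plane_def by (auto simp: emb_def[of I])
qed

lemma slice_ball_eq:
  assumes "I \<in> imag_sphere"
  shows "slice (ball 0 r) I = emb I ` ball 0 r"
  using assms by (auto simp: slice_def slice_plane_eq norm_emb)

lemma emb_surj:
  obtains I z where "I \<in> imag_sphere" "q = emb I z"
proof (cases "norm (q - of_real (qRe q)) = 0")
  case True
  have "Quat 0 1 0 0 \<in> imag_sphere"
    by (simp add: imag_sphere_iff norm_quat_def)
  moreover have "q = emb (Quat 0 1 0 0) (of_real (qRe q))" using True by simp
  ultimately show ?thesis using that by blast
next
  case False
  let ?p = "q - of_real (qRe q)"
  let ?I = "(1 / norm ?p) *\<^sub>R ?p"
  have "?I \<in> imag_sphere" using False by (simp add: imag_sphere_iff)
  moreover have "q = emb ?I (Complex (qRe q) (norm ?p))"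
    using False by (simp add: emb_def of_real_def)
  ultimately show ?thesis using that by blast
qed

lemma qRe_proj [simp]: "Re (proj I q) = qRe q"
  by (simp add: proj_def)

lemma proj_emb_mult:
  assumes "I \<in> imag_sphere"
  shows "proj I (emb I z * q) = z * proj I q"
proof -
  have i: "(qIm1 I) * (qIm1 I) + (qIm2 I)*(qIm2 I) + (qIm3 I)*(qIm3 I) = 1" "qRe I = 0"
    using quat_norm_power2[of I] imag_sphereD(2,3)[OF assms] by (auto simp: power2_eq_square)
  have "inner (emb I z * q) I = Re z * inner q I
      + Im z * qRe q * ((qIm1 I) * (qIm1 I) + (qIm2 I)*(qIm2 I) + (qIm3 I)*(qIm3 I))"
    by (simp add: emb_def inner_quat_def i(2) algebra_simps)
  moreover have "qRe (emb I z * q) = Re z * qRe q - Im z * inner q I"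
    by (simp add: emb_def inner_quat_def i(2) algebra_simps)
  ultimately show ?thesis
    by (simp add: proj_def complex_eq_iff i(1))
qed

lemma proj_one [simp]: "I \<in> imag_sphere \<Longrightarrow> proj I 1 = 1"
  by (simp add: proj_def inner_quat_def complex_eq_iff imag_sphere_iff)

lemma norm_proj_le:
  assumes "I \<in> imag_sphere"
  shows "cmod (proj I q) \<le> norm q"
proof -
  have "(cmod (proj I q))\<^sup>2 = qRe q * qRe q + inner q I * inner q I"
    by (simp only: cmod_power2) (simp add: proj_def power2_eq_square)
  also have "\<dots> = qRe (qcnj (emb I (proj I q)) * q)"
    using imag_sphereD(2)[OF assms]
    by (simp add: emb_def proj_def inner_quat_def algebra_simps)
  also have "\<dots> \<le> norm (qcnj (emb I (proj I q)) * q)"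
    using qRe_le_norm abs_le_D1 by blast
  also have "\<dots> = cmod (proj I q) * norm q"
    by (simp add: norm_mult norm_emb[OF assms])
  finally show ?thesis
    by (cases "cmod (proj I q) = 0") (auto simp: power2_eq_square)
qed

lemma bounded_linear_proj:
  assumes "I \<in> imag_sphere"
  shows "bounded_linear (\<lambda>q. proj I (q * p))"
proof (rule bounded_linear_intro[of _ "norm p"])
  show "cmod (proj I (q * p)) \<le> norm q * norm p" for q
    using norm_proj_le[OF assms, of "q * p"] by (simp add: norm_mult)
qed (auto simp: proj_def complex_eq_iff inner_add_left algebra_simps)

section \<open>Slice regular functions are power series\<close>

text \<open>
  Continuous partial derivatives give real differentiability, and the vanishing of
  \<open>slice_dbar I f\<close> is the Cauchy-Riemann equation, because left multiplication by \<open>I\<close> becomes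
  multiplication by \<open>\<i>\<close> under \<open>proj I\<close>.
\<close>

lemma slice_component_has_field_derivative:
  assumes reg: "slice_regular_on (ball 0 1) f" and I: "I \<in> imag_sphere" and z: "cmod z < 1"
  shows "((\<lambda>z. proj I (f (emb I z) * p)) has_field_derivative
           proj I (slice_deriv f (emb I z) * p)) (at z)"
proof -
  define L where "L q = proj I (q * p)" for q
  have bl: "bounded_linear L" using bounded_linear_proj[OF I] by (simp add: L_def[abs_def])
  define F where "F z = L (f (emb I z))" for z
  define D where "D z = L (slice_dx f (emb I z))" for z
  have sl: "slice (ball 0 1) I = emb I ` ball 0 1" by (rule slice_ball_eq[OF I])
  have in_sl: "emb I w \<in> slice (ball 0 1) I" if "cmod w < 1" for w
    using that sl by auto
  have dx: "((\<lambda>t. f (emb I w + of_real t)) has_vector_derivative slice_dx f (emb I w)) (at 0)"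
    if "cmod w < 1" for w
    using reg I in_sl[OF that] unfolding slice_regular_on_def slice_dx_def
    by (metis vector_derivative_works)
  have dy: "((\<lambda>t. f (emb I w + of_real t * I)) has_vector_derivative I * slice_dx f (emb I w)) (at 0)"
    if "cmod w < 1" for w
  proof -
    have 1: "((\<lambda>t. f (emb I w + of_real t * I)) has_vector_derivative slice_dy I f (emb I w)) (at 0)"
      using reg I in_sl[OF that] unfolding slice_regular_on_def slice_dy_def
      by (metis vector_derivative_works)
    have "slice_dbar I f (emb I w) = 0"
      using reg I in_sl[OF that] unfolding slice_regular_on_def by blast
    then have e: "slice_dx f (emb I w) = - (I * slice_dy I f (emb I w))"
      by (simp add: slice_dbar_def add_eq_0_iff2)
    have "I * slice_dx f (emb I w) = slice_dy I f (emb I w)"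
      unfolding e using imag_sphereD(1)[OF I] by (simp add: mult.assoc[symmetric])
    with 1 show ?thesis by simp
  qed
  have Fx: "((\<lambda>x. F (Complex x y)) has_vector_derivative D (Complex x y)) (at x)"
    if "cmod (Complex x y) < 1" for x y
  proof -
    have "((\<lambda>t. F (Complex (x + t) y)) has_vector_derivative D (Complex x y)) (at 0)"
    proof -
      have "emb I (Complex (x + t) y) = emb I (Complex x y) + of_real t" for t
        by (simp add: emb_def)
      then show ?thesis unfolding F_def D_def
        using bounded_linear.has_vector_derivative[OF bl dx[OF that]] by simp
    qed
    then have "((\<lambda>t. F (Complex (x + t) y)) \<circ> (\<lambda>s. s - x) has_vector_derivative 1 *\<^sub>R D (Complex x y)) (at x)"
      by (intro vector_diff_chain_at) (auto intro!: derivative_eq_intros simp: has_vector_derivative_def)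
    then show ?thesis by (simp add: o_def)
  qed
  have Fy: "((\<lambda>y. F (Complex x y)) has_vector_derivative \<i> * D (Complex x y)) (at y)"
    if "cmod (Complex x y) < 1" for x y
  proof -
    have "((\<lambda>t. F (Complex x (y + t))) has_vector_derivative \<i> * D (Complex x y)) (at 0)"
    proof -
      have "emb I (Complex x (y + t)) = emb I (Complex x y) + of_real t * I" for t
        by (simp add: emb_def algebra_simps)
      moreover have "L (I * slice_dx f (emb I (Complex x y))) = \<i> * D (Complex x y)"
        unfolding D_def L_def using proj_emb_mult[OF I, of \<i>] by (simp add: mult.assoc)
      ultimately show ?thesis unfolding F_def
        using bounded_linear.has_vector_derivative[OF bl dy[OF that]] by simp
    qed
    then have "((\<lambda>t. F (Complex x (y + t))) \<circ> (\<lambda>s. s - y) has_vector_derivative 1 *\<^sub>R (\<i> * D (Complex x y))) (at y)"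
      by (intro vector_diff_chain_at) (auto intro!: derivative_eq_intros simp: has_vector_derivative_def)
    then show ?thesis by (simp add: o_def)
  qed
  have contD: "continuous_on (ball 0 1) D"
  proof -
    have "continuous_on (emb I ` ball 0 1) (slice_dx f)"
      using reg I sl unfolding slice_regular_on_def by auto
    then have "continuous_on (ball 0 1) (\<lambda>w. slice_dx f (emb I w))"
      by (rule continuous_on_compose2) (auto intro: linear_continuous_on bounded_linear_emb)
    then show ?thesis unfolding D_def by (rule bounded_linear.continuous_on[OF bl])
  qed
  define e where "e = (1 - cmod z) / 2"
  have e: "e > 0" using z by (simp add: e_def)
  define X where "X = ball (Re z) e"
  define Y where "Y = ball (Im z) e"
  have XY: "cmod (Complex x y) < 1" if "x \<in> X" "y \<in> Y" for x y
  proof -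
    have "cmod (Complex x y - z) \<le> \<bar>x - Re z\<bar> + \<bar>y - Im z\<bar>"
      using cmod_le[of "Complex x y - z"] by simp
    also have "\<dots> < e + e" using that by (auto simp: X_def Y_def dist_real_def)
    finally have "cmod (Complex x y - z) < 1 - cmod z" by (simp add: e_def)
    then show ?thesis using norm_triangle_sub[of "Complex x y" z] by linarith
  qed
  have zz: "Complex (Re z) (Im z) = z" by simp
  have zX: "Re z \<in> X" "Im z \<in> Y" using e by (auto simp: X_def Y_def)
  have "((\<lambda>(x, y). F (Complex x y)) has_derivative
      (\<lambda>(tx, ty). tx *\<^sub>R D z + blinfun_scaleR_left (\<i> * D (Complex (Re z) (Im z))) ty)) (at (Re z, Im z) within X \<times> Y)"
  proof (rule has_derivative_partialsI)
    show "((\<lambda>x. F (Complex x (Im z))) has_derivative (\<lambda>h. h *\<^sub>R D z)) (at (Re z) within X)"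
      using Fx[of "Re z" "Im z"] z unfolding has_vector_derivative_def
      by (auto intro: has_derivative_at_withinI)
    show "((\<lambda>y. F (Complex x y)) has_derivative blinfun_scaleR_left (\<i> * D (Complex x y))) (at y within Y)"
      if "x \<in> X" "y \<in> Y" for x y
      using Fy[OF XY[OF that]] unfolding has_vector_derivative_def blinfun_scaleR_left.rep_eq
      by (auto intro: has_derivative_at_withinI)
    have "continuous_on (X \<times> Y) (\<lambda>v. D (Complex (fst v) (snd v)))"
      by (rule continuous_on_compose2[OF contD]) (auto simp: XY Complex_eq intro!: continuous_intros XY[simplified Complex_eq])
    then have "continuous_on (X \<times> Y) (\<lambda>v. blinfun_scaleR_left (\<i> * D (Complex (fst v) (snd v))))"
      by (intro bounded_linear.continuous_on[OF bounded_linear_blinfun_scaleR_left] continuous_intros)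
    then show "continuous (at (Re z, Im z) within X \<times> Y)
        (\<lambda>(x, y). blinfun_scaleR_left (\<i> * D (Complex x y)))"
      using zX by (auto simp: continuous_on_eq_continuous_within case_prod_unfold)
    show "Im z \<in> Y" "convex Y" using zX by (auto simp: Y_def)
  qed
  moreover have "at (Re z, Im z) within X \<times> Y = at (Re z, Im z)"
    by (rule at_within_open) (use zX in \<open>auto simp: X_def Y_def intro: open_Times\<close>)
  ultimately have "((\<lambda>(x, y). F (Complex x y)) has_derivative
      (\<lambda>(tx, ty). tx *\<^sub>R D z + ty *\<^sub>R (\<i> * D z))) (at (Re z, Im z))"
    by (simp add: case_prod_unfold)
  then have G: "((\<lambda>v. F (Complex (fst v) (snd v))) has_derivative
      (\<lambda>v. fst v *\<^sub>R D z + snd v *\<^sub>R (\<i> * D z))) (at (Re z, Im z))"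
    by (simp add: case_prod_unfold)
  have R: "((\<lambda>w. (Re w, Im w)) has_derivative (\<lambda>h. (Re h, Im h))) (at z)"
    by (intro has_derivative_Pair bounded_linear.has_derivative[OF bounded_linear_Re]
        bounded_linear.has_derivative[OF bounded_linear_Im] has_derivative_ident)
  have "(F has_derivative (\<lambda>h. Re h *\<^sub>R D z + Im h *\<^sub>R (\<i> * D z))) (at z)"
    using has_derivative_compose[OF R G] by simp
  moreover have "(\<lambda>h. Re h *\<^sub>R D z + Im h *\<^sub>R (\<i> * D z)) = (*) (D z)"
    by (rule ext) (simp add: complex_eq_iff algebra_simps)
  ultimately have "(F has_field_derivative D z) (at z)"
    by (simp add: has_field_derivative_def)
  moreover have "slice_deriv f (emb I z) = slice_dx f (emb I z)"
    using slice_deriv_eq[OF reg I in_sl[OF z]] slice_del_eq_dx[OF reg I in_sl[OF z]] by simp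
  ultimately show ?thesis by (simp add: F_def[abs_def] D_def L_def)
qed

text \<open>
  The coefficients come from the two components of \<open>f\<close> on one fixed slice. On any other slice the
  components of \<open>f\<close> and of the series are holomorphic and agree on the real diameter, which lies in
  every slice; so they agree by analytic continuation.
\<close>

lemma slice_regular_power_series:
  assumes reg: "slice_regular_on (ball 0 1) f"
  obtains a where "\<And>r. 0 \<le> r \<Longrightarrow> r < 1 \<Longrightarrow> summable (\<lambda>n. norm (a n) * r ^ n)"
    and "\<And>q. norm q < 1 \<Longrightarrow> (\<lambda>n. q ^ n * a n) sums f q"
proof -
  define i where "i = Quat 0 1 0 0"
  define j where "j = Quat 0 0 1 0"
  have i: "i \<in> imag_sphere" by (simp add: i_def imag_sphere_iff norm_quat_def)
  have nj: "norm j = 1" by (simp add: j_def norm_quat_def)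
  have hol: "(\<lambda>z. proj I (f (emb I z) * p)) holomorphic_on ball 0 1" if "I \<in> imag_sphere" for I p
    unfolding holomorphic_on_open[OF open_ball]
    by (intro ballI exI, rule slice_component_has_field_derivative[OF reg that]) simp
  have series: "(\<lambda>n. (deriv ^^ n) g 0 / fact n * z ^ n) sums g z"
    if "g holomorphic_on ball 0 1" "cmod z < 1" for g z
    using holomorphic_power_series[OF that(1), of z] that(2) by simp
  have split: "q = emb i (proj i (q * 1)) + emb i (proj i (q * (- j))) * j" for q
    by (simp add: quat_eq_iff i_def j_def emb_def proj_def inner_quat_def)
  define c where "c n = (deriv ^^ n) (\<lambda>z. proj i (f (emb i z) * 1)) 0 / fact n" for n
  define d where "d n = (deriv ^^ n) (\<lambda>z. proj i (f (emb i z) * (- j))) 0 / fact n" for n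
  define a where "a n = emb i (c n) + emb i (d n) * j" for n
  have c: "(\<lambda>n. c n * z ^ n) sums proj i (f (emb i z) * 1)" if "cmod z < 1" for z
    unfolding c_def by (rule series[OF hol[OF i] that])
  have d: "(\<lambda>n. d n * z ^ n) sums proj i (f (emb i z) * (- j))" if "cmod z < 1" for z
    unfolding d_def by (rule series[OF hol[OF i] that])
  have fi: "(\<lambda>n. emb i z ^ n * a n) sums f (emb i z)" if "cmod z < 1" for z
  proof -
    have "(\<lambda>n. emb i (c n * z ^ n) + emb i (d n * z ^ n) * j) sums
        (emb i (proj i (f (emb i z) * 1)) + emb i (proj i (f (emb i z) * (- j))) * j)"
      by (intro sums_add sums_mult2 bounded_linear.sums[OF bounded_linear_emb] c[OF that] d[OF that])
    also have "(\<lambda>n. emb i (c n * z ^ n) + emb i (d n * z ^ n) * j) = (\<lambda>n. emb i z ^ n * a n)"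
      by (rule ext) (simp add: a_def emb_power[OF i, symmetric] emb_mult[OF i, symmetric]
          mult.assoc[symmetric] distrib_left mult.commute[of _ "z ^ _"])
    finally show ?thesis by (simp only: split[symmetric])
  qed
  have sm: "summable (\<lambda>n. norm (a n) * r ^ n)" if r: "0 \<le> r" "r < 1" for r
  proof -
    define s where "s = (r + 1) / 2"
    have s: "r < s" "s < 1" using r by (simp_all add: s_def)
    have cs: "cmod (of_real s) < 1" "norm (of_real r :: complex) < norm (of_real s :: complex)"
      using s r by auto
    have "summable (\<lambda>n. norm (c n * of_real r ^ n) + norm (d n * of_real r ^ n))"
      by (intro summable_add powser_insidea[OF sums_summable[OF c[OF cs(1)]] cs(2)]
          powser_insidea[OF sums_summable[OF d[OF cs(1)]] cs(2)])
    then have sm': "summable (\<lambda>n. (cmod (c n) + cmod (d n)) * r ^ n)"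
      using r by (simp add: norm_mult norm_power distrib_right)
    have "norm (a n) \<le> cmod (c n) + cmod (d n)" for n
      unfolding a_def by (rule order.trans[OF norm_triangle_ineq]) (simp add: norm_mult norm_emb[OF i] nj)
    then show ?thesis
      by (intro summable_comparison_test'[OF sm', of 0]) (use r in \<open>simp add: mult_right_mono\<close>)
  qed
  have "(\<lambda>n. q ^ n * a n) sums f q" if q: "norm q < 1" for q
  proof -
    obtain I z where I: "I \<in> imag_sphere" and qz: "q = emb I z" by (rule emb_surj)
    have z: "cmod z < 1" using q by (simp add: qz norm_emb[OF I])
    have sq: "summable (\<lambda>n. emb I w ^ n * a n)" if "cmod w < 1" for w
      by (rule summable_norm_cancel)
        (use sm[of "cmod w"] that in \<open>simp add: norm_mult norm_power norm_emb[OF I] mult.commute\<close>)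
    have "proj I (f q * p) = proj I ((\<Sum>n. q ^ n * a n) * p)" for p
    proof -
      define h where "h w = proj I ((\<Sum>n. emb I w ^ n * a n) * p)" for w
      have hs: "(\<lambda>n. proj I (a n * p) * w ^ n) sums h w" if "cmod w < 1" for w
      proof -
        have "(\<lambda>n. proj I (emb I w ^ n * a n * p)) sums h w"
          unfolding h_def
          by (intro bounded_linear.sums[OF bounded_linear_proj[OF I]] summable_sums sq that)
        then show ?thesis
          by (simp add: emb_power[OF I, symmetric] mult.assoc proj_emb_mult[OF I] mult.commute)
      qed
      have holh: "h holomorphic_on ball 0 1"
        by (rule power_series_holomorphic[of 0 1 "\<lambda>n. proj I (a n * p)"]) (use hs in simp)
      define U where "U = {complex_of_real x |x. \<bar>x\<bar> < 1}"
      have "proj I (f (emb I z) * p) - h z = 0"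
      proof (rule analytic_continuation[where S = "ball 0 1" and U = U and \<xi> = 0
            and f = "\<lambda>z. proj I (f (emb I z) * p) - h z"])
        show "(\<lambda>z. proj I (f (emb I z) * p) - h z) holomorphic_on ball 0 1"
          by (intro holomorphic_on_diff hol[OF I] holh)
        show "U \<subseteq> ball 0 1" "z \<in> ball 0 1" using z by (auto simp: U_def)
        show "0 islimpt U"
          unfolding islimpt_approachable
        proof (intro allI impI)
          fix e :: real assume e: "e > 0"
          show "\<exists>x'\<in>U. x' \<noteq> 0 \<and> dist x' 0 < e"
            by (rule bexI[of _ "of_real (min (e / 2) (1 / 2))"]) (use e in \<open>auto simp: U_def\<close>)
        qed
        show "proj I (f (emb I w) * p) - h w = 0" if wU: "w \<in> U" for w
        proof -
          obtain x where x: "w = of_real x" "\<bar>x\<bar> < 1" using wU by (auto simp: U_def)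
          have "(\<lambda>n. emb I w ^ n * a n) sums f (emb I w)"
            using fi[of "of_real x"] x by simp
          then show ?thesis by (simp add: h_def sums_iff)
        qed
      qed auto
      then show ?thesis by (simp add: h_def qz)
    qed
    note * = this
    define D where "D = f q - (\<Sum>n. q ^ n * a n)"
    have "qRe (D * p) = 0" for p
      using arg_cong[OF *[of p], of Re] by (simp add: D_def left_diff_distrib)
    from this[of "qcnj D"] have "D = 0" by (simp add: qcnj_mult_self del: of_real_power)
    then show ?thesis
      using summable_sums[OF sq[OF z]] by (simp add: D_def qz)
  qed
  with sm that show ?thesis by blast
qed

lemma continuous_on_quat_power_series:
  assumes "summable (\<lambda>n. norm (a n) * r ^ n)" and "0 \<le> r"
  shows "continuous_on (cball 0 r) (\<lambda>q::quat. \<Sum>n. q ^ n * a n)"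
proof (rule uniform_limit_theorem)
  show "uniform_limit (cball 0 r) (\<lambda>n q. \<Sum>k<n. q ^ k * a k) (\<lambda>q. \<Sum>n. q ^ n * a n) sequentially"
  proof (rule Weierstrass_m_test[OF _ assms(1)])
    show "norm (q ^ n * a n) \<le> norm (a n) * r ^ n" if "q \<in> cball 0 r" for n q
      using that assms(2) by (simp add: norm_mult norm_power mult.commute[of "norm (a n)"] mult_right_mono power_mono)
  qed
qed (auto intro!: always_eventually continuous_intros)

section \<open>Bounded holomorphic functions on the unit disc\<close>

lemma disc_identity:
  fixes a b :: complex
  shows "(cmod (1 - cnj a * b))\<^sup>2 - (cmod (b - a))\<^sup>2 = (1 - (cmod a)\<^sup>2) * (1 - (cmod b)\<^sup>2)"
  by (simp only: cmod_power2) (simp add: power2_eq_square algebra_simps)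

lemma Schwarz_Pick:
  assumes holf: "f holomorphic_on ball 0 1"
    and le: "\<And>z. cmod z < 1 \<Longrightarrow> cmod (f z) \<le> 1"
    and z: "cmod z < 1" and w: "cmod w < 1"
  shows "cmod (f z - f w) * cmod (1 - cnj w * z) \<le> cmod (z - w) * cmod (1 - cnj (f w) * f z)"
proof (cases "\<exists>u. cmod u < 1 \<and> cmod (f u) = 1")
  case True
  then obtain u where u: "cmod u < 1" "cmod (f u) = 1" by auto
  have "f constant_on ball 0 1"
    by (rule maximum_modulus_principle[OF holf, of "ball 0 1" u]) (use u le in auto)
  then have "f z = f w" using z w by (auto simp: constant_on_def)
  then show ?thesis by simp
next
  case False
  then have lt: "cmod (f u) < 1" if "cmod u < 1" for u
    using le[OF that] that by force
  define g where "g = Moebius_function 0 (f w) \<circ> (f \<circ> Moebius_function 0 (- w))"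
  define u where "u = Moebius_function 0 w z"
  have w': "cmod (- w) < 1" using w by simp
  have "(f \<circ> Moebius_function 0 (- w)) holomorphic_on ball 0 1"
    by (rule holomorphic_on_compose_gen[OF Moebius_function_holomorphic[OF w'] holf])
       (use Moebius_function_norm_lt_1[OF w'] in auto)
  then have holg: "g holomorphic_on ball 0 1"
    unfolding g_def
    by (rule holomorphic_on_compose_gen[OF _ Moebius_function_holomorphic[OF lt[OF w]]])
       (use Moebius_function_norm_lt_1[OF w'] lt in auto)
  have g0: "g 0 = 0"
    by (simp add: g_def Moebius_function_of_zero Moebius_function_eq_zero)
  have gl: "cmod (g v) < 1" if "cmod v < 1" for v
    using Moebius_function_norm_lt_1[OF w' that] by (simp add: g_def Moebius_function_norm_lt_1 lt w)
  have u: "cmod u < 1" unfolding u_def by (rule Moebius_function_norm_lt_1[OF w z])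
  have uz: "Moebius_function 0 (- w) u = z"
    unfolding u_def by (rule Moebius_function_compose) (use w z in auto)
  have "cmod (g u) \<le> cmod u"
    by (rule Schwarz_Lemma(1)[OF holg g0 gl u])
  then have "cmod ((f z - f w) / (1 - cnj (f w) * f z)) \<le> cmod ((z - w) / (1 - cnj w * z))"
    by (simp add: g_def uz) (simp add: Moebius_function_simple u_def)
  moreover have "1 - cnj w * z \<noteq> 0" "1 - cnj (f w) * f z \<noteq> 0"
  proof -
    have *: "1 - cnj a * b \<noteq> 0" if "cmod a < 1" "cmod b < 1" for a b
    proof -
      have "cmod (cnj a * b) < 1"
        using that mult_strict_mono[of "cmod a" 1 "cmod b" 1] by (auto simp: norm_mult)
      then show ?thesis by force
    qed
    show "1 - cnj w * z \<noteq> 0" "1 - cnj (f w) * f z \<noteq> 0" using * w z lt by auto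
  qed
  ultimately show ?thesis by (simp add: norm_divide divide_simps mult.commute split: if_splits)
qed

text \<open>
  By the Schwarz-Pick lemma \<open>f z\<close> lies in a disc centred on the real axis, whose leftmost point is the
  bound.
\<close>

lemma Schwarz_Pick_Re_ge:
  assumes holf: "f holomorphic_on ball 0 1"
    and le: "\<And>z. cmod z < 1 \<Longrightarrow> cmod (f z) \<le> 1"
    and f0: "f 0 = of_real \<alpha>" and \<alpha>: "0 < \<alpha>" "\<alpha> < 1" and z: "cmod z < 1"
  shows "(\<alpha> - cmod z) / (1 - \<alpha> * cmod z) \<le> Re (f z)"
proof (rule ccontr)
  assume neg: "\<not> ?thesis"
  define r x s where "r = cmod z" and "x = Re (f z)" and "s = (cmod (f z))\<^sup>2"
  have r: "0 \<le> r" "r < 1" using z by (auto simp: r_def)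
  have ra: "\<alpha> * r < 1" using mult_strict_mono[of \<alpha> 1 r 1] \<alpha> r by auto
  have "cmod (f z - f 0) \<le> r * cmod (1 - cnj (f 0) * f z)"
    using Schwarz_Pick[OF holf le z, of 0] by (simp add: r_def)
  then have "(cmod (f z - f 0))\<^sup>2 \<le> r\<^sup>2 * (cmod (1 - cnj (f 0) * f z))\<^sup>2"
    by (metis norm_ge_zero power_mono power_mult_distrib)
  moreover have "(cmod (f z - f 0))\<^sup>2 = s - 2 * \<alpha> * x + \<alpha>\<^sup>2"
    by (simp only: cmod_power2 s_def x_def f0) (simp add: power2_eq_square algebra_simps)
  moreover have "(cmod (1 - cnj (f 0) * f z))\<^sup>2 = 1 - 2 * \<alpha> * x + \<alpha>\<^sup>2 * s"
    by (simp only: cmod_power2 s_def x_def f0) (simp add: power2_eq_square algebra_simps)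
  ultimately have "s - 2 * \<alpha> * x + \<alpha>\<^sup>2 \<le> r\<^sup>2 * (1 - 2 * \<alpha> * x + \<alpha>\<^sup>2 * s)"
    by (simp only:)
  then have "(1 - r\<^sup>2 * \<alpha>\<^sup>2) * s \<le> 2 * \<alpha> * x * (1 - r\<^sup>2) - \<alpha>\<^sup>2 + r\<^sup>2"
    by (simp add: algebra_simps)
  moreover have "x\<^sup>2 \<le> s" by (simp only: s_def x_def cmod_power2) simp
  moreover have "0 \<le> 1 - r\<^sup>2 * \<alpha>\<^sup>2"
    using ra r \<alpha> by (metis diff_ge_0_iff_ge less_eq_real_def mult.commute mult_nonneg_nonneg power_le_one power_mult_distrib)
  ultimately have "(1 - r\<^sup>2 * \<alpha>\<^sup>2) * x\<^sup>2 \<le> 2 * \<alpha> * x * (1 - r\<^sup>2) - \<alpha>\<^sup>2 + r\<^sup>2"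
    using mult_left_mono[of "x\<^sup>2" s "1 - r\<^sup>2 * \<alpha>\<^sup>2"] by linarith
  then have le0: "((1 - \<alpha> * r) * x - (\<alpha> - r)) * ((1 + \<alpha> * r) * x - (\<alpha> + r)) \<le> 0"
    by (simp add: algebra_simps power2_eq_square)
  have "x < (\<alpha> - r) / (1 - \<alpha> * r)" using neg by (simp add: x_def r_def)
  then have n1: "(1 - \<alpha> * r) * x - (\<alpha> - r) < 0"
    using ra by (simp add: field_simps)
  have "(\<alpha> - r) * (1 + \<alpha> * r) \<le> (\<alpha> + r) * (1 - \<alpha> * r)"
    using \<alpha> r mult_mono[of \<alpha> 1 \<alpha> 1] mult_left_mono[of "\<alpha> * \<alpha>" 1 r] by (simp add: algebra_simps)
  moreover have "(1 - \<alpha> * r) * x * (1 + \<alpha> * r) < (\<alpha> - r) * (1 + \<alpha> * r)"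
    using n1 \<alpha> r by (intro mult_strict_right_mono) (auto simp: add_pos_nonneg)
  ultimately have "((1 + \<alpha> * r) * x) * (1 - \<alpha> * r) < (\<alpha> + r) * (1 - \<alpha> * r)"
    by (simp add: mult_ac)
  then have "(1 + \<alpha> * r) * x - (\<alpha> + r) < 0" using ra by simp
  with n1 le0 show False using mult_neg_neg by (meson not_le)
qed

section \<open>Bonk's distortion theorem\<close>

lemma has_real_derivative_Re:
  assumes "(g has_vector_derivative d) (at t)"
  shows "((\<lambda>t. Re (g t)) has_real_derivative Re d) (at t)"
  using bounded_linear.has_vector_derivative[OF bounded_linear_Re assms]
  by (simp add: has_real_derivative_iff_has_vector_derivative)

lemma has_real_derivative_Im:
  assumes "(g has_vector_derivative d) (at t)"
  shows "((\<lambda>t. Im (g t)) has_real_derivative Im d) (at t)"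
  using bounded_linear.has_vector_derivative[OF bounded_linear_Im assms]
  by (simp add: has_real_derivative_iff_has_vector_derivative)

text \<open>
  The function \<open>|h|\<close> touches its majorant \<open>1 / (1 - |z|\<^sup>2)\<close> at the origin, so its first order term
  vanishes.
\<close>

lemma bonk_deriv_0:
  assumes holh: "h holomorphic_on ball 0 1" and h0: "h 0 = 1"
    and le: "\<And>z. cmod z < 1 \<Longrightarrow> (1 - (cmod z)\<^sup>2) * cmod (h z) \<le> 1"
  shows "deriv h 0 = 0"
proof -
  have dh: "(h has_field_derivative deriv h 0) (at 0)"
    using holomorphic_derivI[OF holh open_ball, of 0] by simp
  have "Re (e * deriv h 0) = 0" if e: "cmod e = 1" for e
  proof -
    define p where "p t = 1 / (1 - t\<^sup>2) - Re (h (of_real t * e))" for t :: real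
    have "((\<lambda>t::real. h (of_real t * e)) has_vector_derivative (e * deriv h 0)) (at 0)"
    proof -
      have "((\<lambda>t::real. of_real t * e) has_vector_derivative e) (at 0)"
        by (auto intro!: derivative_eq_intros)
      from field_vector_diff_chain_at[OF this, of h "deriv h 0"] dh show ?thesis by (simp add: o_def)
    qed
    then have d1: "((\<lambda>t. Re (h (of_real t * e))) has_real_derivative Re (e * deriv h 0)) (at 0)"
      by (rule has_real_derivative_Re)
    have d2: "((\<lambda>t. 1 / (1 - t\<^sup>2)) has_real_derivative 0) (at 0)"
      by (auto intro!: derivative_eq_intros)
    have dp: "(p has_real_derivative (- Re (e * deriv h 0))) (at 0)"
      using DERIV_diff[OF d2 d1] unfolding p_def[abs_def] by simp
    have "p 0 \<le> p t" if "\<bar>0 - t\<bar> < 1" for t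
    proof -
      have t2: "t\<^sup>2 < 1" using that by (simp add: abs_square_less_1)
      have "(1 - t\<^sup>2) * cmod (h (of_real t * e)) \<le> 1"
        using le[of "of_real t * e"] that by (simp add: norm_mult e)
      then have "cmod (h (of_real t * e)) \<le> 1 / (1 - t\<^sup>2)"
        using t2 by (simp add: field_simps)
      then show ?thesis using complex_Re_le_cmod[of "h (of_real t * e)"] by (simp add: p_def h0)
    qed
    then show ?thesis using DERIV_local_min[OF dp, of 1] by simp
  qed
  from this[of 1] this[of \<i>] show ?thesis by (simp add: complex_eq_iff)
qed

text \<open>
  The substitution \<open>z = Z v\<close> maps the unit disc onto a disc that has the origin as boundary point
  \<open>v = 1\<close>, and \<open>psi v = 4 h (Z v) / (3 - v)\<^sup>2\<close> is bounded by \<open>1\<close> there. Since \<open>psi 1 = 1\<close> and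
  \<open>psi' 1 = 1\<close>, Julia's lemma at the boundary point \<open>1\<close> gives \<open>Re (psi u) \<ge> u\<close> for \<open>0 \<le> u < 1\<close>.
  For Bonk's extremal function, \<open>psi\<close> is the identity.
\<close>

lemma bonk_distortion_real:
  assumes holh: "h holomorphic_on ball 0 1" and h0: "h 0 = 1"
    and le: "\<And>z. cmod z < 1 \<Longrightarrow> (1 - (cmod z)\<^sup>2) * cmod (h z) \<le> 1"
    and u: "0 \<le> u" "u < 1"
  shows "u * (3 - u)\<^sup>2 / 4 \<le> Re (h (of_real (sqrt 3 * (1 - u) / (3 - u))))"
proof -
  define Z where "Z v = of_real (sqrt 3) * (1 - v) / (3 - v)" for v :: complex
  define psi where "psi v = 4 * h (Z v) / (3 - v)\<^sup>2" for v
  have ne: "3 - v \<noteq> 0" if "cmod v \<le> 1" for v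
    using that by force
  have Z2: "(1 - (cmod (Z v))\<^sup>2) * (cmod (3 - v))\<^sup>2 = 6 - 2 * (cmod v)\<^sup>2" if "cmod v \<le> 1" for v
  proof -
    have "(cmod (Z v))\<^sup>2 = 3 * (cmod (1 - v))\<^sup>2 / (cmod (3 - v))\<^sup>2"
      by (simp add: Z_def norm_mult norm_divide power_mult_distrib power_divide)
    then have "(1 - (cmod (Z v))\<^sup>2) * (cmod (3 - v))\<^sup>2 = (cmod (3 - v))\<^sup>2 - 3 * (cmod (1 - v))\<^sup>2"
      using ne[OF that] by (simp add: field_simps)
    also have "\<dots> = 6 - 2 * (cmod v)\<^sup>2"
      by (simp only: cmod_power2) (simp add: power2_eq_square algebra_simps)
    finally show ?thesis .
  qed
  have Z1: "cmod (Z v) < 1" if "cmod v \<le> 1" for v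
  proof -
    have "(cmod v)\<^sup>2 \<le> 1" using that by (simp add: power_le_one)
    then have "0 < (1 - (cmod (Z v))\<^sup>2) * (cmod (3 - v))\<^sup>2" using Z2[OF that] by simp
    then have "(cmod (Z v))\<^sup>2 < 1" by (simp add: zero_less_mult_iff)
    then show ?thesis by (simp add: power_less_one_iff abs_square_less_1)
  qed
  have dZ: "(Z has_field_derivative (of_real (sqrt 3) * (- 2) / (3 - v)\<^sup>2)) (at v)" if "cmod v \<le> 1" for v
    unfolding Z_def using ne[OF that]
    by (auto intro!: derivative_eq_intros simp: divide_simps power2_eq_square) (simp add: algebra_simps)
  have dpsi: "(psi has_field_derivative
      (4 * (deriv h (Z v) * (of_real (sqrt 3) * (- 2) / (3 - v)\<^sup>2)) / (3 - v)\<^sup>2 + 8 * h (Z v) / (3 - v) ^ 3)) (at v)"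
    if v: "cmod v \<le> 1" for v
  proof -
    have "(h has_field_derivative deriv h (Z v)) (at (Z v))"
      using holomorphic_derivI[OF holh open_ball, of "Z v"] Z1[OF v] by simp
    from DERIV_chain2[OF this dZ[OF v]]
    have "((\<lambda>v. h (Z v)) has_field_derivative deriv h (Z v) * (of_real (sqrt 3) * (- 2) / (3 - v)\<^sup>2)) (at v)" .
    note dhZ = this
    define w H H' where "w = 3 - v" and "H = h (Z v)"
      and "H' = deriv h (Z v) * (of_real (sqrt 3) * (- 2) / (3 - v)\<^sup>2)"
    have w: "w \<noteq> 0" using ne[OF v] by (simp add: w_def)
    have d3: "((\<lambda>v. (3 - v)\<^sup>2) has_field_derivative (- 2 * w)) (at v)"
      by (auto intro!: derivative_eq_intros simp: w_def)
    have "(psi has_field_derivative ((4 * H' * w\<^sup>2 - 4 * H * (- 2 * w)) / (w\<^sup>2 * w\<^sup>2))) (at v)"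
      using DERIV_divide[OF DERIV_cmult[OF dhZ, of 4] d3] w
      by (simp add: psi_def[abs_def] w_def H_def H'_def)
    moreover have "(4 * H' * w\<^sup>2 - 4 * H * (- 2 * w)) / (w\<^sup>2 * w\<^sup>2) = 4 * H' / w\<^sup>2 + 8 * H / w ^ 3"
      using w by (simp add: divide_simps power2_eq_square power3_eq_cube) (simp add: algebra_simps)
    ultimately show ?thesis unfolding w_def H_def H'_def by simp
  qed
  have holpsi: "psi holomorphic_on ball 0 1"
    unfolding holomorphic_on_open[OF open_ball]
    by (intro ballI exI, rule dpsi) simp
  have psi_le: "cmod (psi v) \<le> 1" if v: "cmod v < 1" for v
  proof -
    have v1: "cmod v \<le> 1" using v by simp
    have "(cmod v)\<^sup>2 \<le> 1" using v by (simp add: power_le_one)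
    then have "4 * ((1 - (cmod (Z v))\<^sup>2) * cmod (h (Z v))) \<le> (1 - (cmod (Z v))\<^sup>2) * (cmod (3 - v))\<^sup>2"
      using le[OF Z1[OF v1]] Z2[OF v1] by linarith
    moreover have "0 < 1 - (cmod (Z v))\<^sup>2"
      using Z1[OF v1] by (simp add: power_less_one_iff abs_square_less_1)
    ultimately have "4 * cmod (h (Z v)) \<le> (cmod (3 - v))\<^sup>2"
      by (metis mult.assoc mult.left_commute mult_le_cancel_left_pos)
    then show ?thesis
      using ne[OF v1] by (simp add: psi_def norm_divide norm_mult norm_power divide_simps)
  qed
  have psi1: "psi 1 = 1" by (simp add: psi_def Z_def h0)
  have "(psi has_field_derivative 1) (at 1)"
    using dpsi[of 1] bonk_deriv_0[OF holh h0 le] by (simp add: Z_def h0)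
  then have "((\<lambda>t::real. psi (of_real t)) has_vector_derivative 1) (at 1)"
    using has_vector_derivative_real_field[of psi 1 1] by simp
  then have dN: "((\<lambda>t::real. (Re (psi (of_real t)))\<^sup>2 + (Im (psi (of_real t)))\<^sup>2) has_real_derivative 2) (at 1)"
    by (auto intro!: derivative_eq_intros has_real_derivative_Re has_real_derivative_Im simp: psi1)
  define N where "N t = (cmod (psi (of_real t)))\<^sup>2" for t :: real
  have "(N has_real_derivative 2) (at 1)"
    using dN unfolding N_def[abs_def] cmod_power2 .
  then have "((\<lambda>t. (N t - 1) / (t - 1)) \<longlongrightarrow> 2) (at_left 1)"
    unfolding has_field_derivative_iff by (auto simp: N_def psi1 intro: tendsto_mono[OF at_le])
  then have lim1: "((\<lambda>t. (1 - N t) / (1 - t)) \<longlongrightarrow> 2) (at_left 1)"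
    by (rule Lim_transform_eventually) (auto intro!: always_eventually simp: divide_simps algebra_simps)
  define y where "y = psi (of_real u)"
  have lim_psi: "((\<lambda>t::real. psi (of_real t)) \<longlongrightarrow> 1) (at_left 1)"
  proof -
    have "isCont (\<lambda>t::real. psi (of_real t)) 1"
      using \<open>((\<lambda>t::real. psi (of_real t)) has_vector_derivative 1) (at 1)\<close>
      by (rule has_vector_derivative_continuous)
    then show ?thesis by (auto simp: isCont_def psi1 intro: tendsto_mono[OF at_le])
  qed
  have lim2: "((\<lambda>t. (1 + t) * (1 - u\<^sup>2) * (cmod (1 - cnj (psi (of_real t)) * y))\<^sup>2) \<longlongrightarrow>
       (1 + 1) * (1 - u\<^sup>2) * (cmod (1 - cnj 1 * y))\<^sup>2) (at_left 1)"
    by (intro tendsto_intros lim_psi)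
  have lim3: "((\<lambda>t. (1 - N t) / (1 - t) * ((1 - (cmod y)\<^sup>2) * (1 - t * u)\<^sup>2)) \<longlongrightarrow>
       2 * ((1 - (cmod y)\<^sup>2) * (1 - 1 * u)\<^sup>2)) (at_left 1)"
    by (intro tendsto_intros lim1)
  \<comment> \<open>Schwarz-Pick for the points \<open>u\<close> and \<open>t\<close>; Julia's inequality is the limit \<open>t \<rightarrow> 1\<close>.\<close>
  have ev: "eventually (\<lambda>t. (1 + t) * (1 - u\<^sup>2) * (cmod (1 - cnj (psi (of_real t)) * y))\<^sup>2
      \<le> (1 - N t) / (1 - t) * ((1 - (cmod y)\<^sup>2) * (1 - t * u)\<^sup>2)) (at_left 1)"
  proof -
    have "eventually (\<lambda>t. t \<in> {0<..<1}) (at_left (1::real))"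
      by (rule eventually_at_left_real) simp
    then show ?thesis
    proof eventually_elim
      case (elim t)
      define A B where "A = (cmod (1 - cnj (psi (of_real t)) * y))\<^sup>2" and "B = (1 - t * u)\<^sup>2"
      have t1: "cmod (of_real t) < 1" and u1: "cmod (of_real u) < 1" using elim u by auto
      have "cmod (y - psi (of_real t)) * cmod (1 - cnj (of_real t) * of_real u)
          \<le> cmod (of_real u - of_real t) * cmod (1 - cnj (psi (of_real t)) * y)"
        unfolding y_def by (rule Schwarz_Pick[OF holpsi psi_le u1 t1])
      then have "(cmod (y - psi (of_real t)))\<^sup>2 * (cmod (1 - cnj (of_real t) * of_real u))\<^sup>2
          \<le> (cmod (of_real u - of_real t))\<^sup>2 * A"
        unfolding A_def by (metis mult_nonneg_nonneg norm_ge_zero power_mono power_mult_distrib)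
      moreover have "(cmod (1 - cnj (of_real t) * of_real u))\<^sup>2 = B"
        by (simp only: cmod_power2 B_def) simp
      moreover have "(cmod (of_real u - of_real t))\<^sup>2 = B - (1 - t\<^sup>2) * (1 - u\<^sup>2)"
        by (simp only: cmod_power2 B_def) (simp add: power2_eq_square algebra_simps)
      moreover have "(cmod (y - psi (of_real t)))\<^sup>2 = A - (1 - N t) * (1 - (cmod y)\<^sup>2)"
        using disc_identity[of "psi (of_real t)" y] by (simp add: A_def N_def)
      ultimately have "(1 - t\<^sup>2) * (1 - u\<^sup>2) * A \<le> (1 - N t) * (1 - (cmod y)\<^sup>2) * B"
        by (simp add: algebra_simps)
      moreover have "1 - t\<^sup>2 = (1 - t) * (1 + t)" by (simp add: power2_eq_square algebra_simps)
      ultimately have "(1 - t) * ((1 + t) * (1 - u\<^sup>2) * A) \<le> (1 - N t) * ((1 - (cmod y)\<^sup>2) * B)"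
        by (simp add: mult.assoc)
      then show ?case using elim unfolding A_def[symmetric] B_def[symmetric]
        by (simp add: pos_le_divide_eq mult.commute)
    qed
  qed
  have "(1 + 1) * (1 - u\<^sup>2) * (cmod (1 - cnj 1 * y))\<^sup>2 \<le> 2 * ((1 - (cmod y)\<^sup>2) * (1 - 1 * u)\<^sup>2)"
    by (rule tendsto_le[OF _ lim3 lim2 ev]) simp
  then have "(1 - u) * ((1 + u) * (cmod (1 - y))\<^sup>2) \<le> (1 - u) * ((1 - u) * (1 - (cmod y)\<^sup>2))"
    by (simp add: power2_eq_square algebra_simps)
  then have J: "(1 + u) * (cmod (1 - y))\<^sup>2 \<le> (1 - u) * (1 - (cmod y)\<^sup>2)"
    using u by simp
  define x where "x = Re y"
  have "(cmod (1 - y))\<^sup>2 = 1 - 2 * x + (cmod y)\<^sup>2"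
    by (simp only: cmod_power2) (simp add: power2_eq_square algebra_simps x_def)
  with J have "(cmod y)\<^sup>2 + u \<le> x * (1 + u)" by (simp add: algebra_simps)
  moreover have "x\<^sup>2 \<le> (cmod y)\<^sup>2" by (simp only: cmod_power2 x_def) simp
  ultimately have le0: "(x - 1) * (x - u) \<le> 0" by (simp add: power2_eq_square algebra_simps)
  have "u \<le> x"
  proof (rule ccontr)
    assume "\<not> u \<le> x"
    then have "0 < (x - 1) * (x - u)" using u by (intro mult_neg_neg) auto
    with le0 show False by simp
  qed
  moreover have "y = of_real (4 / (3 - u)\<^sup>2) * h (of_real (sqrt 3 * (1 - u) / (3 - u)))"
    by (simp add: y_def psi_def Z_def)
  then have "x = 4 / (3 - u)\<^sup>2 * Re (h (of_real (sqrt 3 * (1 - u) / (3 - u))))"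
    unfolding x_def by (simp only: Re_complex_of_real Im_complex_of_real times_complex.sel mult_zero_left diff_zero)
  ultimately show ?thesis using u by (simp add: field_simps)
qed

theorem bonk_distortion:
  assumes holh: "h holomorphic_on ball 0 1" and h0: "h 0 = 1"
    and le: "\<And>z. cmod z < 1 \<Longrightarrow> (1 - (cmod z)\<^sup>2) * cmod (h z) \<le> 1"
    and z: "cmod z \<le> 1 / sqrt 3"
  shows "(1 - sqrt 3 * cmod z) / (1 - cmod z / sqrt 3) ^ 3 \<le> Re (h z)"
proof (cases "z = 0")
  case True
  then show ?thesis by (simp add: h0)
next
  case False
  define r where "r = cmod z"
  have r: "0 < r" "r \<le> 1 / sqrt 3" using False z by (auto simp: r_def)
  define k where "k w = h (sgn z * w)" for w
  have n: "cmod (sgn z * w) = cmod w" for w using False by (simp add: norm_mult norm_sgn)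
  have holk: "k holomorphic_on ball 0 1"
  proof -
    have "(h \<circ> (\<lambda>w. sgn z * w)) holomorphic_on ball 0 1"
      by (rule holomorphic_on_compose_gen[OF _ holh]) (auto simp: n intro!: holomorphic_intros)
    then show ?thesis by (simp add: k_def[abs_def] o_def)
  qed
  have kle: "(1 - (cmod w)\<^sup>2) * cmod (k w) \<le> 1" if "cmod w < 1" for w
    using le[of "sgn z * w"] that by (simp add: k_def n)
  define s where "s = sqrt 3"
  have s: "s * s = 3" "s > 1" by (simp_all add: s_def)
  have rs: "r * s \<le> 1" using r by (simp add: s_def field_simps)
  have "r * 1 < r * s" using s r by (intro mult_strict_left_mono) auto
  then have r2: "r < s" using rs s by linarith
  \<comment> \<open>The solution of \<open>s (1 - u) / (3 - u) = r\<close>.\<close>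
  define u where "u = (s - 3 * r) / (s - r)"
  have "3 * r \<le> s" using mult_right_mono[of "r * s" 1 s] rs s by (simp add: mult.assoc)
  then have u: "0 \<le> u" "u < 1" using r r2 by (auto simp: u_def field_simps)
  have 3: "3 - u = 2 * s / (s - r)" "1 - u = 2 * r / (s - r)"
    using r2 by (simp_all add: u_def field_simps)
  have "u * (3 - u)\<^sup>2 / 4 \<le> Re (k (of_real (s * (1 - u) / (3 - u))))"
    using bonk_distortion_real[OF holk _ kle u] h0 by (simp add: k_def s_def)
  also have "s * (1 - u) / (3 - u) = r"
    unfolding 3 using r2 s by (simp add: field_simps)
  also have "k (of_real r) = h z"
    unfolding k_def r_def using False by (simp add: sgn_eq)
  also have "u * (3 - u)\<^sup>2 / 4 = (1 - s * r) / (1 - r / s) ^ 3"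
  proof -
    have "1 - r / s = (s - r) / s" using s by (simp add: field_simps)
    moreover have "s - 3 * r = s * (1 - s * r)" using s by (simp add: algebra_simps)
    ultimately show ?thesis
      unfolding 3 unfolding u_def using r2 s by (simp add: divide_simps power2_eq_square power3_eq_cube)
  qed
  finally show ?thesis by (simp add: s_def r_def)
qed

section \<open>Bounded power series act contractively\<close>

text \<open>
  At \<open>z = x + y \<i>\<close> these are the quaternions \<open>P\<close> and \<open>Q\<close> with \<open>(\<Sum>n. q\<^sup>n x\<^sub>n) = P + I Q\<close> for
  \<open>q = x + y I\<close>, simultaneously for all imaginary units \<open>I\<close>.
\<close>

definition cos_sum :: "complex \<Rightarrow> (nat \<Rightarrow> quat) \<Rightarrow> quat" where
  "cos_sum z x = (\<Sum>n. Re (z ^ n) *\<^sub>R x n)"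

definition sin_sum :: "complex \<Rightarrow> (nat \<Rightarrow> quat) \<Rightarrow> quat" where
  "sin_sum z x = (\<Sum>n. Im (z ^ n) *\<^sub>R x n)"

text \<open>
  The coefficients of the regular product of two power series with coefficients on the right.
\<close>

definition conv :: "(nat \<Rightarrow> quat) \<Rightarrow> (nat \<Rightarrow> quat) \<Rightarrow> nat \<Rightarrow> quat" where
  "conv x y n = (\<Sum>k\<le>n. x k * y (n - k))"

lemma cmod_power_le_1: "cmod z \<le> 1 \<Longrightarrow> cmod (z ^ n) \<le> 1"
  by (simp add: norm_power power_le_one)

lemma summable_cos_sin:
  assumes "summable (\<lambda>n. norm (x n))" and "cmod z \<le> 1"
  shows "summable (\<lambda>n. norm (Re (z ^ n) *\<^sub>R x n))" "summable (\<lambda>n. norm (Im (z ^ n) *\<^sub>R x n))"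
proof -
  have "\<bar>Re (z ^ n)\<bar> \<le> 1" "\<bar>Im (z ^ n)\<bar> \<le> 1" for n
    using cmod_power_le_1[OF assms(2), of n] abs_Re_le_cmod[of "z ^ n"] abs_Im_le_cmod[of "z ^ n"] by auto
  then have "norm (norm (Re (z ^ n) *\<^sub>R x n)) \<le> norm (x n)" "norm (norm (Im (z ^ n) *\<^sub>R x n)) \<le> norm (x n)" for n
    by (auto intro: mult_left_le_one_le)
  then show "summable (\<lambda>n. norm (Re (z ^ n) *\<^sub>R x n))" "summable (\<lambda>n. norm (Im (z ^ n) *\<^sub>R x n))"
    by (auto intro: summable_comparison_test'[OF assms(1)])
qed

lemma emb_series_sums:
  assumes I: "I \<in> imag_sphere" and x: "summable (\<lambda>n. norm (x n))" and z: "cmod z \<le> 1"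
  shows "(\<lambda>n. emb I z ^ n * x n) sums (cos_sum z x + I * sin_sum z x)"
proof -
  have "(\<lambda>n. Re (z ^ n) *\<^sub>R x n + I * (Im (z ^ n) *\<^sub>R x n)) sums (cos_sum z x + I * sin_sum z x)"
    unfolding cos_sum_def sin_sum_def
    by (intro sums_add sums_mult summable_sums summable_norm_cancel[OF summable_cos_sin(1)[OF x z]]
        summable_norm_cancel[OF summable_cos_sin(2)[OF x z]])
  moreover have "emb I z ^ n * x n = Re (z ^ n) *\<^sub>R x n + I * (Im (z ^ n) *\<^sub>R x n)" for n
    unfolding emb_power[OF I, symmetric] by (simp add: emb_def of_real_def distrib_right)
  ultimately show ?thesis by simp
qed

lemma summable_conv:
  assumes "summable (\<lambda>n. norm (x n))" and "summable (\<lambda>n. norm (y n))"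
  shows "summable (\<lambda>n. norm (conv x y n))"
proof -
  have "summable (\<lambda>n. \<Sum>k\<le>n. norm (x k) * norm (y (n - k)))"
    by (rule summable_Cauchy_product) (use assms in auto)
  then show ?thesis
  proof (rule summable_comparison_test')
    show "norm (norm (conv x y n)) \<le> (\<Sum>k\<le>n. norm (x k) * norm (y (n - k)))" for n
      unfolding conv_def using norm_sum[of "\<lambda>k. x k * y (n - k)" "{..n}"] by (simp add: norm_mult)
  qed
qed

lemma
  assumes x: "summable (\<lambda>n. norm (x n))" and y: "summable (\<lambda>n. norm (y n))" and z: "cmod z \<le> 1"
  shows cos_sum_conv: "cos_sum z (conv x y) = cos_sum z x * cos_sum z y - sin_sum z x * sin_sum z y"
    and sin_sum_conv: "sin_sum z (conv x y) = sin_sum z x * cos_sum z y + cos_sum z x * sin_sum z y"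
proof -
  note sx = summable_cos_sin[OF x z] and sy = summable_cos_sin[OF y z]
  have split: "z ^ n = z ^ k * z ^ (n - k)" if "k \<le> n" for n k
    using that by (simp add: power_add[symmetric])
  have "(\<lambda>n. (\<Sum>k\<le>n. (Re (z ^ k) *\<^sub>R x k) * (Re (z ^ (n - k)) *\<^sub>R y (n - k)))
       - (\<Sum>k\<le>n. (Im (z ^ k) *\<^sub>R x k) * (Im (z ^ (n - k)) *\<^sub>R y (n - k))))
     sums (cos_sum z x * cos_sum z y - sin_sum z x * sin_sum z y)"
    unfolding cos_sum_def sin_sum_def by (intro sums_diff Cauchy_product_sums sx sy)
  also have "(\<lambda>n. (\<Sum>k\<le>n. (Re (z ^ k) *\<^sub>R x k) * (Re (z ^ (n - k)) *\<^sub>R y (n - k)))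
       - (\<Sum>k\<le>n. (Im (z ^ k) *\<^sub>R x k) * (Im (z ^ (n - k)) *\<^sub>R y (n - k))))
     = (\<lambda>n. Re (z ^ n) *\<^sub>R conv x y n)"
    unfolding conv_def scaleR_sum_right sum_subtractf[symmetric]
    by (intro ext sum.cong refl) (simp add: split algebra_simps)
  finally show "cos_sum z (conv x y) = cos_sum z x * cos_sum z y - sin_sum z x * sin_sum z y"
    by (simp add: cos_sum_def sums_iff)
  have "(\<lambda>n. (\<Sum>k\<le>n. (Im (z ^ k) *\<^sub>R x k) * (Re (z ^ (n - k)) *\<^sub>R y (n - k)))
       + (\<Sum>k\<le>n. (Re (z ^ k) *\<^sub>R x k) * (Im (z ^ (n - k)) *\<^sub>R y (n - k))))
     sums (sin_sum z x * cos_sum z y + cos_sum z x * sin_sum z y)"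
    unfolding cos_sum_def sin_sum_def by (intro sums_add Cauchy_product_sums sx sy)
  also have "(\<lambda>n. (\<Sum>k\<le>n. (Im (z ^ k) *\<^sub>R x k) * (Re (z ^ (n - k)) *\<^sub>R y (n - k)))
       + (\<Sum>k\<le>n. (Re (z ^ k) *\<^sub>R x k) * (Im (z ^ (n - k)) *\<^sub>R y (n - k))))
     = (\<lambda>n. Im (z ^ n) *\<^sub>R conv x y n)"
    unfolding conv_def scaleR_sum_right sum.distrib[symmetric]
    by (intro ext sum.cong refl) (simp add: split algebra_simps)
  finally show "sin_sum z (conv x y) = sin_sum z x * cos_sum z y + cos_sum z x * sin_sum z y"
    by (simp add: sin_sum_def sums_iff)
qed

text \<open>
  Evaluation of the regular product. For noncommuting values this is not the product of the values:
  only the value \<open>c\<close> of the first factor is inserted between \<open>q\<^sup>n\<close> and \<open>y\<^sub>n\<close>.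
\<close>

lemma conv_eval_sums:
  assumes x: "summable (\<lambda>n. norm (x n))" and y: "summable (\<lambda>n. norm (y n))" and q: "norm q \<le> 1"
    and c: "(\<lambda>n. q ^ n * x n) sums c"
  shows "(\<lambda>n. q ^ n * conv x y n) sums (\<Sum>n. q ^ n * (c * y n))"
proof -
  obtain I z where I: "I \<in> imag_sphere" and qz: "q = emb I z" by (rule emb_surj)
  have z: "cmod z \<le> 1" using q by (simp add: qz norm_emb[OF I])
  note II = imag_sphereD(1)[OF I]
  have cc: "c = cos_sum z x + I * sin_sum z x"
    using emb_series_sums[OF I x z] c sums_unique2 unfolding qz by blast
  have cy: "summable (\<lambda>n. norm (c * y n))" using y by (simp add: norm_mult summable_mult)
  have "cos_sum z (\<lambda>n. c * y n) = c * cos_sum z y" "sin_sum z (\<lambda>n. c * y n) = c * sin_sum z y"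
    using suminf_mult[OF summable_norm_cancel[OF summable_cos_sin(1)[OF y z]], of c]
      suminf_mult[OF summable_norm_cancel[OF summable_cos_sin(2)[OF y z]], of c]
    by (simp_all add: cos_sum_def sin_sum_def)
  then have "(\<Sum>n. q ^ n * (c * y n)) = c * cos_sum z y + I * (c * sin_sum z y)"
    using emb_series_sums[OF I cy z] by (simp add: sums_iff qz)
  also have "\<dots> = (cos_sum z x * cos_sum z y - sin_sum z x * sin_sum z y)
      + I * (sin_sum z x * cos_sum z y + cos_sum z x * sin_sum z y)"
  proof -
    have "I * (I * w) = - w" for w by (simp add: mult.assoc[symmetric] II)
    then show ?thesis unfolding cc by (simp add: algebra_simps)
  qed
  also have "\<dots> = cos_sum z (conv x y) + I * sin_sum z (conv x y)"
    by (simp add: cos_sum_conv[OF x y z] sin_sum_conv[OF x y z])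
  finally show ?thesis
    using emb_series_sums[OF I summable_conv[OF x y] z] by (simp add: qz)
qed

text \<open>
  A bound for \<open>P + K Q\<close> for all imaginary units \<open>K\<close> is used at the maximizing \<open>K\<close>, where it says that
  \<open>|P|\<^sup>2 + |Q|\<^sup>2 + 2 |V| \<le> 1\<close> for the imaginary part \<open>V\<close> of \<open>Q (conj P)\<close>. Twice \<open>|V|\<close> also bounds
  the mixed terms on the left-hand side.
\<close>

lemma sphere_contraction:
  fixes P Q A B :: quat
  assumes le: "\<And>K. K \<in> imag_sphere \<Longrightarrow> norm (P + K * Q) \<le> 1"
  shows "(norm (P * A - Q * B))\<^sup>2 + (norm (Q * A + P * B))\<^sup>2 \<le> (norm A)\<^sup>2 + (norm B)\<^sup>2"
proof -
  define V where "V = Q * qcnj P - of_real (qRe (Q * qcnj P))"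
  define V' where "V' = qcnj P * Q - of_real (qRe (qcnj P * Q))"
  have nV: "(norm V)\<^sup>2 = (norm P)\<^sup>2 * (norm Q)\<^sup>2 - (qRe (Q * qcnj P))\<^sup>2"
  proof -
    have "(norm V)\<^sup>2 = (norm (Q * qcnj P))\<^sup>2 - (qRe (Q * qcnj P))\<^sup>2"
      unfolding V_def quat_norm_power2[of "Q * qcnj P"] quat_norm_power2[of "_ - _"] by simp
    then show ?thesis by (simp add: norm_mult power_mult_distrib mult.commute)
  qed
  have "(norm V')\<^sup>2 = (norm P)\<^sup>2 * (norm Q)\<^sup>2 - (qRe (qcnj P * Q))\<^sup>2"
  proof -
    have "(norm V')\<^sup>2 = (norm (qcnj P * Q))\<^sup>2 - (qRe (qcnj P * Q))\<^sup>2"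
      unfolding V'_def quat_norm_power2[of "qcnj P * Q"] quat_norm_power2[of "_ - _"] by simp
    then show ?thesis by (simp add: norm_mult power_mult_distrib mult.commute)
  qed
  then have VV': "norm V' = norm V"
    using nV qRe_mult_commute[of Q "qcnj P"] by (metis norm_ge_zero power2_eq_imp_eq)
  have nPQ: "(norm (P + K * Q))\<^sup>2 = (norm P)\<^sup>2 + (norm Q)\<^sup>2 + 2 * qRe (K * V)" if "K \<in> imag_sphere" for K
  proof -
    have "(norm (P + K * Q))\<^sup>2 = (norm P)\<^sup>2 + (norm (K * Q))\<^sup>2 + 2 * inner P (K * Q)"
      by (simp add: power2_norm_eq_inner inner_add_left inner_add_right inner_commute)
    moreover have "norm (K * Q) = norm Q" using imag_sphereD(3)[OF that] by (simp add: norm_mult)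
    moreover have "inner P (K * Q) = qRe (K * (Q * qcnj P))"
      using qinner_eq_Re(2)[of "K * Q" P] by (simp add: inner_commute[of P] mult.assoc del: quat_ring_sel)
    moreover have "\<dots> = qRe (K * V)"
      using imag_sphereD(2)[OF that] by (simp add: V_def)
    ultimately show ?thesis by simp
  qed
  have V1: "(norm P)\<^sup>2 + (norm Q)\<^sup>2 + 2 * norm V \<le> 1"
  proof (cases "V = 0")
    case True
    have "Quat 0 1 0 0 \<in> imag_sphere" by (simp add: imag_sphere_iff norm_quat_def)
    then show ?thesis
      using nPQ[of "Quat 0 1 0 0"] power_le_one[OF norm_ge_zero le, of "Quat 0 1 0 0" 2] True by simp
  next
    case False
    define K where "K = (- 1 / norm V) *\<^sub>R V"
    have "qRe V = 0" by (simp add: V_def)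
    then have K: "K \<in> imag_sphere" using False by (simp add: imag_sphere_iff K_def)
    have "qRe (V * V) = - (norm V)\<^sup>2"
      unfolding quat_norm_power2 using \<open>qRe V = 0\<close> by (simp add: power2_eq_square)
    then have "qRe (K * V) = norm V"
      using False by (simp add: K_def power2_eq_square field_simps del: quat_ring_sel)
    then show ?thesis
      using nPQ[OF K] power_le_one[OF norm_ge_zero le[OF K], of 2] by simp
  qed
  have c1: "inner (P * A) (Q * B) = qRe (qcnj P * Q * (B * qcnj A))"
    by (simp add: inner_quat_def algebra_simps)
  have c2: "inner (Q * A) (P * B) = qRe (qcnj Q * P * (B * qcnj A))"
    by (simp add: inner_quat_def algebra_simps)
  have "qcnj Q * P - qcnj P * Q = - 2 *\<^sub>R V'"
    by (simp add: V'_def quat_eq_iff)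
  then have c3: "inner (Q * A) (P * B) - inner (P * A) (Q * B) = - 2 * qRe (V' * (B * qcnj A))"
  proof -
    assume e: "qcnj Q * P - qcnj P * Q = - 2 *\<^sub>R V'"
    have "inner (Q * A) (P * B) - inner (P * A) (Q * B) = qRe ((qcnj Q * P - qcnj P * Q) * (B * qcnj A))"
      unfolding c1 c2 left_diff_distrib by (simp only: quat_vector_sel)
    also have "\<dots> = - 2 * qRe (V' * (B * qcnj A))"
      unfolding e mult_scaleR_left by (simp only: quat_vector_sel)
    finally show ?thesis .
  qed
  have "\<bar>qRe (V' * (B * qcnj A))\<bar> \<le> norm V * (norm A * norm B)"
    using qRe_le_norm[of "V' * (B * qcnj A)"] by (simp add: norm_mult VV' mult_ac del: quat_ring_sel)
  also have "2 * \<dots> \<le> norm V * ((norm A)\<^sup>2 + (norm B)\<^sup>2)"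
    using mult_left_mono[OF sum_squares_bound[of "norm A" "norm B"], of "norm V"] by (simp add: algebra_simps)
  finally have c4: "- 2 * qRe (V' * (B * qcnj A)) \<le> norm V * ((norm A)\<^sup>2 + (norm B)\<^sup>2)" by linarith
  have "(norm (P * A - Q * B))\<^sup>2 + (norm (Q * A + P * B))\<^sup>2
     = (norm (P * A))\<^sup>2 + (norm (Q * B))\<^sup>2 + (norm (Q * A))\<^sup>2 + (norm (P * B))\<^sup>2
       + 2 * (inner (Q * A) (P * B) - inner (P * A) (Q * B))"
    by (simp add: power2_norm_eq_inner inner_add_left inner_add_right inner_diff_left inner_diff_right inner_commute)
  also have "\<dots> = ((norm P)\<^sup>2 + (norm Q)\<^sup>2) * ((norm A)\<^sup>2 + (norm B)\<^sup>2)
       + 2 * (- 2 * qRe (V' * (B * qcnj A)))"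
    unfolding c3 norm_mult power_mult_distrib by (simp add: algebra_simps del: quat_ring_sel)
  also have "\<dots> \<le> ((norm P)\<^sup>2 + (norm Q)\<^sup>2 + 2 * norm V) * ((norm A)\<^sup>2 + (norm B)\<^sup>2)"
    using c4 by (simp add: algebra_simps del: quat_ring_sel)
  also have "\<dots> \<le> 1 * ((norm A)\<^sup>2 + (norm B)\<^sup>2)"
    by (rule mult_right_mono[OF V1]) simp
  finally show ?thesis by simp
qed

lemma summable_norm_power2:
  fixes x :: "nat \<Rightarrow> 'a::real_normed_vector"
  assumes "summable (\<lambda>n. norm (x n))"
  shows "summable (\<lambda>n. (norm (x n))\<^sup>2)"
proof -
  define M where "M = (\<Sum>n. norm (x n))"
  have "norm (x n) \<le> M" for n
    using sum_le_suminf[OF assms, of "{n}"] by (simp add: M_def)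
  then have "norm ((norm (x n))\<^sup>2) \<le> M * norm (x n)" for n
    by (simp add: power2_eq_square mult_right_mono)
  then show ?thesis
    by (intro summable_comparison_test'[OF summable_mult[OF assms, of M], of 0])
qed

lemma has_integral_cos_int:
  fixes k :: int
  shows "((\<lambda>t. cos (of_int k * t)) has_integral (if k = 0 then 2 * pi else 0)) {0..2 * pi}"
proof (cases "k = 0")
  case True
  then show ?thesis using has_integral_const_real[of "1::real" 0 "2 * pi"] by simp
next
  case False
  have "((\<lambda>t. cos (of_int k * t)) has_integral
      (sin (of_int k * (2 * pi)) / of_int k - sin (of_int k * 0) / of_int k)) {0..2 * pi}"
    by (rule fundamental_theorem_of_calculus)
       (use False in \<open>auto intro!: derivative_eq_intros simp: has_real_derivative_iff_has_vector_derivative[symmetric]\<close>)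
  moreover have "sin (of_int k * (2 * pi)) = 0"
    using sin_int_2pin[of k] by (simp add: mult.commute)
  ultimately show ?thesis using False by simp
qed

lemma has_integral_trig_polynomial:
  fixes x :: "nat \<Rightarrow> quat"
  shows "((\<lambda>t. (norm (\<Sum>n<N. Re (cis t ^ n) *\<^sub>R x n))\<^sup>2 + (norm (\<Sum>n<N. Im (cis t ^ n) *\<^sub>R x n))\<^sup>2)
     has_integral (2 * pi * (\<Sum>n<N. (norm (x n))\<^sup>2))) {0..2 * pi}"
proof -
  have eq: "(norm (\<Sum>n<N. Re (cis t ^ n) *\<^sub>R x n))\<^sup>2 + (norm (\<Sum>n<N. Im (cis t ^ n) *\<^sub>R x n))\<^sup>2
    = (\<Sum>n<N. \<Sum>m<N. cos (of_int (int n - int m) * t) * inner (x n) (x m))" for t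
  proof -
    have "(norm (\<Sum>n<N. Re (cis t ^ n) *\<^sub>R x n))\<^sup>2 + (norm (\<Sum>n<N. Im (cis t ^ n) *\<^sub>R x n))\<^sup>2
      = (\<Sum>n<N. \<Sum>m<N. (cos (real n * t) * cos (real m * t) + sin (real n * t) * sin (real m * t)) * inner (x n) (x m))"
      unfolding power2_norm_eq_inner inner_sum_left inner_sum_right sum.distrib[symmetric]
      by (intro sum.cong refl) (simp add: Complex.DeMoivre algebra_simps inner_commute)
    then show ?thesis by (simp add: cos_diff[symmetric] left_diff_distrib)
  qed
  have "((\<lambda>t. \<Sum>n<N. \<Sum>m<N. cos (of_int (int n - int m) * t) * inner (x n) (x m)) has_integral
     (\<Sum>n<N. \<Sum>m<N. (if int n - int m = 0 then 2 * pi else 0) * inner (x n) (x m))) {0..2 * pi}"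
    by (intro has_integral_sum has_integral_mult_left has_integral_cos_int finite_lessThan)
  moreover have "(\<Sum>n<N. \<Sum>m<N. (if int n - int m = 0 then 2 * pi else 0) * inner (x n) (x m))
     = 2 * pi * (\<Sum>n<N. (norm (x n))\<^sup>2)"
  proof -
    have "(\<Sum>m<N. (if int n - int m = 0 then 2 * pi else 0) * inner (x n) (x m)) = 2 * pi * (norm (x n))\<^sup>2"
      if "n < N" for n
    proof -
      have "(\<Sum>m<N. (if int n - int m = 0 then 2 * pi else 0) * inner (x n) (x m))
        = (\<Sum>m<N. if m = n then 2 * pi * (norm (x n))\<^sup>2 else 0)"
        by (intro sum.cong refl) (auto simp: power2_norm_eq_inner)
      then show ?thesis using that by simp
    qed
    then show ?thesis by (simp add: sum_distrib_left)
  qed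
  ultimately show ?thesis unfolding eq by simp
qed

text \<open>
  The constant \<open>2 \<pi>\<close> is the same as for complex Fourier series, because
  \<open>cos (n t) cos (m t) + sin (n t) sin (m t) = cos ((n - m) t)\<close>.
\<close>

lemma parseval:
  assumes x: "summable (\<lambda>n. norm (x n))"
  shows "((\<lambda>t. (norm (cos_sum (cis t) x))\<^sup>2 + (norm (sin_sum (cis t) x))\<^sup>2)
     has_integral (2 * pi * (\<Sum>n. (norm (x n))\<^sup>2))) {0..2 * pi}"
proof -
  define f where "f N t = (norm (\<Sum>n<N. Re (cis t ^ n) *\<^sub>R x n))\<^sup>2 + (norm (\<Sum>n<N. Im (cis t ^ n) *\<^sub>R x n))\<^sup>2" for N t
  define g where "g t = (norm (cos_sum (cis t) x))\<^sup>2 + (norm (sin_sum (cis t) x))\<^sup>2" for t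
  define M where "M = (\<Sum>n. norm (x n))"
  have fint: "(f N has_integral (2 * pi * (\<Sum>n<N. (norm (x n))\<^sup>2))) {0..2 * pi}" for N
    unfolding f_def by (rule has_integral_trig_polynomial)
  have b: "norm (\<Sum>n<N. c n *\<^sub>R x n) \<le> M" if "\<And>n. \<bar>c n\<bar> \<le> 1" for c N
  proof -
    have "norm (\<Sum>n<N. c n *\<^sub>R x n) \<le> (\<Sum>n<N. norm (x n))"
      by (intro sum_norm_le) (use that in \<open>simp add: mult_left_le_one_le\<close>)
    also have "\<dots> \<le> M" unfolding M_def by (rule sum_le_suminf[OF x]) auto
    finally show ?thesis .
  qed
  have fg: "(\<lambda>N. f N t) \<longlonglongrightarrow> g t" for t
  proof -
    have c: "cmod (cis t) \<le> 1" by simp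
    have "(\<lambda>N. \<Sum>n<N. Re (cis t ^ n) *\<^sub>R x n) \<longlonglongrightarrow> cos_sum (cis t) x"
      "(\<lambda>N. \<Sum>n<N. Im (cis t ^ n) *\<^sub>R x n) \<longlonglongrightarrow> sin_sum (cis t) x"
      unfolding cos_sum_def sin_sum_def
      by (intro summable_LIMSEQ summable_norm_cancel[OF summable_cos_sin(1)[OF x c]]
          summable_norm_cancel[OF summable_cos_sin(2)[OF x c]])+
    then show ?thesis unfolding f_def g_def by (intro tendsto_intros)
  qed
  have dc: "g integrable_on {0..2 * pi}" "(\<lambda>N. integral {0..2 * pi} (f N)) \<longlonglongrightarrow> integral {0..2 * pi} g"
  proof -
    have bd: "norm (f N t) \<le> M\<^sup>2 + M\<^sup>2" for N t
    proof -
      have "\<bar>Re (cis t ^ n)\<bar> \<le> 1" "\<bar>Im (cis t ^ n)\<bar> \<le> 1" for n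
        by (simp_all add: Complex.DeMoivre)
      then have "f N t \<le> M\<^sup>2 + M\<^sup>2"
        unfolding f_def by (intro add_mono power_mono b norm_ge_zero)
      then show ?thesis by (simp add: f_def)
    qed
    show "g integrable_on {0..2 * pi}" "(\<lambda>N. integral {0..2 * pi} (f N)) \<longlonglongrightarrow> integral {0..2 * pi} g"
      using dominated_convergence[of f "{0..2 * pi}" "\<lambda>_. M\<^sup>2 + M\<^sup>2" g] fint bd fg
      by (auto simp: integrable_on_def)
  qed
  have L: "(\<lambda>N. 2 * pi * (\<Sum>n<N. (norm (x n))\<^sup>2)) \<longlonglongrightarrow> 2 * pi * (\<Sum>n. (norm (x n))\<^sup>2)"
    by (intro tendsto_intros summable_LIMSEQ summable_norm_power2 x)
  have "integral {0..2 * pi} (f N) = 2 * pi * (\<Sum>n<N. (norm (x n))\<^sup>2)" for N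
    using fint by (rule integral_unique)
  then have "integral {0..2 * pi} g = 2 * pi * (\<Sum>n. (norm (x n))\<^sup>2)"
    by (intro LIMSEQ_unique[OF _ L]) (use dc(2) in simp)
  then have "(g has_integral 2 * pi * (\<Sum>n. (norm (x n))\<^sup>2)) {0..2 * pi}"
    using integrable_integral[OF dc(1)] by simp
  then show ?thesis unfolding g_def[abs_def] .
qed

lemma conv_contraction:
  assumes x: "summable (\<lambda>n. norm (x n))" and y: "summable (\<lambda>n. norm (y n))"
    and le: "\<And>q. norm q \<le> 1 \<Longrightarrow> norm (\<Sum>n. q ^ n * x n) \<le> 1"
  shows "(\<Sum>n. (norm (conv x y n))\<^sup>2) \<le> (\<Sum>n. (norm (y n))\<^sup>2)"
proof -
  have "2 * pi * (\<Sum>n. (norm (conv x y n))\<^sup>2) \<le> 2 * pi * (\<Sum>n. (norm (y n))\<^sup>2)"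
  proof (rule has_integral_le[OF parseval[OF summable_conv[OF x y]] parseval[OF y]])
    fix t :: real
    have c: "cmod (cis t) \<le> 1" by simp
    have "norm (cos_sum (cis t) x + K * sin_sum (cis t) x) \<le> 1" if "K \<in> imag_sphere" for K
      using le[of "emb K (cis t)"] emb_series_sums[OF that x c] by (simp add: sums_iff norm_emb[OF that])
    from sphere_contraction[OF this, of "cos_sum (cis t) y" "sin_sum (cis t) y"]
    show "(norm (cos_sum (cis t) (conv x y)))\<^sup>2 + (norm (sin_sum (cis t) (conv x y)))\<^sup>2
      \<le> (norm (cos_sum (cis t) y))\<^sup>2 + (norm (sin_sum (cis t) y))\<^sup>2"
      by (simp add: cos_sum_conv[OF x y c] sin_sum_conv[OF x y c])
  qed
  then show ?thesis by simp
qed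

section \<open>Two points with the same value\<close>

text \<open>
  In the proof, \<open>A\<close>, \<open>B\<close> and \<open>S\<close> are the inner products of the sequences \<open>(conj a)\<^sup>n\<close> and \<open>(conj b)\<^sup>n\<close>,
  \<open>\<Gamma>\<close> is their Gram determinant and \<open>\<Delta>\<close> the squared norm of their difference. The identity
  \<open>\<Delta> = (1 - |a|\<^sup>2 |b|\<^sup>2) \<Gamma>\<close> follows from \<open>a S (conj b) = S - 1\<close>.
\<close>

lemma equal_values_norm_le:
  fixes a b c :: quat
  assumes x: "summable (\<lambda>n. norm (x n))" and x0: "x 0 = 0"
    and le: "\<And>q. norm q \<le> 1 \<Longrightarrow> norm (\<Sum>n. q ^ n * x n) \<le> 1"
    and a: "norm a < 1" and b: "norm b < 1" and ab: "a \<noteq> b"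
    and ca: "(\<lambda>n. a ^ n * x n) sums c" and cb: "(\<lambda>n. b ^ n * x n) sums c"
  shows "norm c \<le> norm a * norm b"
proof -
  define A where "A = 1 / (1 - (norm a)\<^sup>2)"
  define B where "B = 1 / (1 - (norm b)\<^sup>2)"
  have geo: "summable (\<lambda>n. norm (d ^ n * e))" if "norm d < 1" for d e :: quat
    using that by (simp add: norm_mult norm_power summable_mult2 summable_geometric)
  have kernel: "summable (\<lambda>n. d ^ n * qcnj e ^ n)" if "norm d < 1" "norm e < 1" for d e
  proof (rule summable_norm_cancel, rule summable_comparison_test')
    show "summable (\<lambda>n. norm d ^ n)" using that by (simp add: summable_geometric)
    show "norm (norm (d ^ n * qcnj e ^ n)) \<le> norm d ^ n" for n
      using that by (simp add: norm_mult norm_power mult_left_le power_le_one)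
  qed
  have diag: "(\<lambda>n. d ^ n * qcnj d ^ n) sums of_real (1 / (1 - (norm d)\<^sup>2))" if "norm d < 1" for d
  proof -
    have "d ^ n * qcnj d ^ n = of_real (((norm d)\<^sup>2) ^ n)" for n
    proof -
      have "d ^ n * qcnj d ^ n = of_real ((norm (d ^ n))\<^sup>2)"
        by (simp add: qcnj_mult_self qcnj_power[symmetric] del: of_real_power)
      then show ?thesis by (simp add: norm_power power_mult[symmetric] mult.commute del: of_real_power)
    qed
    moreover have "(norm d)\<^sup>2 < 1" using that by (simp add: abs_square_less_1)
    ultimately show ?thesis
      using sums_of_real[OF geometric_sums[of "(norm d)\<^sup>2"], where 'a = quat] by (simp del: of_real_power of_real_divide)
  qed
  define S where "S = (\<Sum>n. a ^ n * qcnj b ^ n)"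
  have Ss: "(\<lambda>n. a ^ n * qcnj b ^ n) sums S"
    unfolding S_def by (intro summable_sums kernel a b)
  have Ss': "(\<lambda>n. b ^ n * qcnj a ^ n) sums qcnj S"
    using bounded_linear.sums[OF bounded_linear_qcnj Ss] by (simp add: qcnj_mult qcnj_power)
  have aSb: "a * S * qcnj b = S - 1"
  proof -
    have 1: "(\<lambda>n. a ^ Suc n * qcnj b ^ Suc n) sums (S - 1)"
      using Ss by (subst sums_Suc_iff) simp
    have 2: "(\<lambda>n. a * (a ^ n * qcnj b ^ n) * qcnj b) sums (a * S * qcnj b)"
      by (intro sums_mult sums_mult2 Ss)
    have "a * (a ^ n * qcnj b ^ n) * qcnj b = a ^ Suc n * qcnj b ^ Suc n" for n
      by (simp add: mult.assoc power_commutes)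
    with 2 have "(\<lambda>n. a ^ Suc n * qcnj b ^ Suc n) sums (a * S * qcnj b)"
      by (simp only:)
    from sums_unique2[OF this 1] show ?thesis .
  qed
  define \<Delta> where "\<Delta> = A + B - 2 * qRe S"
  define \<Gamma> where "\<Gamma> = A * B - (norm S)\<^sup>2"
  have \<Delta>\<Gamma>: "\<Delta> = (1 - (norm a)\<^sup>2 * (norm b)\<^sup>2) * \<Gamma>"
  proof -
    have "(norm a)\<^sup>2 * (norm S)\<^sup>2 * (norm b)\<^sup>2 = (norm (S - 1))\<^sup>2"
      unfolding aSb[symmetric] by (simp add: norm_mult power_mult_distrib)
    also have "\<dots> = (norm S)\<^sup>2 - 2 * qRe S + 1"
      unfolding quat_norm_power2 by (simp add: power2_eq_square algebra_simps)
    finally have 1: "(norm a)\<^sup>2 * (norm b)\<^sup>2 * (norm S)\<^sup>2 = (norm S)\<^sup>2 - 2 * qRe S + 1" by (simp add: mult_ac)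
    have ne: "1 - (norm a)\<^sup>2 \<noteq> 0" "1 - (norm b)\<^sup>2 \<noteq> 0"
      using abs_square_less_1[of "norm a"] abs_square_less_1[of "norm b"] a b by auto
    then have "(1 - (norm a)\<^sup>2) * A = 1" "(1 - (norm b)\<^sup>2) * B = 1"
      by (simp_all add: A_def B_def)
    then have 2: "(1 - (norm a)\<^sup>2 * (norm b)\<^sup>2) * (A * B) = A + B - 1"
      by algebra
    have 3: "(1 - (norm a)\<^sup>2 * (norm b)\<^sup>2) * (norm S)\<^sup>2 = 2 * qRe S - 1"
      using 1 by (simp add: left_diff_distrib)
    show ?thesis
      unfolding \<Delta>_def \<Gamma>_def right_diff_distrib 2 3 by simp
  qed
  have "0 < \<Delta>"
  proof -
    have 1: "(\<lambda>n. qRe (a ^ n * qcnj a ^ n + b ^ n * qcnj b ^ n - a ^ n * qcnj b ^ n - b ^ n * qcnj a ^ n))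
       sums qRe (of_real A + of_real B - S - qcnj S)"
      unfolding A_def B_def
      by (intro bounded_linear.sums[OF bounded_linear_qRe] sums_diff sums_add diag Ss Ss' a b)
    have e2: "qRe (a ^ n * qcnj a ^ n + b ^ n * qcnj b ^ n - a ^ n * qcnj b ^ n - b ^ n * qcnj a ^ n)
        = (norm (a ^ n - b ^ n))\<^sup>2" for n
    proof -
      have e: "a ^ n * qcnj a ^ n + b ^ n * qcnj b ^ n - a ^ n * qcnj b ^ n - b ^ n * qcnj a ^ n
        = (a ^ n - b ^ n) * qcnj (a ^ n - b ^ n)"
        by (simp add: qcnj_power algebra_simps)
      show ?thesis unfolding e qcnj_mult_self quat_of_real_sel ..
    qed
    have s: "(\<lambda>n. (norm (a ^ n - b ^ n))\<^sup>2) sums \<Delta>"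
      using 1 unfolding e2 by (simp add: \<Delta>_def)
    have "0 < (\<Sum>n. (norm (a ^ n - b ^ n))\<^sup>2)"
      by (rule suminf_pos2[of _ 1]) (use s ab in \<open>auto simp: sums_iff\<close>)
    then show ?thesis using s by (simp add: sums_iff)
  qed
  have ab1: "0 < 1 - (norm a)\<^sup>2 * (norm b)\<^sup>2"
  proof -
    have "norm a * norm b < 1" using a b mult_strict_mono[of "norm a" 1 "norm b" 1] by simp
    then have "(norm a * norm b)\<^sup>2 < 1" by (simp add: abs_square_less_1 abs_mult)
    then show ?thesis by (simp add: power_mult_distrib)
  qed
  with \<open>0 < \<Delta>\<close> have "0 < \<Gamma>" unfolding \<Delta>\<Gamma> by (simp add: zero_less_mult_iff)
  \<comment> \<open>The coefficients that make \<open>v\<close> orthogonal to \<open>(conj a)\<^sup>n - (conj b)\<^sup>n\<close>: the series of \<open>v\<close> takes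
    the same value \<open>\<Gamma>\<close> at \<open>a\<close> and at \<open>b\<close>.\<close>
  define p where "p = of_real B - S"
  define p' where "p' = of_real A - qcnj S"
  define v where "v n = qcnj a ^ n * p + qcnj b ^ n * p'" for n
  have vs: "summable (\<lambda>n. norm (v n))"
  proof (rule summable_comparison_test')
    show "summable (\<lambda>n. norm (qcnj a ^ n * p) + norm (qcnj b ^ n * p'))"
      by (intro summable_add geo) (use a b in auto)
  qed (simp add: v_def norm_triangle_ineq)
  have comm: "of_real r * q = q * of_real r" for r and q :: quat by (simp add: of_real_def)
  have eva: "(\<lambda>n. a ^ n * v n) sums of_real \<Gamma>"
  proof -
    have "(\<lambda>n. a ^ n * qcnj a ^ n * p + a ^ n * qcnj b ^ n * p') sums (of_real A * p + S * p')"
      unfolding A_def by (intro sums_add sums_mult2 diag Ss a b)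
    also have "of_real A * p + S * p' = of_real \<Gamma>"
      by (simp add: p_def p'_def \<Gamma>_def right_diff_distrib qcnj_mult_self comm[of A S] del: of_real_power)
    finally show ?thesis by (simp add: v_def distrib_left mult.assoc)
  qed
  have evb: "(\<lambda>n. b ^ n * v n) sums of_real \<Gamma>"
  proof -
    have "(\<lambda>n. b ^ n * qcnj a ^ n * p + b ^ n * qcnj b ^ n * p') sums (qcnj S * p + of_real B * p')"
      unfolding B_def by (intro sums_add sums_mult2 diag Ss' a b)
    also have "qcnj S * p + of_real B * p' = of_real \<Gamma>"
      by (simp add: p_def p'_def \<Gamma>_def right_diff_distrib qcnj_mult_self comm[of B "qcnj S"] mult.commute[of A B] del: of_real_power)
    finally show ?thesis by (simp add: v_def distrib_left mult.assoc)
  qed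
  have inner_v: "(\<lambda>n. inner (y n) (v n)) sums (inner ya p + inner yb p')"
    if "(\<lambda>n. a ^ n * y n) sums ya" "(\<lambda>n. b ^ n * y n) sums yb" for y ya yb
  proof -
    have "(\<lambda>n. inner (a ^ n * y n) p + inner (b ^ n * y n) p') sums (inner ya p + inner yb p')"
      by (intro sums_add bounded_linear.sums[OF bounded_linear_inner_left] that)
    then show ?thesis by (simp add: v_def inner_add_right qinner_mult qcnj_power)
  qed
  define V where "V = \<Gamma> * \<Delta>"
  have V: "(\<lambda>n. (norm (v n))\<^sup>2) sums V"
  proof -
    have "inner (of_real \<Gamma>) p + inner (of_real \<Gamma>) p' = V"
      by (simp add: inner_quat_def p_def p'_def V_def \<Delta>_def algebra_simps)
    then show ?thesis using inner_v[OF eva evb] by (simp add: power2_norm_eq_inner)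
  qed
  define u where "u n = qcnj c * v n" for n
  have us: "summable (\<lambda>n. norm (u n))" unfolding u_def by (simp add: norm_mult summable_mult vs)
  define h where "h = conv x u"
  have hs: "summable (\<lambda>n. norm (h n))" unfolding h_def by (rule summable_conv[OF x us])
  have h0: "h 0 = 0" by (simp add: h_def conv_def x0)
  define \<delta> where "\<delta> = (norm c)\<^sup>2"
  have hV: "(\<Sum>n. (norm (h n))\<^sup>2) \<le> \<delta> * V"
  proof -
    have "(\<lambda>n. (norm (u n))\<^sup>2) sums (\<delta> * V)"
      unfolding u_def \<delta>_def norm_mult power_mult_distrib using sums_mult[OF V] by simp
    then show ?thesis using conv_contraction[OF x us le] by (simp add: sums_iff h_def)
  qed
  have hv: "(\<lambda>n. inner (h n) (v n)) sums (\<delta> * V)"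
  proof -
    have cu: "d ^ n * (c * u n) = of_real \<delta> * (d ^ n * v n)" for d n
    proof -
      have "c * u n = of_real \<delta> * v n"
        by (simp add: u_def \<delta>_def mult.assoc[symmetric] qcnj_mult_self del: of_real_power)
      then show ?thesis by (simp add: of_real_def)
    qed
    have "(\<Sum>n. a ^ n * (c * u n)) = of_real \<delta> * of_real \<Gamma>" "(\<Sum>n. b ^ n * (c * u n)) = of_real \<delta> * of_real \<Gamma>"
      unfolding cu using sums_mult[OF eva] sums_mult[OF evb] by (simp_all add: sums_iff)
    then have "(\<lambda>n. a ^ n * h n) sums of_real (\<delta> * \<Gamma>)" "(\<lambda>n. b ^ n * h n) sums of_real (\<delta> * \<Gamma>)"
      using conv_eval_sums[OF x us _ ca] conv_eval_sums[OF x us _ cb] a b by (simp_all add: h_def)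
    from inner_v[OF this] show ?thesis
      by (simp add: inner_quat_def p_def p'_def V_def \<Delta>_def algebra_simps)
  qed
  define w where "w n = (if n = 0 then 0 else v n)" for n
  have w: "(\<lambda>n. (norm (w n))\<^sup>2) sums (V - \<Delta>\<^sup>2)"
  proof -
    have "v 0 = of_real \<Delta>"
      by (simp add: v_def p_def p'_def \<Delta>_def quat_eq_iff del: of_real_diff of_real_add of_real_mult)
    then have "(\<lambda>n. if n = 0 then \<Delta>\<^sup>2 else 0) sums \<Delta>\<^sup>2" "(norm (v 0))\<^sup>2 = \<Delta>\<^sup>2"
      using sums_single[of 0 "\<lambda>_. \<Delta>\<^sup>2"] by auto
    then have "(\<lambda>n. (norm (v n))\<^sup>2 - (if n = 0 then \<Delta>\<^sup>2 else 0)) sums (V - \<Delta>\<^sup>2)"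
      by (intro sums_diff V)
    also have "(\<lambda>n. (norm (v n))\<^sup>2 - (if n = 0 then \<Delta>\<^sup>2 else 0)) = (\<lambda>n. (norm (w n))\<^sup>2)"
      using \<open>(norm (v 0))\<^sup>2 = \<Delta>\<^sup>2\<close> by (auto simp: w_def)
    finally show ?thesis .
  qed
  have "inner (h n) (w n) = inner (h n) (v n)" for n by (simp add: w_def h0)
  then have hw: "(\<lambda>n. inner (h n) (w n)) sums (\<delta> * V)" using hv by simp
  \<comment> \<open>Expand \<open>0 \<le> \<parallel>h - w\<parallel>\<^sup>2\<close>, where \<open>h\<close> is the image of \<open>u = (conj c) v\<close> under the contraction and
    \<open>w\<close> is \<open>v\<close> without its entry at \<open>0\<close>.\<close>
  have s: "(\<lambda>n. (norm (h n))\<^sup>2 - 2 * inner (h n) (w n) + (norm (w n))\<^sup>2) sums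
      ((\<Sum>n. (norm (h n))\<^sup>2) - 2 * (\<delta> * V) + (V - \<Delta>\<^sup>2))"
    by (intro sums_add sums_diff sums_mult hw w summable_sums summable_norm_power2 hs)
  have "0 \<le> (norm (h n))\<^sup>2 - 2 * inner (h n) (w n) + (norm (w n))\<^sup>2" for n
    using zero_le_power2[of "norm (h n - w n)"]
    by (simp add: power2_norm_eq_inner inner_diff_left inner_diff_right inner_commute)
  from sums_le[OF this sums_zero s]
  have "0 \<le> (\<Sum>n. (norm (h n))\<^sup>2) - 2 * (\<delta> * V) + (V - \<Delta>\<^sup>2)" .
  with hV have "\<delta> * V \<le> V - \<Delta>\<^sup>2" by linarith
  then have "\<Delta> * (\<delta> * \<Gamma>) \<le> \<Delta> * (\<Gamma> - \<Delta>)" by (simp add: V_def power2_eq_square algebra_simps)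
  then have "\<delta> * \<Gamma> \<le> \<Gamma> - \<Delta>" using \<open>0 < \<Delta>\<close> by simp
  also have "\<dots> = (norm a * norm b)\<^sup>2 * \<Gamma>" unfolding \<Delta>\<Gamma> by (simp add: power_mult_distrib algebra_simps)
  finally have "(norm c)\<^sup>2 \<le> (norm a * norm b)\<^sup>2" using \<open>0 < \<Gamma>\<close> by (simp add: \<delta>_def)
  then show ?thesis by (rule power2_le_imp_le) simp
qed

section \<open>Numerical bounds for the inverse hyperbolic tangent\<close>

lemma artanh_series_bounds:
  fixes x :: real
  assumes "0 \<le> x" "x < 1"
  shows artanh_ge_sum: "(\<Sum>k<n. x ^ (2 * k + 1) / real (2 * k + 1)) \<le> artanh x"
    and artanh_le_sum: "artanh x \<le> (\<Sum>k<n. x ^ (2 * k + 1) / real (2 * k + 1))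
          + x ^ (2 * n + 1) / (real (2 * n + 1) * (1 - x\<^sup>2))"
proof -
  define p where "p t = (\<Sum>k<n. t ^ (2 * k + 1) / real (2 * k + 1))" for t :: real
  have dp: "(p has_real_derivative (1 - t ^ (2 * n)) / (1 - t\<^sup>2)) (at t)" if t: "0 \<le> t" "t < 1" for t
  proof -
    have t2: "t\<^sup>2 \<noteq> 1" using t by (simp add: power2_eq_1_iff)
    have "(p has_real_derivative (\<Sum>k<n. (t\<^sup>2) ^ k)) (at t)"
      unfolding p_def
    proof (rule DERIV_sum)
      show "((\<lambda>t. t ^ (2 * k + 1) / real (2 * k + 1)) has_real_derivative (t\<^sup>2) ^ k) (at t)" for k
        by (auto intro!: derivative_eq_intros simp: power_mult[symmetric] simp del: power_Suc of_nat_Suc of_nat_add)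
    qed
    also have "(\<Sum>k<n. (t\<^sup>2) ^ k) = (1 - t ^ (2 * n)) / (1 - t\<^sup>2)"
      using t2 by (subst sum_gp_strict) (simp add: power_mult)
    finally show ?thesis .
  qed
  have da: "(artanh has_real_derivative 1 / (1 - t\<^sup>2)) (at t)" if "0 \<le> t" "t < 1" for t :: real
    by (rule artanh_real_has_field_derivative) (use that in simp)
  have "artanh 0 - p 0 \<le> artanh x - p x"
  proof (rule DERIV_nonneg_imp_nondecreasing[OF assms(1)])
    fix t assume t: "0 \<le> t" "t \<le> x"
    then have t1: "t < 1" "t\<^sup>2 < 1" using assms by (auto simp: abs_square_less_1)
    have "((\<lambda>t. artanh t - p t) has_real_derivative (1 / (1 - t\<^sup>2) - (1 - t ^ (2 * n)) / (1 - t\<^sup>2))) (at t)"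
      using t t1 by (intro DERIV_diff da dp)
    moreover have "0 \<le> 1 / (1 - t\<^sup>2) - (1 - t ^ (2 * n)) / (1 - t\<^sup>2)"
      using t t1 by (simp add: diff_divide_distrib[symmetric])
    ultimately show "\<exists>y. ((\<lambda>t. artanh t - p t) has_real_derivative y) (at t) \<and> 0 \<le> y" by blast
  qed
  then show "(\<Sum>k<n. x ^ (2 * k + 1) / real (2 * k + 1)) \<le> artanh x" by (simp add: p_def)
  define C where "C = 1 / (1 - x\<^sup>2)"
  have "p 0 + 0 ^ (2 * n + 1) / real (2 * n + 1) * C - artanh 0
      \<le> p x + x ^ (2 * n + 1) / real (2 * n + 1) * C - artanh x"
  proof (rule DERIV_nonneg_imp_nondecreasing[OF assms(1)])
    fix t assume t: "0 \<le> t" "t \<le> x"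
    then have t1: "t < 1" "t\<^sup>2 < 1" "t\<^sup>2 \<le> x\<^sup>2" "x\<^sup>2 < 1" using assms by (auto simp: abs_square_less_1)
    have "((\<lambda>t. t ^ (2 * n + 1) / real (2 * n + 1) * C) has_real_derivative t ^ (2 * n) * C) (at t)"
      by (auto intro!: derivative_eq_intros simp del: power_Suc of_nat_Suc of_nat_add)
    then have "((\<lambda>t. p t + t ^ (2 * n + 1) / real (2 * n + 1) * C - artanh t) has_real_derivative
        ((1 - t ^ (2 * n)) / (1 - t\<^sup>2) + t ^ (2 * n) * C - 1 / (1 - t\<^sup>2))) (at t)"
      using t t1 by (intro DERIV_diff DERIV_add da dp)
    moreover have "0 \<le> (1 - t ^ (2 * n)) / (1 - t\<^sup>2) + t ^ (2 * n) * C - 1 / (1 - t\<^sup>2)"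
    proof -
      have "1 / (1 - t\<^sup>2) \<le> C" unfolding C_def using t1 by (intro divide_left_mono) auto
      then have "t ^ (2 * n) * (1 / (1 - t\<^sup>2)) \<le> t ^ (2 * n) * C" using t by (intro mult_left_mono) auto
      then show ?thesis by (simp add: diff_divide_distrib)
    qed
    ultimately show "\<exists>y. ((\<lambda>t. p t + t ^ (2 * n + 1) / real (2 * n + 1) * C - artanh t) has_real_derivative y) (at t) \<and> 0 \<le> y"
      by blast
  qed
  then show "artanh x \<le> (\<Sum>k<n. x ^ (2 * k + 1) / real (2 * k + 1))
          + x ^ (2 * n + 1) / (real (2 * n + 1) * (1 - x\<^sup>2))"
    by (simp add: p_def C_def)
qed


text \<open>
  The numerical evaluations bound each term of the series by a decimal fraction; the next two lemmas
  turn such a bound into an inequality between integers.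
\<close>

lemma power_quotient_ge:
  fixes m e N D k :: real
  assumes "m * (D ^ j * k) \<le> e * N ^ j" "0 < D" "0 < k" "0 < e"
  shows "m / e \<le> (N / D) ^ j / k"
  using assms by (simp add: power_divide field_simps)

lemma power_quotient_le:
  fixes m e N D k :: real
  assumes "e * N ^ j \<le> m * (D ^ j * k)" "0 < D" "0 < k" "0 < e"
  shows "(N / D) ^ j / k \<le> m / e"
  using assms by (simp add: power_divide field_simps)

lemma sum_lessThan_18: "(\<Sum>k<18. f k) = f 0 + f 1 + f 2 + f 3 + f 4 + f 5 + f 6 + f 7 + f 8
    + f 9 + f 10 + f 11 + f 12 + f 13 + f 14 + f 15 + f 16 + f (17::nat)" for f :: "nat \<Rightarrow> real"
  by (simp add: eval_nat_numeral)

lemma sum_lessThan_12: "(\<Sum>k<12. f k) = f 0 + f 1 + f 2 + f 3 + f 4 + f 5 + f 6 + f 7 + f 8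
    + f 9 + f 10 + f (11::nat)" for f :: "nat \<Rightarrow> real"
  by (simp add: eval_nat_numeral)

text \<open>
  The fractions \<open>19/27\<close> and \<open>11/19\<close> are close to the points where the two suprema are attained
  (\<open>0.70367\<close> and \<open>0.57902\<close>) and have small denominators; tangents transfer the values to the points
  that are needed.
\<close>

lemma artanh_19_27: "874599804 / 1000000000 \<le> artanh (19 / 27 :: real)"
proof -
  have "(874599804::real) / 1000000000 \<le> 703703703 / 1000000000 + 116157767 / 1000000000 + 34512719 / 1000000000 + 12207614 / 1000000000
      + 4701820 / 1000000000 + 1905002 / 1000000000 + 798223 / 1000000000 + 342575 / 1000000000
      + 149685 / 1000000000 + 66321 / 1000000000 + 29714 / 1000000000 + 13435 / 1000000000
      + 6120 / 1000000000 + 2806 / 1000000000 + 1293 / 1000000000 + 599 / 1000000000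
      + 278 / 1000000000 + 130 / 1000000000"
    by simp
  also have "\<dots> \<le> (\<Sum>k<18. (19 / 27) ^ (2 * k + 1) / real (2 * k + 1))"
    unfolding sum_lessThan_18 by (intro add_mono power_quotient_ge; simp)
  also have "\<dots> \<le> artanh (19 / 27)"
    by (intro artanh_ge_sum) auto
  finally show ?thesis .
qed

lemma artanh_11_19:
  "660877847 / 1000000000 \<le> artanh (11 / 19 :: real)" "artanh (11 / 19 :: real) \<le> 660877930 / 1000000000"
proof -
  have "(660877847::real) / 1000000000 \<le> 578947368 / 1000000000 + 64683870 / 1000000000 + 13008445 / 1000000000 + 3114408 / 1000000000
      + 811912 / 1000000000 + 222657 / 1000000000 + 63148 / 1000000000 + 18344 / 1000000000
      + 5425 / 1000000000 + 1627 / 1000000000 + 493 / 1000000000 + 150 / 1000000000"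
    by simp
  also have "\<dots> \<le> (\<Sum>k<12. (11 / 19) ^ (2 * k + 1) / real (2 * k + 1))"
    unfolding sum_lessThan_12 by (intro add_mono power_quotient_ge; simp)
  also have "\<dots> \<le> artanh (11 / 19)"
    by (intro artanh_ge_sum) auto
  finally show "660877847 / 1000000000 \<le> artanh (11 / 19 :: real)" .
  have "artanh (11 / 19 :: real) \<le> (\<Sum>k<12. (11 / 19) ^ (2 * k + 1) / real (2 * k + 1))
      + (11 / 19) ^ (2 * 12 + 1) / (real (2 * 12 + 1) * (1 - (11 / 19)\<^sup>2))"
    by (intro artanh_le_sum) auto
  also have "\<dots> \<le> 578947369 / 1000000000 + 64683871 / 1000000000 + 13008446 / 1000000000 + 3114409 / 1000000000
      + 811913 / 1000000000 + 222658 / 1000000000 + 63149 / 1000000000 + 18345 / 1000000000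
      + 5426 / 1000000000 + 1628 / 1000000000 + 494 / 1000000000 + 151 / 1000000000
      + 71 / 1000000000"
    unfolding sum_lessThan_12 by (intro add_mono power_quotient_le; simp add: power2_eq_square)
  also have "\<dots> \<le> 660877930 / 1000000000"
    by simp
  finally show "artanh (11 / 19 :: real) \<le> 660877930 / 1000000000" .
qed

lemma artanh_7_10: "artanh (7 / 10 :: real) \<le> 86735 / 100000"
proof -
  have "artanh (7 / 10 :: real) \<le> (\<Sum>k<12. (7 / 10) ^ (2 * k + 1) / real (2 * k + 1))
      + (7 / 10) ^ (2 * 12 + 1) / (real (2 * 12 + 1) * (1 - (7 / 10)\<^sup>2))"
    by (intro artanh_le_sum) auto
  also have "\<dots> \<le> 700000000 / 1000000000 + 114333334 / 1000000000 + 33614000 / 1000000000 + 11764900 / 1000000000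
      + 4483735 / 1000000000 + 1797570 / 1000000000 + 745301 / 1000000000 + 316505 / 1000000000
      + 136842 / 1000000000 + 59995 / 1000000000 + 26598 / 1000000000 + 11900 / 1000000000
      + 10519 / 1000000000"
    unfolding sum_lessThan_12 by (intro add_mono power_quotient_le; simp add: power2_eq_square)
  also have "\<dots> \<le> 86735 / 100000"
    by simp
  finally show ?thesis .
qed

lemma artanh_tangent: "artanh b + (x - b) / (1 - b\<^sup>2) \<le> artanh x"
  if "0 \<le> x" "x < 1" "0 \<le> b" "b < 1" for b x :: real
proof -
  define p where "p t = artanh t - t / (1 - b\<^sup>2)" for t :: real
  have b1: "b\<^sup>2 < 1" using that by (simp add: abs_square_less_1)
  have dp: "(p has_real_derivative (1 / (1 - t\<^sup>2) - 1 / (1 - b\<^sup>2))) (at t)" if "0 \<le> t" "t < 1" for t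
    unfolding p_def using that b1
    by (intro DERIV_diff artanh_real_has_field_derivative) (auto intro!: derivative_eq_intros)
  have "p b \<le> p x"
  proof (cases "b \<le> x")
    case True
    then show ?thesis
    proof (rule DERIV_nonneg_imp_nondecreasing)
      fix t assume t: "b \<le> t" "t \<le> x"
      then have "b\<^sup>2 \<le> t\<^sup>2" "t\<^sup>2 < 1" using that by (auto simp: abs_square_less_1)
      then have "0 \<le> 1 / (1 - t\<^sup>2) - 1 / (1 - b\<^sup>2)" by (simp add: frac_le)
      then show "\<exists>y. (p has_real_derivative y) (at t) \<and> 0 \<le> y"
        using dp[of t] t that by force
    qed
  next
    case False
    then have "x \<le> b" by simp
    then show ?thesis
    proof (rule DERIV_nonpos_imp_nonincreasing)
      fix t assume t: "x \<le> t" "t \<le> b"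
      then have "t\<^sup>2 \<le> b\<^sup>2" using that by (auto intro: power_mono)
      then have "1 / (1 - t\<^sup>2) - 1 / (1 - b\<^sup>2) \<le> 0" using b1 by (simp add: frac_le)
      then show "\<exists>y. (p has_real_derivative y) (at t) \<and> y \<le> 0"
        using dp[of t] t that by force
    qed
  qed
  then show ?thesis by (simp add: p_def diff_divide_distrib)
qed

lemma artanh_7036643_ge: "87452148 / 100000000 \<le> artanh (7036643 / 10000000 :: real)"
proof -
  have "artanh (19 / 27) + (7036643 / 10000000 - 19 / 27) / (1 - (19 / 27)\<^sup>2) \<le> artanh (7036643 / 10000000 :: real)"
    by (intro artanh_tangent) auto
  moreover have "(7036643 / 10000000 - 19 / 27) / (1 - (19 / 27)\<^sup>2) \<ge> (87452148 / 100000000 - 874599804 / 1000000000 :: real)"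
    by (simp add: power2_eq_square)
  ultimately show ?thesis using artanh_19_27 by linarith
qed

lemma artanh_5789864_ge: "660935 / 1000000 \<le> artanh (5789864 / 10000000 :: real)"
proof -
  have "artanh (11 / 19) + (5789864 / 10000000 - 11 / 19) / (1 - (11 / 19)\<^sup>2) \<le> artanh (5789864 / 10000000 :: real)"
    by (intro artanh_tangent) auto
  moreover have "(5789864 / 10000000 - 11 / 19) / (1 - (11 / 19)\<^sup>2) \<ge> (660935 / 1000000 - 660877847 / 1000000000 :: real)"
    by (simp add: power2_eq_square)
  ultimately show ?thesis using artanh_11_19(1) by linarith
qed

lemma artanh_ge_cubic: "x + x ^ 3 / 3 \<le> artanh x" if "0 \<le> x" "x < 1" for x :: real
  using artanh_ge_sum[OF that, of 2] by (simp add: eval_nat_numeral)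

lemma artanh_gt_self: "x < artanh x" if "0 < x" "x < 1" for x :: real
proof -
  have "0 < x ^ 3 / 3" using that by simp
  then show ?thesis using artanh_ge_cubic[of x] that by linarith
qed

lemma artanh_mono: "artanh x \<le> artanh y" if "0 \<le> x" "x \<le> y" "y < 1" for x y :: real
proof (rule DERIV_nonneg_imp_nondecreasing[OF that(2)])
  fix t assume t: "x \<le> t" "t \<le> y"
  then have "(artanh has_real_derivative 1 / (1 - t\<^sup>2)) (at t)"
    using that by (intro artanh_real_has_field_derivative) auto
  moreover have "0 \<le> 1 / (1 - t\<^sup>2)"
    using t that by (simp add: abs_square_le_1)
  ultimately show "\<exists>D. (artanh has_real_derivative D) (at t) \<and> 0 \<le> D" by blast
qed

section \<open>The two constants\<close>

text \<open>
  The root \<open>\<rho> < 1\<close> of \<open>r (1 + \<rho>\<^sup>2) = 2 \<rho> artanh r\<close>. The terms of the two suprema that define the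
  constants are \<open>r \<rho>\<close> and \<open>\<rho>\<^sup>2 artanh r\<close>.
\<close>

definition landau_radius :: "real \<Rightarrow> real" where
  "landau_radius r = (artanh r - sqrt ((artanh r)\<^sup>2 - r\<^sup>2)) / r"

lemma landau_radius:
  assumes "0 < r" "r < 1"
  shows "0 < landau_radius r" "landau_radius r < 1"
    and "r * (1 + (landau_radius r)\<^sup>2) = 2 * artanh r * landau_radius r"
proof -
  define L where "L = artanh r"
  have L: "r < L" unfolding L_def by (rule artanh_gt_self[OF assms])
  then have p: "r\<^sup>2 < L\<^sup>2" using assms by (intro power_strict_mono) auto
  define s where "s = sqrt (L\<^sup>2 - r\<^sup>2)"
  have s2: "s\<^sup>2 = L\<^sup>2 - r\<^sup>2" "0 < s" using p by (simp_all add: s_def)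
  have "s\<^sup>2 < L\<^sup>2" using s2 assms by simp
  then have sL: "s < L" using L assms by (intro power_less_imp_less_base[of s 2 L]) auto
  have "(L - r)\<^sup>2 < s\<^sup>2"
  proof -
    have "0 < 2 * r * (L - r)" using L assms by simp
    then show ?thesis unfolding s2 by (simp add: power2_eq_square algebra_simps)
  qed
  then have "L - r < s" using s2 by (intro power_less_imp_less_base[of "L - r" 2 s]) auto
  then show "0 < landau_radius r" "landau_radius r < 1"
    using sL assms by (simp_all add: landau_radius_def L_def[symmetric] s_def[symmetric])
  have "r * (1 + ((L - s) / r)\<^sup>2) = 2 * L * ((L - s) / r)"
    using assms s2 by (simp add: field_simps power2_eq_square)
  then show "r * (1 + (landau_radius r)\<^sup>2) = 2 * artanh r * landau_radius r"
    by (simp add: landau_radius_def L_def s_def)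
qed

text \<open>
  If \<open>t = r \<rho>\<close> reaches \<open>v\<close>, then \<open>artanh r = (r\<^sup>2 + t\<^sup>2) / (2 t)\<close> is at most
  \<open>(r\<^sup>2 + v\<^sup>2) / (2 v)\<close>. The difference \<open>d r\<close> of the two sides is positive, however: its derivative has the
  sign of \<open>v - (r - r\<^sup>3)\<close>, it has its minimum between \<open>c\<close> and \<open>c'\<close>, and for \<open>r \<le> 1/2\<close>
  the cubic Taylor polynomial suffices.
\<close>

lemma dom_radius_lt:
  assumes r: "0 < r" "r < 1"
  shows "r * landau_radius r < 3552495 / 10000000"
proof (rule ccontr)
  define v :: real where "v = 3552495 / 10000000"
  define t where "t = r * landau_radius r"
  assume "\<not> ?thesis"
  then have tv: "v \<le> t" by (simp add: v_def t_def)
  have v: "0 < v" by (simp add: v_def)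
  have tr: "t < r" using landau_radius(2)[OF r] r by (simp add: t_def)
  have "r\<^sup>2 + t\<^sup>2 = r * (r * (1 + (landau_radius r)\<^sup>2))"
    by (simp add: t_def power2_eq_square algebra_simps)
  then have Lt: "r\<^sup>2 + t\<^sup>2 = 2 * artanh r * t"
    unfolding landau_radius(3)[OF r] by (simp add: t_def)
  have "(r\<^sup>2 + t\<^sup>2) * v \<le> (r\<^sup>2 + v\<^sup>2) * t"
  proof -
    have "v * t \<le> r\<^sup>2"
      unfolding power2_eq_square using tv tr v by (intro mult_mono) auto
    then have "0 \<le> (t - v) * (r\<^sup>2 - v * t)" using tv by simp
    then show ?thesis by (simp add: power2_eq_square algebra_simps)
  qed
  then have "t * (2 * artanh r * v) \<le> t * (r\<^sup>2 + v\<^sup>2)" by (simp add: Lt mult_ac)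
  then have "2 * artanh r * v \<le> r\<^sup>2 + v\<^sup>2" using tv v by (simp add: mult_le_cancel_left)
  then have le: "artanh r - (r\<^sup>2 + v\<^sup>2) / (2 * v) \<le> 0" using v by (simp add: field_simps)
  define d where "d y = artanh y - (y\<^sup>2 + v\<^sup>2) / (2 * v)" for y :: real
  have dd: "(d has_real_derivative ((v - (y - y ^ 3)) / (v * (1 - y\<^sup>2)))) (at y)" if "0 \<le> y" "y < 1" for y
  proof -
    have "y\<^sup>2 < 1" using that by (simp add: abs_square_less_1)
    then have e: "1 / (1 - y\<^sup>2) - y / v = (v - (y - y ^ 3)) / (v * (1 - y\<^sup>2))"
      using v by (simp add: field_simps power2_eq_square power3_eq_cube)
    have "((\<lambda>y. (y\<^sup>2 + v\<^sup>2) / (2 * v)) has_real_derivative y / v) (at y)"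
      using v by (auto intro!: derivative_eq_intros)
    then show ?thesis unfolding d_def[abs_def] e[symmetric]
      by (intro DERIV_diff artanh_real_has_field_derivative) (use that in auto)
  qed
  define c c' :: real where "c = 7036643 / 10000000" and "c' = 7036644 / 10000000"
  have pos: "0 < artanh c - (c'\<^sup>2 + v\<^sup>2) / (2 * v)"
  proof -
    have "(c'\<^sup>2 + v\<^sup>2) / (2 * v) < 87452148 / 100000000"
      by (simp add: c'_def v_def power2_eq_square)
    then show ?thesis using artanh_7036643_ge unfolding c_def by linarith
  qed
  have "0 < d r"
  proof (cases "r \<le> 1 / 2")
    case True
    define e where "e = r - v"
    have e: "0 \<le> e" "e \<le> 1448 / 10000" using tv tr True by (auto simp: e_def v_def)
    have "v ^ 3 + 3 * v\<^sup>2 * e \<le> r ^ 3"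
    proof -
      have "r ^ 3 = v ^ 3 + 3 * v\<^sup>2 * e + (3 * v * e\<^sup>2 + e ^ 3)"
        by (simp add: e_def power2_eq_square power3_eq_cube algebra_simps)
      then show ?thesis using e v by simp
    qed
    then have "2 * v * (v ^ 3 + 3 * v\<^sup>2 * e) \<le> 2 * v * r ^ 3" using v by simp
    moreover have "3 * e\<^sup>2 < 2 * v * (v ^ 3 + 3 * v\<^sup>2 * e)"
    proof -
      have "3 * e\<^sup>2 \<le> 3 * (1448 / 10000) * e"
        using mult_right_mono[OF e(2,1)] by (simp add: power2_eq_square)
      moreover have "3 * (1448 / 10000) * e < 2 * v * (v ^ 3 + 3 * v\<^sup>2 * e)"
        using e by (simp add: v_def power2_eq_square power3_eq_cube algebra_simps)
      ultimately show ?thesis by linarith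
    qed
    ultimately have "3 * e\<^sup>2 < 2 * v * r ^ 3" by linarith
    then have "(r\<^sup>2 + v\<^sup>2) / (2 * v) < r + r ^ 3 / 3"
      using v by (simp add: e_def field_simps power2_eq_square)
    then show ?thesis using artanh_ge_cubic[of r] r by (simp add: d_def)
  next
    case False
    show ?thesis
    proof (cases "r \<le> c")
      case True
      have "d c \<le> d r"
      proof (rule DERIV_nonpos_imp_nonincreasing[OF True])
        fix y assume y: "r \<le> y" "y \<le> c"
        have y1: "1 / 2 \<le> y" "y < 1" using y False by (auto simp: c_def)
        have yy: "1 / 4 \<le> y * y" using mult_mono[OF y1(1) y1(1)] y1 by simp
        have "0 \<le> (c - y) * (c * c + c * y + y * y - 1)"
          using y y1 yy by (intro mult_nonneg_nonneg) (auto simp: c_def)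
        then have "c - c ^ 3 \<le> y - y ^ 3" by (simp add: power3_eq_cube algebra_simps)
        moreover have "v \<le> c - c ^ 3" by (simp add: c_def v_def power3_eq_cube)
        moreover have "0 < v * (1 - y\<^sup>2)" using v y1 by (simp add: abs_square_less_1)
        ultimately have "(v - (y - y ^ 3)) / (v * (1 - y\<^sup>2)) \<le> 0"
          by (simp add: divide_nonpos_pos)
        then show "\<exists>D. (d has_real_derivative D) (at y) \<and> D \<le> 0"
          using dd[of y] y1 by auto
      qed
      moreover have "0 < d c"
      proof -
        have "(c\<^sup>2 + v\<^sup>2) / (2 * v) \<le> (c'\<^sup>2 + v\<^sup>2) / (2 * v)"
          by (simp add: c_def c'_def v_def power2_eq_square)
        then show ?thesis using pos by (simp add: d_def)
      qed
      ultimately show ?thesis by simp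
    next
      case False
      show ?thesis
      proof (cases "r \<le> c'")
        case True
        have "artanh c \<le> artanh r"
          using False r by (intro artanh_mono) (auto simp: c_def)
        moreover have "(r\<^sup>2 + v\<^sup>2) / (2 * v) \<le> (c'\<^sup>2 + v\<^sup>2) / (2 * v)"
          using True r v by (intro divide_right_mono add_right_mono power_mono) auto
        ultimately show ?thesis using pos by (simp add: d_def)
      next
        case F2: False
        have "d c' \<le> d r"
        proof (rule DERIV_nonneg_imp_nondecreasing[of c' r d])
          show "c' \<le> r" using F2 by simp
        next
          fix y assume y: "c' \<le> y" "y \<le> r"
          have y1: "7 / 10 \<le> y" "y < 1" using y r by (auto simp: c'_def)
          have yy: "49 / 100 \<le> y * y" using mult_mono[OF y1(1) y1(1)] y1 by simp
          have "(y - c') * (1 - c' * c' - c' * y - y * y) \<le> 0"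
            using y y1 yy by (intro mult_nonneg_nonpos) (auto simp: c'_def)
          then have "y - y ^ 3 \<le> c' - c' ^ 3" by (simp add: power3_eq_cube algebra_simps)
          moreover have "c' - c' ^ 3 \<le> v" by (simp add: c'_def v_def power3_eq_cube)
          moreover have "0 < v * (1 - y\<^sup>2)" using v y1 by (simp add: abs_square_less_1)
          ultimately have "0 \<le> (v - (y - y ^ 3)) / (v * (1 - y\<^sup>2))" by simp
          then show "\<exists>D. (d has_real_derivative D) (at y) \<and> 0 \<le> D"
            using dd[of y] y1 by auto
        qed
        moreover have "artanh c \<le> artanh c'"
          by (intro artanh_mono) (auto simp: c_def c'_def)
        ultimately show ?thesis using pos by (simp add: d_def)
      qed
    qed
  qed
  with le show False by (simp add: d_def)
qed

lemma dom_radius_ge: "35516 / 100000 \<le> 7 / 10 * landau_radius (7 / 10)"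
proof (rule ccontr)
  define r s :: real where "r = 7 / 10" and "s = 35516 / 100000"
  define t where "t = r * landau_radius r"
  assume "\<not> ?thesis"
  then have ts: "t < s" by (simp add: t_def s_def r_def)
  have r: "0 < r" "r < 1" by (auto simp: r_def)
  have t0: "0 < t" using landau_radius(1)[OF r] r by (simp add: t_def)
  have "r\<^sup>2 + t\<^sup>2 = r * (r * (1 + (landau_radius r)\<^sup>2))"
    by (simp add: t_def power2_eq_square algebra_simps)
  then have Lt: "r\<^sup>2 + t\<^sup>2 = 2 * artanh r * t"
    unfolding landau_radius(3)[OF r] by (simp add: t_def)
  have "(s - t) * (r\<^sup>2 - s * t) > 0"
  proof (intro mult_pos_pos)
    have "s * t < r * r" using ts t0 by (intro mult_strict_mono) (auto simp: s_def r_def)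
    then show "0 < r\<^sup>2 - s * t" by (simp add: power2_eq_square)
  qed (use ts in simp)
  then have "(r\<^sup>2 + s\<^sup>2) * t < (r\<^sup>2 + t\<^sup>2) * s"
    by (simp add: power2_eq_square algebra_simps)
  then have "t * (r\<^sup>2 + s\<^sup>2) < t * (2 * artanh r * s)" by (simp add: Lt mult_ac)
  then have "r\<^sup>2 + s\<^sup>2 < 2 * artanh r * s" using t0 by simp
  also have "\<dots> \<le> 2 * (86735 / 100000) * s"
    using artanh_7_10 by (simp add: r_def s_def)
  finally show False by (simp add: r_def s_def power2_eq_square)
qed

lemma artanh_over_self_mono:
  fixes x y :: real
  assumes "0 < x" "x \<le> y" "y < 1"
  shows "artanh x / x \<le> artanh y / y"
proof (rule DERIV_nonneg_imp_nondecreasing[OF assms(2)])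
  fix t assume t: "x \<le> t" "t \<le> y"
  then have t1: "0 < t" "t < 1" using assms by auto
  have "((\<lambda>t. artanh t / t) has_real_derivative (1 / (1 - t\<^sup>2) * t - artanh t * 1) / (t * t)) (at t)"
    by (intro DERIV_divide artanh_real_has_field_derivative DERIV_ident) (use t1 in auto)
  moreover have "artanh t \<le> t / (1 - t\<^sup>2)"
    using artanh_le_sum[of t 0] t1 by simp
  ultimately show "\<exists>D. ((\<lambda>t. artanh t / t) has_real_derivative D) (at t) \<and> 0 \<le> D"
    using t1 by (intro exI[of _ "(1 / (1 - t\<^sup>2) * t - artanh t * 1) / (t * t)"]) simp
qed

text \<open>
  The curve \<open>s \<mapsto> (2 w / (s (1 + s\<^sup>2)), w / s\<^sup>2)\<close> consists of the pairs \<open>(r, L)\<close> for which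
  \<open>L s\<^sup>2 = w\<close>, where \<open>r (1 + s\<^sup>2) = 2 L s\<close>. The lemma says that the graph of \<open>artanh\<close> runs above it.
  The derivative of the difference \<open>e\<close> has the sign of \<open>p s - 4 w\<^sup>2\<close>; its minimum lies between \<open>c\<close> and
  \<open>c'\<close>, and for \<open>s \<ge> 0.72\<close> the cubic Taylor polynomial suffices.
\<close>

lemma artanh_gt_img_curve:
  fixes w s :: real
  defines "w \<equiv> 230845 / 1000000"
  assumes s: "0 < s" "s < 1" and x1: "2 * w / (s * (1 + s\<^sup>2)) < 1"
  shows "w / s\<^sup>2 < artanh (2 * w / (s * (1 + s\<^sup>2)))"
proof -
  define x where "x y = 2 * w / (y * (1 + y\<^sup>2))" for y :: real
  define p where "p y = y\<^sup>2 * (1 - y) * (1 + 2 * y\<^sup>2 - y ^ 3)" for y :: real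
  define e where "e y = artanh (x y) - w / y\<^sup>2" for y :: real
  have w: "0 < w" by (simp add: w_def)
  have xpos: "0 < x y" if "0 < y" for y
    using that w by (simp add: x_def add_pos_nonneg)
  have x_mono: "x b \<le> x a" if "0 < a" "a \<le> b" for a b
  proof -
    have "a * (1 + a\<^sup>2) \<le> b * (1 + b\<^sup>2)"
      using that by (intro mult_mono add_left_mono power_mono) auto
    moreover have "0 < a * (1 + a\<^sup>2)" using that by (simp add: add_pos_nonneg)
    ultimately show ?thesis unfolding x_def using w by (intro divide_left_mono) auto
  qed
  have de: "(e has_real_derivative 2 * w * (4 * w\<^sup>2 - p y) * (- 1) / (y ^ 3 * ((y * (1 + y\<^sup>2))\<^sup>2 - 4 * w\<^sup>2))) (at y)"
    and den: "0 < y ^ 3 * ((y * (1 + y\<^sup>2))\<^sup>2 - 4 * w\<^sup>2)"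
    if y: "0 < y" "x y < 1" for y
  proof -
    define g where "g = y * (1 + y\<^sup>2)"
    have g: "0 < g" using y by (simp add: g_def add_pos_nonneg)
    then have gn: "g \<noteq> 0" by simp
    have gw: "2 * w < g" using y(2) g by (simp add: x_def g_def[symmetric])
    then have "(2 * w)\<^sup>2 < g\<^sup>2" using w by (intro power_strict_mono) auto
    then have g2: "0 < g\<^sup>2 - 4 * w\<^sup>2" by (simp add: power_mult_distrib)
    then show "0 < y ^ 3 * ((y * (1 + y\<^sup>2))\<^sup>2 - 4 * w\<^sup>2)" using y by (simp add: g_def)
    have dg: "((\<lambda>y. y * (1 + y\<^sup>2)) has_real_derivative (1 + 3 * y\<^sup>2)) (at y)"
      by (auto intro!: derivative_eq_intros simp: power2_eq_square)
    have dx: "(x has_real_derivative (- (2 * w * (1 + 3 * y\<^sup>2)) / g\<^sup>2)) (at y)"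
    proof -
      have "((\<lambda>y. 2 * w / (y * (1 + y\<^sup>2))) has_real_derivative
          (0 * g - 2 * w * (1 + 3 * y\<^sup>2)) / (g * g)) (at y)"
        unfolding g_def by (intro DERIV_divide DERIV_const dg) (fact gn[unfolded g_def])
      then show ?thesis by (simp add: x_def[abs_def] power2_eq_square)
    qed
    have "x y > -1" using xpos[OF y(1)] by simp
    then have da: "((\<lambda>y. artanh (x y)) has_real_derivative (1 / (1 - (x y)\<^sup>2) * (- (2 * w * (1 + 3 * y\<^sup>2)) / g\<^sup>2))) (at y)"
      by (intro DERIV_chain2[OF _ dx] artanh_real_has_field_derivative) (use y in auto)
    have dw: "((\<lambda>y. w / y\<^sup>2) has_real_derivative (- 2 * w / y ^ 3)) (at y)"
      using y by (auto intro!: derivative_eq_intros simp: power2_eq_square power3_eq_cube divide_simps)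
    have e1: "1 / (1 - (x y)\<^sup>2) * (- (2 * w * (1 + 3 * y\<^sup>2)) / g\<^sup>2) = - (2 * w * (1 + 3 * y\<^sup>2)) / (g\<^sup>2 - 4 * w\<^sup>2)"
    proof -
      have "(x y)\<^sup>2 = 4 * w\<^sup>2 / g\<^sup>2" by (simp add: x_def g_def power_divide power_mult_distrib)
      then have "1 - (x y)\<^sup>2 = (g\<^sup>2 - 4 * w\<^sup>2) / g\<^sup>2" using g by (simp add: diff_divide_distrib)
      then show ?thesis using g by simp
    qed
    have e2: "p y = g\<^sup>2 - y ^ 3 * (1 + 3 * y\<^sup>2)"
      by (simp add: p_def g_def power2_eq_square power3_eq_cube algebra_simps)
    define h where "h = g\<^sup>2 - 4 * w\<^sup>2"
    have "- (2 * w * (1 + 3 * y\<^sup>2)) / h - (- 2 * w / y ^ 3)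
        = 2 * w * (h - y ^ 3 * (1 + 3 * y\<^sup>2)) / (y ^ 3 * h)"
      using y g2 by (simp add: h_def[symmetric] divide_simps) (simp add: algebra_simps)
    also have "h - y ^ 3 * (1 + 3 * y\<^sup>2) = (4 * w\<^sup>2 - p y) * (- 1)" by (simp add: e2 h_def)
    finally have e3: "- (2 * w * (1 + 3 * y\<^sup>2)) / h - (- 2 * w / y ^ 3)
        = 2 * w * ((4 * w\<^sup>2 - p y) * (- 1)) / (y ^ 3 * h)" .
    show "(e has_real_derivative 2 * w * (4 * w\<^sup>2 - p y) * (- 1) / (y ^ 3 * ((y * (1 + y\<^sup>2))\<^sup>2 - 4 * w\<^sup>2))) (at y)"
      using DERIV_diff[OF da dw] unfolding e_def[abs_def] e1 h_def[symmetric] e3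
      by (simp only: h_def g_def mult.assoc)
  qed
  have q_mono: "a\<^sup>2 * (1 - a) \<le> b\<^sup>2 * (1 - b)" if "0 < a" "a \<le> b" "b \<le> 2 / 3" for a b :: real
  proof -
    have "a * a \<le> (2 / 3) * a" "a * b \<le> a * (2 / 3)" "a * b \<le> (2 / 3) * b" "b * b \<le> (2 / 3) * b"
      using that by (intro mult_left_mono mult_right_mono; simp)+
    then have "a * a + a * b + b * b \<le> a + b" by linarith
    then have "0 \<le> (b - a) * (a + b - (a * a + a * b + b * b))"
      using that by (intro mult_nonneg_nonneg) auto
    then show ?thesis by (simp add: power2_eq_square algebra_simps)
  qed
  have r_mono: "1 + 2 * a\<^sup>2 - a ^ 3 \<le> 1 + 2 * b\<^sup>2 - b ^ 3" if "0 < a" "a \<le> b" "b \<le> 1" for a b :: real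
  proof -
    have "a * a \<le> a" "a * b \<le> a" "b * b \<le> b"
      using mult_left_mono[of a 1 a] mult_left_mono[of b 1 a] mult_left_mono[of b 1 b] that by auto
    then have "a * a + a * b + b * b \<le> a + a + b" by (intro add_mono)
    then have "a * a + a * b + b * b \<le> 2 * (a + b)" using that by (simp add: algebra_simps)
    then have "0 \<le> (b - a) * (2 * (a + b) - (a * a + a * b + b * b))"
      using that by (intro mult_nonneg_nonneg) auto
    then show ?thesis by (simp add: power2_eq_square power3_eq_cube algebra_simps)
  qed
  have p_mono: "p a \<le> p b" if "0 < a" "a \<le> b" "b \<le> 2 / 3" for a b
  proof -
    have "0 \<le> 1 + 2 * a\<^sup>2 - a ^ 3"
      using that power_le_one[of a 3] zero_le_power2[of a] by linarith
    then show ?thesis unfolding p_def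
      using that by (intro mult_mono q_mono r_mono) auto
  qed
  define c c' :: real where "c = 590992 / 1000000" and "c' = 590993 / 1000000"
  have xc': "5789864 / 10000000 \<le> x c'"
    by (simp add: x_def c'_def w_def power2_eq_square)
  have xc: "x c < 1" by (simp add: x_def c_def w_def power2_eq_square)
  have pos: "0 < artanh (x c') - w / c\<^sup>2"
  proof -
    have "artanh (5789864 / 10000000) \<le> artanh (x c')"
      using x_mono[of c c'] xc by (intro artanh_mono xc') (auto simp: c_def c'_def)
    moreover have "w / c\<^sup>2 < 660935 / 1000000" by (simp add: c_def w_def power2_eq_square)
    ultimately show ?thesis using artanh_5789864_ge by linarith
  qed
  have "0 < e s"
  proof (cases "s \<le> c")
    case True
    have "e c \<le> e s"
    proof (rule DERIV_nonpos_imp_nonincreasing[OF True])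
      fix y assume y: "s \<le> y" "y \<le> c"
      have y0: "0 < y" "x y < 1" using y s x1 x_mono[of s y] by (auto simp: x_def)
      have "p y \<le> p c" using y y0 by (intro p_mono) (auto simp: c_def)
      also have "\<dots> \<le> 4 * w\<^sup>2" by (simp add: p_def c_def w_def power2_eq_square power3_eq_cube)
      finally have "2 * w * (4 * w\<^sup>2 - p y) * (- 1) \<le> 0" using w by simp
      then show "\<exists>D. (e has_real_derivative D) (at y) \<and> D \<le> 0"
        using de[OF y0] den[OF y0] by (intro exI conjI) (assumption, rule divide_nonpos_pos)
    qed
    moreover have "artanh (x c') \<le> artanh (x c)"
      using xc x_mono[of c c'] xpos[of c'] by (intro artanh_mono) (auto simp: c_def c'_def)
    ultimately show ?thesis using pos by (simp add: e_def)
  next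
    case False
    show ?thesis
    proof (cases "s \<le> c'")
      case True
      have "artanh (x c') \<le> artanh (x s)"
        using x1 x_mono[of s c'] xpos[of c'] s True by (intro artanh_mono) (auto simp: x_def c'_def)
      moreover have "w / s\<^sup>2 \<le> w / c\<^sup>2"
        using False w by (intro divide_left_mono power_mono) (auto simp: c_def)
      ultimately show ?thesis using pos by (simp add: e_def)
    next
      case F2: False
      show ?thesis
      proof (cases "s \<le> 72 / 100")
        case True
        have "e c' \<le> e s"
        proof (rule DERIV_nonneg_imp_nondecreasing[of c' s e])
          show "c' \<le> s" using F2 by simp
        next
          fix y assume y: "c' \<le> y" "y \<le> s"
          have y0: "0 < y" using y by (simp add: c'_def)
          have yx: "x y < 1"
            using x_mono[of c' y] x_mono[of c c'] xc y by (auto simp: c_def c'_def)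
          have "4 * w\<^sup>2 \<le> p y"
          proof (cases "y \<le> 2 / 3")
            case True
            have "4 * w\<^sup>2 \<le> p c'" by (simp add: p_def c'_def w_def power2_eq_square power3_eq_cube)
            also have "\<dots> \<le> p y" using y True by (intro p_mono) (auto simp: c'_def)
            finally show ?thesis .
          next
            case f: False
            have yl: "2 / 3 \<le> y" "y \<le> 72 / 100" using f y True by auto
            have yy: "4 / 9 \<le> y * y" using mult_mono[OF yl(1) yl(1)] yl by simp
            have "0 \<le> (72 / 100 - y) * (72 / 100 * (72 / 100) + 72 / 100 * y + y * y - 72 / 100 - y)"
              using yl yy by (intro mult_nonneg_nonneg) auto
            then have "14515 / 100000 \<le> y\<^sup>2 * (1 - y)"
              by (simp add: power2_eq_square field_simps)
            moreover have "159 / 100 \<le> 1 + 2 * y\<^sup>2 - y ^ 3"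
              using r_mono[of "2 / 3" y] yl by (simp add: power2_eq_square power3_eq_cube)
            ultimately have "14515 / 100000 * (159 / 100) \<le> p y"
              unfolding p_def by (intro mult_mono) auto
            then show ?thesis by (simp add: w_def power2_eq_square)
          qed
          then have "0 \<le> 2 * w * (4 * w\<^sup>2 - p y) * (- 1)"
            using w by (simp add: mult_nonneg_nonpos)
          then show "\<exists>D. (e has_real_derivative D) (at y) \<and> 0 \<le> D"
            using de[OF y0 yx] den[OF y0 yx] by (intro exI conjI) (assumption, rule divide_nonneg_pos)
        qed
        moreover have "w / c'\<^sup>2 \<le> w / c\<^sup>2"
          using w by (intro divide_left_mono power_mono) (auto simp: c_def c'_def)
        ultimately show ?thesis using pos by (simp add: e_def)
      next
        case F3: False
        then have s7: "72 / 100 \<le> s" by simp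
        have "(1 - s) * (1 + s\<^sup>2)\<^sup>2 \<le> (1 - 72 / 100) * (1 + (72 / 100)\<^sup>2)\<^sup>2"
        proof (rule DERIV_nonpos_imp_nonincreasing[OF s7, of "\<lambda>s. (1 - s) * (1 + s\<^sup>2)\<^sup>2"])
          fix y :: real
          have "((\<lambda>s. (1 - s) * (1 + s\<^sup>2)\<^sup>2) has_real_derivative - ((1 + y\<^sup>2) * (y\<^sup>2 + (2 * y - 1)\<^sup>2))) (at y)"
            by (auto intro!: derivative_eq_intros simp: power2_eq_square algebra_simps)
          moreover have "- ((1 + y\<^sup>2) * (y\<^sup>2 + (2 * y - 1)\<^sup>2)) \<le> 0" by simp
          ultimately show "\<exists>D. ((\<lambda>s. (1 - s) * (1 + s\<^sup>2)\<^sup>2) has_real_derivative D) (at y) \<and> D \<le> 0"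
            by blast
        qed
        then have a1: "(1 - s) * (1 + s\<^sup>2)\<^sup>2 \<le> 6456 / 10000" by (simp add: power2_eq_square)
        have "0 \<le> (s - 72 / 100) * (s + 72 / 100 - 1)" using s7 by (intro mult_nonneg_nonneg) auto
        then have a2: "s * (1 - s) \<le> 2016 / 10000" by (simp add: field_simps)
        have "3 * (s * (1 - s)) * ((1 - s) * (1 + s\<^sup>2)\<^sup>2) \<le> 3 * (2016 / 10000) * (6456 / 10000)"
          using s a1 a2 by (intro mult_mono) auto
        also have "\<dots> < 8 * w\<^sup>2" by (simp add: w_def power2_eq_square)
        finally have a3: "3 * s * (1 - s)\<^sup>2 * (1 + s\<^sup>2)\<^sup>2 < 8 * w\<^sup>2"
          by (simp add: power2_eq_square mult_ac)
        define g where "g = 1 + s\<^sup>2"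
        have g: "0 < g" by (simp add: g_def add_pos_nonneg)
        have "w / s\<^sup>2 - x s = w * (1 - s)\<^sup>2 / (s\<^sup>2 * g)"
        proof -
          have "w / s\<^sup>2 - x s = w * (g - 2 * s) / (s\<^sup>2 * g)"
            unfolding x_def g_def[symmetric] using s g by (simp add: field_simps power2_eq_square)
          also have "g - 2 * s = (1 - s)\<^sup>2" by (simp add: g_def power2_eq_square algebra_simps)
          finally show ?thesis .
        qed
        also have "\<dots> = (w / (3 * s ^ 3 * g ^ 3)) * (3 * s * (1 - s)\<^sup>2 * g\<^sup>2)"
          using s g by (simp add: divide_simps power2_eq_square power3_eq_cube)
        also have "\<dots> < (w / (3 * s ^ 3 * g ^ 3)) * (8 * w\<^sup>2)"
          using a3 s g w by (intro mult_strict_left_mono) (auto simp: g_def)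
        also have "\<dots> = (x s) ^ 3 / 3"
          unfolding x_def g_def[symmetric] by (simp add: power_divide power_mult_distrib power2_eq_square power3_eq_cube mult_ac)
        finally have "w / s\<^sup>2 - x s < (x s) ^ 3 / 3" .
        moreover have "x s + (x s) ^ 3 / 3 \<le> artanh (x s)"
          using xpos[of s] s x1 by (intro artanh_ge_cubic) (auto simp: x_def)
        ultimately show ?thesis unfolding e_def by linarith
      qed
    qed
  qed
  then show ?thesis by (simp add: e_def x_def)
qed

text \<open>
  Suppose that \<open>\<rho>\<^sup>2 artanh r \<ge> w\<close>. The ray from the origin through \<open>(r, artanh r)\<close> meets the curve of
  \<open>artanh_gt_img_curve\<close> at a point with first coordinate at most \<open>r\<close>; since \<open>artanh r / r\<close> increases, the
  graph of \<open>artanh\<close> is on or below the ray there, and so not above the curve.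
\<close>

lemma img_radius_lt:
  assumes r: "0 < r" "r < 1"
  shows "artanh r * (landau_radius r)\<^sup>2 < 230845 / 1000000"
proof (rule ccontr)
  define w :: real where "w = 230845 / 1000000"
  define s where "s = landau_radius r"
  note lr = landau_radius[OF r, folded s_def]
  assume "\<not> ?thesis"
  then have wl: "w \<le> artanh r * s\<^sup>2" by (simp add: w_def s_def)
  have w: "0 < w" by (simp add: w_def)
  define x where "x = 2 * w / (s * (1 + s\<^sup>2))"
  have g: "0 < s * (1 + s\<^sup>2)" using lr by (simp add: add_pos_nonneg)
  then have x0: "0 < x" using w by (simp add: x_def)
  have "r * (s * (1 + s\<^sup>2)) = 2 * (artanh r * s\<^sup>2)"
    using lr(3) by (simp add: power2_eq_square mult_ac)
  then have "2 * w \<le> r * (s * (1 + s\<^sup>2))" using wl by simp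
  then have xr: "x \<le> r" using g by (simp add: x_def pos_divide_le_eq)
  have "artanh x / x \<le> artanh r / r" by (rule artanh_over_self_mono[OF x0 xr r(2)])
  also have "\<dots> = (1 + s\<^sup>2) / (2 * s)" using lr r by (simp add: field_simps)
  finally have "artanh x \<le> (1 + s\<^sup>2) / (2 * s) * x" using x0 by (simp add: pos_divide_le_eq)
  also have "\<dots> = w / s\<^sup>2" using lr proof -
    have "1 + s\<^sup>2 \<noteq> 0" by (metis add_pos_nonneg less_irrefl zero_le_power2 zero_less_one)
    then show ?thesis using lr(1) by (simp add: x_def power2_eq_square)
  qed
  finally have "artanh x \<le> w / s\<^sup>2" .
  moreover have "w / s\<^sup>2 < artanh x"
    unfolding x_def w_def using lr xr r by (intro artanh_gt_img_curve) (auto simp: x_def w_def)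
  ultimately show False by simp
qed

lemma img_radius_ge: "23076 / 100000 \<le> artanh (11 / 19) * (landau_radius (11 / 19))\<^sup>2"
proof (rule ccontr)
  define r w :: real where "r = 11 / 19" and "w = 23076 / 100000"
  define L where "L = artanh r"
  define X where "X = (landau_radius r)\<^sup>2"
  have r: "0 < r" "r < 1" by (auto simp: r_def)
  have L: "660877847 / 1000000000 \<le> L" "L \<le> 660877930 / 1000000000" using artanh_11_19 by (auto simp: L_def r_def)
  assume "\<not> ?thesis"
  then have lt: "L * X < w" by (simp add: L_def X_def r_def w_def)
  have X: "0 < X" using landau_radius(1)[OF r] by (simp add: X_def)
  have "(r * (1 + X))\<^sup>2 = (2 * L * landau_radius r)\<^sup>2"
    using landau_radius(3)[OF r] by (simp add: X_def L_def)
  then have eq: "r\<^sup>2 * (1 + X)\<^sup>2 = 4 * L\<^sup>2 * X" by (simp add: power_mult_distrib X_def)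
  have "X * w < L"
  proof -
    have "L * (X * w) < w * w" using lt by (simp add: mult.assoc[symmetric] w_def)
    also have "\<dots> < L * L" using L by (intro mult_strict_mono) (auto simp: w_def)
    finally show ?thesis using L by simp
  qed
  then have "0 < (w - L * X) * (L - X * w)" using lt by simp
  then have "X * (L + w)\<^sup>2 < w * L * (1 + X)\<^sup>2" by (simp add: power2_eq_square algebra_simps)
  then have "r\<^sup>2 * (X * (L + w)\<^sup>2) < r\<^sup>2 * (w * L * (1 + X)\<^sup>2)"
    using r by (intro mult_strict_left_mono) auto
  also have "\<dots> = w * L * (r\<^sup>2 * (1 + X)\<^sup>2)" by (simp add: mult_ac)
  also have "\<dots> = X * (4 * w * L ^ 3)" unfolding eq by (simp add: power2_eq_square power3_eq_cube)
  finally have "X * (r\<^sup>2 * (L + w)\<^sup>2) < X * (4 * w * L ^ 3)" by (simp add: mult_ac)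
  then have "r\<^sup>2 * (L + w)\<^sup>2 < 4 * w * L ^ 3" using X by simp
  also have "\<dots> \<le> 4 * w * (660877930 / 1000000000) ^ 3"
    using L by (intro mult_left_mono power_mono) (auto simp: w_def)
  finally have "r\<^sup>2 * (L + w)\<^sup>2 < 4 * w * (660877930 / 1000000000) ^ 3" .
  moreover have "r\<^sup>2 * (660877847 / 1000000000 + w)\<^sup>2 \<le> r\<^sup>2 * (L + w)\<^sup>2"
    using L by (intro mult_left_mono power_mono) (auto simp: w_def)
  ultimately show False by (simp add: r_def w_def power2_eq_square power3_eq_cube)
qed

section \<open>Estimates along rays\<close>

lemma emb_cnj: "I \<in> imag_sphere \<Longrightarrow> emb I (cnj z) = qcnj (emb I z)"
  by (simp add: emb_def qcnj_mult imag_sphereD(4)) (simp add: of_real_def)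

lemma inner_emb:
  assumes "I \<in> imag_sphere"
  shows "inner (emb I z) q = Re (cnj z * proj I q)"
  using proj_emb_mult[OF assms, of "cnj z" q] qinner_eq_Re(1)[of "emb I z" q] qRe_proj[of I "emb I (cnj z) * q"]
  by (simp add: emb_cnj[OF assms] del: qRe_proj quat_ring_sel)

lemma bloch_normD:
  assumes "bloch_norm f \<le> 1" "norm q < 1"
  shows "(1 - (norm q)\<^sup>2) * norm (slice_deriv f q) \<le> 1"
proof -
  have "ereal ((1 - (norm q)\<^sup>2) * norm (slice_deriv f q)) \<le> bloch_norm f"
    unfolding bloch_norm_def by (rule SUP_upper) (use assms in simp)
  also note assms(1)
  finally show ?thesis by (simp add: one_ereal_def)
qed

lemma slice_deriv_Re_ge:
  assumes reg: "slice_regular_on (ball 0 1) f" and d0: "slice_deriv f 0 = 1"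
    and bl: "bloch_norm f \<le> 1" and q: "norm q \<le> 1 / sqrt 3"
  shows "(1 - sqrt 3 * norm q) / (1 - norm q / sqrt 3) ^ 3 \<le> qRe (slice_deriv f q)"
proof -
  obtain I z where I: "I \<in> imag_sphere" and qz: "q = emb I z" by (rule emb_surj)
  have nz: "norm q = cmod z" by (simp add: qz norm_emb[OF I])
  define F where "F z = proj I (f (emb I z) * 1)" for z
  define h where "h z = proj I (slice_deriv f (emb I z) * 1)" for z
  have dF: "(F has_field_derivative h z) (at z)" if "cmod z < 1" for z
    using slice_component_has_field_derivative[OF reg I that, of 1] by (simp add: F_def[abs_def] h_def)
  have "F holomorphic_on ball 0 1"
    unfolding holomorphic_on_open[OF open_ball] by (intro ballI exI, rule dF) simp
  then have "deriv F holomorphic_on ball 0 1" by (rule holomorphic_deriv) simp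
  then have holh: "h holomorphic_on ball 0 1"
    by (rule holomorphic_transform) (simp add: DERIV_imp_deriv[OF dF])
  have h0: "h 0 = 1" using I by (simp add: h_def d0)
  have le: "(1 - (cmod w)\<^sup>2) * cmod (h w) \<le> 1" if w: "cmod w < 1" for w
  proof -
    have "(1 - (cmod w)\<^sup>2) * cmod (h w) \<le> (1 - (cmod w)\<^sup>2) * norm (slice_deriv f (emb I w))"
      using norm_proj_le[OF I, of "slice_deriv f (emb I w)"] w
      by (intro mult_left_mono) (simp_all add: h_def power_le_one)
    also have "\<dots> \<le> 1" using bloch_normD[OF bl, of "emb I w"] w by (simp add: norm_emb[OF I])
    finally show ?thesis .
  qed
  have "(1 - sqrt 3 * cmod z) / (1 - cmod z / sqrt 3) ^ 3 \<le> Re (h z)"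
    by (rule bonk_distortion[OF holh h0 le]) (use q nz in auto)
  also have "Re (h z) = qRe (slice_deriv f q)" by (simp add: h_def qz)
  finally show ?thesis by (simp only: nz)
qed

text \<open>
  The Noshiro-Warschawski argument: \<open>Re (F (z + t (w - z)) / (w - z))\<close> is strictly increasing in \<open>t\<close>.
\<close>

lemma slice_inj:
  assumes reg: "slice_regular_on (ball 0 1) f" and I: "I \<in> imag_sphere" and R: "R \<le> 1"
    and pos: "\<And>q. norm q < R \<Longrightarrow> 0 < qRe (slice_deriv f q)"
  shows "inj_on f (slice (ball 0 R) I)"
proof (rule inj_onI)
  fix p q assume pq: "p \<in> slice (ball 0 R) I" "q \<in> slice (ball 0 R) I" and eq: "f p = f q"
  then obtain z w where z: "p = emb I z" "cmod z < R" and w: "q = emb I w" "cmod w < R"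
    unfolding slice_ball_eq[OF I] by auto
  show "p = q"
  proof (rule ccontr)
    assume "p \<noteq> q"
    then have zw: "w - z \<noteq> 0" using z w by auto
    define F where "F z = proj I (f (emb I z) * 1)" for z
    define g where "g t = Re (F (z + of_real t * (w - z)) / (w - z))" for t :: real
    have "g 0 < g 1"
    proof (rule DERIV_pos_imp_increasing[of 0 1 g])
      fix t :: real assume t: "0 \<le> t" "t \<le> 1"
      define v where "v = z + of_real t * (w - z)"
      have "v \<in> ball 0 R"
      proof -
        have "v = (1 - t) *\<^sub>R z + t *\<^sub>R w" by (simp add: v_def scaleR_conv_of_real algebra_simps)
        then show ?thesis using convexD_alt[OF convex_ball, of z 0 R w t] z w t by simp
      qed
      then have v: "cmod v < R" by simp
      have dF: "(F has_field_derivative proj I (slice_deriv f (emb I v) * 1)) (at v)"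
        using slice_component_has_field_derivative[OF reg I, of v 1] v R by (simp add: F_def[abs_def])
      have dv: "((\<lambda>t::real. z + of_real t * (w - z)) has_vector_derivative (w - z)) (at t)"
        by (auto intro!: derivative_eq_intros)
      have "((\<lambda>t. F (z + of_real t * (w - z))) has_vector_derivative
          (w - z) * proj I (slice_deriv f (emb I v) * 1)) (at t)"
        using field_vector_diff_chain_at[OF dv, of F] dF by (simp add: o_def v_def)
      then have "((\<lambda>t. F (z + of_real t * (w - z)) / (w - z)) has_vector_derivative
          (w - z) * proj I (slice_deriv f (emb I v) * 1) / (w - z)) (at t)"
        by (rule has_vector_derivative_divide)
      then have "(g has_real_derivative Re (proj I (slice_deriv f (emb I v) * 1))) (at t)"
        unfolding g_def using has_real_derivative_Re zw by fastforce
      moreover have "0 < Re (proj I (slice_deriv f (emb I v) * 1))"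
        using pos[of "emb I v"] v by (simp add: norm_emb[OF I])
      ultimately show "\<exists>D. (g has_real_derivative D) (at t) \<and> 0 < D" by blast
    qed simp
    then show False using eq z w by (simp add: g_def F_def)
  qed
qed

lemma ray_derivative:
  assumes reg: "slice_regular_on (ball 0 1) f" and I: "I \<in> imag_sphere"
    and w: "cmod w = 1" and t: "0 \<le> t" "t < 1"
  shows "((\<lambda>t. proj I (f (emb I (of_real t * w)) * p)) has_vector_derivative
      w * proj I (slice_deriv f (emb I (of_real t * w)) * p)) (at t)"
proof -
  have dv: "((\<lambda>t::real. of_real t * w) has_vector_derivative w) (at t)"
    by (auto intro!: derivative_eq_intros)
  have "cmod (of_real t * w) < 1" using t w by (simp add: norm_mult)
  from field_vector_diff_chain_at[OF dv slice_component_has_field_derivative[OF reg I this]]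
  show ?thesis by (simp add: o_def)
qed

lemma ray_decomposition:
  obtains I w where "I \<in> imag_sphere" "cmod w = 1" "q = emb I (of_real (norm q) * w)"
proof -
  obtain I z where I: "I \<in> imag_sphere" and qz: "q = emb I z" by (rule emb_surj)
  show ?thesis
  proof (cases "z = 0")
    case True
    then show ?thesis using that[OF I, of 1] qz by simp
  next
    case False
    have "of_real (norm q) * sgn z = z" using False by (simp add: qz norm_emb[OF I] sgn_eq)
    then show ?thesis using that[OF I, of "sgn z"] qz False by (simp add: norm_sgn)
  qed
qed

text \<open>
  The factor \<open>p\<close> in the proof rotates \<open>f q\<close> to the positive real axis, so that only the real part has to
  be integrated along the ray.
\<close>

lemma norm_le_artanh:
  assumes reg: "slice_regular_on (ball 0 1) f" and f0: "f 0 = 0"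
    and bl: "bloch_norm f \<le> 1" and q: "norm q < 1"
  shows "norm (f q) \<le> artanh (norm q)"
proof -
  obtain I w where I: "I \<in> imag_sphere" and w: "cmod w = 1" and qw: "q = emb I (of_real (norm q) * w)"
    by (rule ray_decomposition)
  define p where "p = qcnj (sgn (f q))"
  have p: "norm p \<le> 1" by (simp add: p_def norm_sgn)
  have fp: "qRe (f q * p) = norm (f q)"
  proof (cases "f q = 0")
    case False
    have "f q * p = (1 / norm (f q)) *\<^sub>R (f q * qcnj (f q))"
      by (simp add: p_def sgn_div_norm quat_eq_iff algebra_simps divide_inverse)
    then have "qRe (f q * p) = 1 / norm (f q) * (norm (f q))\<^sup>2"
      by (simp only: qcnj_mult_self quat_vector_sel quat_of_real_sel)
    then show ?thesis using False by (simp add: power2_eq_square del: quat_ring_sel)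
  qed simp
  define g where "g t = artanh t - Re (proj I (f (emb I (of_real t * w)) * p))" for t :: real
  have "g 0 \<le> g (norm q)"
  proof (rule DERIV_nonneg_imp_nondecreasing[of 0 "norm q" g])
    fix t assume "0 \<le> t" "t \<le> norm q"
    then have t: "0 \<le> t" "t < 1" using q by auto
    have t2: "t\<^sup>2 < 1" using t by (simp add: abs_square_less_1)
    define e where "e = emb I (of_real t * w)"
    have e: "norm e = t" using t w by (simp add: e_def norm_emb[OF I] norm_mult)
    have "(g has_real_derivative (1 / (1 - t\<^sup>2) - Re (w * proj I (slice_deriv f e * p)))) (at t)"
      unfolding g_def e_def using t
      by (intro DERIV_diff artanh_real_has_field_derivative has_real_derivative_Re ray_derivative[OF reg I w]) auto
    moreover have "Re (w * proj I (slice_deriv f e * p)) \<le> 1 / (1 - t\<^sup>2)"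
    proof -
      have "Re (w * proj I (slice_deriv f e * p)) \<le> norm (slice_deriv f e * p)"
        using complex_Re_le_cmod[of "w * proj I (slice_deriv f e * p)"] norm_proj_le[OF I, of "slice_deriv f e * p"] w
        by (simp add: norm_mult)
      also have "\<dots> \<le> norm (slice_deriv f e)"
        using p by (simp add: norm_mult mult_left_le)
      also have "\<dots> \<le> 1 / (1 - t\<^sup>2)"
        using bloch_normD[OF bl, of e] t t2 by (simp add: e field_simps)
      finally show ?thesis .
    qed
    ultimately show "\<exists>D. (g has_real_derivative D) (at t) \<and> 0 \<le> D"
      by (intro exI[of _ "1 / (1 - t\<^sup>2) - Re (w * proj I (slice_deriv f e * p))"]) simp
  qed simp
  then show ?thesis
    using fp qw f0 by (simp add: g_def proj_def del: quat_ring_sel)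
qed

text \<open>
  The function \<open>sqrt 3 / 4 * (1 - (u t)\<^sup>2)\<close> of the proof is the primitive of the bound in
  \<open>slice_deriv_Re_ge\<close> that vanishes at \<open>0\<close>; at \<open>t = 1 / sqrt 3\<close> it equals \<open>sqrt 3 / 4\<close>.
\<close>

lemma inner_ge_bonk_circle:
  assumes reg: "slice_regular_on (ball 0 1) f" and f0: "f 0 = 0" and d0: "slice_deriv f 0 = 1"
    and bl: "bloch_norm f \<le> 1" and q: "norm q = 1 / sqrt 3"
  shows "norm q * (sqrt 3 / 4) \<le> inner q (f q)"
proof -
  obtain I w where I: "I \<in> imag_sphere" and w: "cmod w = 1" and qw: "q = emb I (of_real (norm q) * w)"
    by (rule ray_decomposition)
  define s where "s = sqrt 3"
  have s: "s * s = 3" "1 < s" by (simp_all add: s_def)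
  define u where "u t = (s - 3 * t) / (s - t)" for t :: real
  define g where "g t = Re (cnj w * proj I (f (emb I (of_real t * w)) * 1)) - s / 4 * (1 - (u t)\<^sup>2)" for t :: real
  have cw: "cnj w * w = 1" using w complex_norm_square[of w] by (simp add: mult.commute)
  have "g 0 \<le> g (1 / s)"
  proof (rule DERIV_nonneg_imp_nondecreasing[of 0 "1 / s" g])
    show "0 \<le> 1 / s" using s by simp
  next
    fix t assume t: "0 \<le> t" "t \<le> 1 / s"
    have "1 / s < 1" using s by simp
    then have t1: "t < 1" "t < s" using t s by linarith+
    define e where "e = emb I (of_real t * w)"
    have e: "norm e = t" using t w by (simp add: e_def norm_emb[OF I] norm_mult)
    have du: "(u has_real_derivative (- 2 * s / (s - t)\<^sup>2)) (at t)"
      unfolding u_def using t1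
      by (auto intro!: derivative_eq_intros simp: divide_simps power2_eq_square)
    have "((\<lambda>t. s / 4 * (1 - (u t)\<^sup>2)) has_real_derivative
        s / 4 * (0 - of_nat 2 * (- 2 * s / (s - t)\<^sup>2 * u t ^ (2 - Suc 0)))) (at t)"
      by (intro DERIV_cmult DERIV_diff DERIV_const DERIV_power du)
    also have "s / 4 * (0 - of_nat 2 * (- 2 * s / (s - t)\<^sup>2 * u t ^ (2 - Suc 0)))
        = - (s / 2) * (u t * (- 2 * s / (s - t)\<^sup>2))"
      by simp
    also have "- (s / 2) * (u t * (- 2 * s / (s - t)\<^sup>2)) = (1 - s * t) / (1 - t / s) ^ 3"
    proof -
      have "1 - t / s = (s - t) / s" using s by (simp add: field_simps)
      moreover have "s - 3 * t = s * (1 - s * t)" using s by (simp add: algebra_simps)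
      ultimately show ?thesis
        unfolding u_def using t1 s
        by (simp add: divide_simps power2_eq_square power3_eq_cube) (use s(1) in algebra)
    qed
    finally have d1: "((\<lambda>t. s / 4 * (1 - (u t)\<^sup>2)) has_real_derivative (1 - s * t) / (1 - t / s) ^ 3) (at t)" .
    have "((\<lambda>t. cnj w * proj I (f (emb I (of_real t * w)) * 1)) has_vector_derivative
        cnj w * (w * proj I (slice_deriv f e * 1))) (at t)"
      unfolding e_def by (intro has_vector_derivative_mult_right ray_derivative[OF reg I w t(1) t1(1)])
    then have "((\<lambda>t. Re (cnj w * proj I (f (emb I (of_real t * w)) * 1))) has_real_derivative
        qRe (slice_deriv f e)) (at t)"
      using has_real_derivative_Re cw by (fastforce simp: mult.assoc[symmetric])
    then have "(g has_real_derivative (qRe (slice_deriv f e) - (1 - s * t) / (1 - t / s) ^ 3)) (at t)"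
      unfolding g_def by (intro DERIV_diff d1)
    moreover have "(1 - s * t) / (1 - t / s) ^ 3 \<le> qRe (slice_deriv f e)"
      using slice_deriv_Re_ge[OF reg d0 bl, of e] t by (simp add: e s_def)
    ultimately show "\<exists>D. (g has_real_derivative D) (at t) \<and> 0 \<le> D"
      by (intro exI[of _ "qRe (slice_deriv f e) - (1 - s * t) / (1 - t / s) ^ 3"]) simp
  qed
  moreover have "g 0 = 0" using s by (simp add: g_def u_def f0 proj_def)
  moreover have "u (1 / s) = 0" using s by (simp add: u_def field_simps)
  ultimately have "s / 4 \<le> Re (cnj w * proj I (f q))"
    using qw q by (simp add: g_def s_def)
  then have "norm q * (s / 4) \<le> norm q * Re (cnj w * proj I (f q))"
    by (intro mult_left_mono) auto
  also have "\<dots> = inner (emb I (of_real (norm q) * w)) (f q)"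
    unfolding inner_emb[OF I] by (simp add: algebra_simps)
  finally show ?thesis by (simp add: s_def qw[symmetric])
qed

section \<open>Covering from a boundary condition\<close>

lemma covering_from_inner_ge:
  fixes g :: "'a::euclidean_space \<Rightarrow> 'a"
  assumes cont: "continuous_on (cball 0 \<rho>) g" and \<rho>: "0 < \<rho>"
    and ge: "\<And>q. norm q = \<rho> \<Longrightarrow> \<rho> * m \<le> inner q (g q)"
    and y: "norm y < m"
  obtains q where "norm q < \<rho>" "g q = y"
proof -
  have pos: "0 < inner q (g q - y)" if "norm q = \<rho>" for q
  proof -
    have "inner q y \<le> norm q * norm y" by (rule norm_cauchy_schwarz)
    also have "\<dots> < \<rho> * m" using that y \<rho> by simp
    also have "\<dots> \<le> inner q (g q)" by (rule ge[OF that])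
    finally show ?thesis by (simp add: inner_diff_right)
  qed
  have "\<exists>q\<in>cball 0 \<rho>. g q = y"
  proof (rule ccontr)
    assume "\<not> ?thesis"
    then have ne: "g q - y \<noteq> 0" if "q \<in> cball 0 \<rho>" for q using that by auto
    \<comment> \<open>A fixed point of the normalized field \<open>y - g\<close> would be a boundary point where the field \<open>g - y\<close> points
      inwards.\<close>
    define G where "G q = - (\<rho> / norm (g q - y)) *\<^sub>R (g q - y)" for q
    have nG: "norm (G q) = \<rho>" if "q \<in> cball 0 \<rho>" for q
      using ne[OF that] \<rho> by (simp add: G_def)
    have "continuous_on (cball 0 \<rho>) G"
      unfolding G_def by (intro continuous_intros cont) (use ne in auto)
    moreover have "G \<in> cball 0 \<rho> \<rightarrow> cball 0 \<rho>" using nG by auto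
    ultimately obtain q where q: "q \<in> cball 0 \<rho>" "G q = q"
      using brouwer_ball[OF \<rho>] by blast
    have "inner q (g q - y) = - \<rho> * norm (g q - y)"
    proof -
      have "inner (G q) (g q - y) = - (\<rho> / norm (g q - y)) * inner (g q - y) (g q - y)"
        by (simp add: G_def)
      also have "\<dots> = - \<rho> * norm (g q - y)"
        using ne[OF q(1)] by (simp add: power2_norm_eq_inner[symmetric] power2_eq_square)
      finally show ?thesis by (simp only: q(2))
    qed
    moreover have "0 < inner q (g q - y)" using pos nG[OF q(1)] q(2) by simp
    ultimately show False using \<rho> by (simp add: mult_less_0_iff not_less)
  qed
  then obtain q where q: "norm q \<le> \<rho>" "g q = y" by auto
  then have "norm q \<noteq> \<rho>" using pos[of q] by auto
  with q that show ?thesis by force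
qed

section \<open>A Landau theorem for the rescaled function\<close>

context
  fixes f :: "quat \<Rightarrow> quat" and r :: real
  assumes reg: "slice_regular_on (ball 0 1) f" and f0: "f 0 = 0" and d0: "slice_deriv f 0 = 1"
    and bl: "bloch_norm f \<le> 1" and r: "0 < r" "r < 1"
begin

lemma rescaled_lt:
  assumes "norm q < 1"
  shows "norm (f (r *\<^sub>R q)) < artanh r"
proof -
  define x where "x = r * norm q"
  have x: "0 \<le> x" "x < r" using assms r by (auto simp: x_def)
  have "norm (f (r *\<^sub>R q)) \<le> artanh x"
    using norm_le_artanh[OF reg f0 bl, of "r *\<^sub>R q"] x r unfolding x_def by simp
  also have "artanh x \<le> artanh r - (r - x) / (1 - x\<^sup>2)"
    using artanh_tangent[of r x] x r by simp
  also have "\<dots> < artanh r" using x r by (simp add: abs_square_less_1)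
  finally show ?thesis .
qed

text \<open>
  Write the component of \<open>f (r z) / artanh r\<close> on the slice of \<open>q\<close> as \<open>z h z\<close>. Then \<open>h\<close> is bounded by \<open>1\<close>
  and \<open>h 0 = r / artanh r\<close>, so that \<open>Schwarz_Pick_Re_ge\<close> applies to \<open>h\<close>.
\<close>

lemma rescaled_inner_ge:
  assumes q: "norm q < 1"
  shows "(norm q)\<^sup>2 * ((r / artanh r - norm q) / (1 - r / artanh r * norm q))
    \<le> inner q ((1 / artanh r) *\<^sub>R f (r *\<^sub>R q))"
proof -
  define L where "L = artanh r"
  define \<alpha> where "\<alpha> = r / L"
  have L: "r < L" unfolding L_def by (rule artanh_gt_self[OF r])
  have \<alpha>: "0 < \<alpha>" "\<alpha> < 1" using r L by (auto simp: \<alpha>_def)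
  obtain I z where I: "I \<in> imag_sphere" and qz: "q = emb I z" by (rule emb_surj)
  have z: "cmod z < 1" using q by (simp add: qz norm_emb[OF I])
  have sc: "emb I (of_real r * z) = r *\<^sub>R emb I z" for z
    by (simp add: emb_def scaleR_add_right of_real_def)
  define F where "F z = proj I (f (emb I z) * 1)" for z
  define H where "H z = F (of_real r * z) / of_real L" for z
  have rz: "cmod (of_real r * z) < 1" if "cmod z < 1" for z
    using that r mult_strict_mono[of r 1 "cmod z" 1] by (auto simp: norm_mult)
  have dF: "(F has_field_derivative proj I (slice_deriv f (emb I z) * 1)) (at z)" if "cmod z < 1" for z
    using slice_component_has_field_derivative[OF reg I that, of 1] by (simp add: F_def[abs_def])
  have dH: "(H has_field_derivative of_real r * proj I (slice_deriv f (emb I (of_real r * z)) * 1) / of_real L) (at z)"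
    if "cmod z < 1" for z
  proof -
    have "((\<lambda>z. of_real r * z) has_field_derivative of_real r) (at z)"
      by (auto intro!: derivative_eq_intros)
    from DERIV_chain2[OF dF[OF rz[OF that]] this] show ?thesis
      unfolding H_def[abs_def] by (metis DERIV_cdivide mult.commute)
  qed
  have holH: "H holomorphic_on ball 0 1"
    unfolding holomorphic_on_open[OF open_ball] by (intro ballI exI, rule dH) simp
  have H0: "H 0 = 0" by (simp add: H_def F_def f0 proj_def complex_eq_iff)
  have Hlt: "cmod (H z) < 1" if "cmod z < 1" for z
  proof -
    have "cmod (F (of_real r * z)) \<le> norm (f (r *\<^sub>R emb I z))"
      unfolding F_def using norm_proj_le[OF I] by (simp add: sc)
    also have "\<dots> < L" unfolding L_def by (rule rescaled_lt) (use that in \<open>simp add: norm_emb[OF I]\<close>)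
    finally show ?thesis using L r by (simp add: H_def norm_divide)
  qed
  obtain h where holh: "h holomorphic_on ball 0 1" and h: "\<And>z. cmod z < 1 \<Longrightarrow> H z = z * h z"
    and h0: "deriv H 0 = h 0"
    using Schwarz3[OF holH H0] by blast
  have h0: "h 0 = of_real \<alpha>"
    using DERIV_imp_deriv[OF dH[of 0]] I by (simp add: h0[symmetric] d0 \<alpha>_def)
  have hle: "cmod (h z) \<le> 1" if "cmod z < 1" for z
  proof (cases "z = 0")
    case True
    then show ?thesis using \<alpha> by (simp add: h0)
  next
    case False
    have "cmod (H z) \<le> cmod z" by (rule Schwarz_Lemma(1)[OF holH H0 Hlt that])
    then show ?thesis using False by (simp add: h[OF that] norm_mult)
  qed
  have "(\<alpha> - cmod z) / (1 - \<alpha> * cmod z) \<le> Re (h z)"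
    by (rule Schwarz_Pick_Re_ge[OF holh hle h0 \<alpha> z])
  then have "(cmod z)\<^sup>2 * ((\<alpha> - cmod z) / (1 - \<alpha> * cmod z)) \<le> (cmod z)\<^sup>2 * Re (h z)"
    by (intro mult_left_mono) auto
  also have "(cmod z)\<^sup>2 * Re (h z) = Re (cnj z * H z)"
  proof -
    have "cnj z * H z = of_real ((cmod z)\<^sup>2) * h z"
      unfolding h[OF z] complex_norm_square by (simp add: mult_ac)
    then show ?thesis by simp
  qed
  also have "\<dots> = inner q ((1 / L) *\<^sub>R f (r *\<^sub>R q))"
  proof -
    have "H z = proj I ((1 / L) *\<^sub>R f (r *\<^sub>R q))"
      by (simp add: H_def F_def sc qz proj_def complex_eq_iff)
    then show ?thesis unfolding inner_emb[OF I] qz by simp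
  qed
  finally show ?thesis by (simp add: \<alpha>_def L_def qz norm_emb[OF I])
qed

lemma
  shows landau_injective: "inj_on f (ball 0 (r * landau_radius r))"
    and landau_covering: "ball 0 (artanh r * (landau_radius r)\<^sup>2) \<subseteq> f ` ball 0 (r * landau_radius r)"
proof -
  define L \<rho> \<alpha> where "L = artanh r" and "\<rho> = landau_radius r" and "\<alpha> = r / L"
  have L: "r < L" unfolding L_def by (rule artanh_gt_self[OF r])
  then have L0: "0 < L" using r by simp
  have \<alpha>: "0 < \<alpha>" "\<alpha> < 1" using r L by (auto simp: \<alpha>_def)
  note \<rho> = landau_radius(1,2)[OF r, folded \<rho>_def]
  have \<alpha>\<rho>: "\<alpha> - \<rho> = \<rho> * (1 - \<alpha> * \<rho>)"
    using landau_radius(3)[OF r] L0 by (simp add: \<alpha>_def \<rho>_def L_def field_simps power2_eq_square)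
  obtain a where sma: "\<And>r. 0 \<le> r \<Longrightarrow> r < 1 \<Longrightarrow> summable (\<lambda>n. norm (a n) * r ^ n)"
    and fa: "\<And>q. norm q < 1 \<Longrightarrow> (\<lambda>n. q ^ n * a n) sums f q"
    using slice_regular_power_series[OF reg] by blast
  define x where "x n = (r ^ n / L) *\<^sub>R a n" for n
  define \<phi> where "\<phi> q = (1 / L) *\<^sub>R f (r *\<^sub>R q)" for q
  have x: "summable (\<lambda>n. norm (x n))"
    using summable_mult[OF sma[of r], of "1 / L"] r L0 by (simp add: x_def mult_ac)
  have \<phi>x: "(\<lambda>n. q ^ n * x n) sums \<phi> q" if "norm q \<le> 1" for q
  proof -
    have "r * norm q \<le> r * 1" using that r by (intro mult_left_mono) auto
    moreover have "norm (r *\<^sub>R q) = r * norm q" using r by simp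
    ultimately have "norm (r *\<^sub>R q) < 1" using r by linarith
    from sums_scaleR_right[OF fa[OF this], of "1 / L"] show ?thesis
      by (simp add: x_def \<phi>_def scaleR_power)
  qed
  have a0: "a 0 = 0"
  proof -
    have "(\<lambda>n. (0::quat) ^ n * a n) = (\<lambda>n. if n = 0 then a n else 0)"
      by (rule ext) (simp add: power_0_left)
    then have "(\<lambda>n. (0::quat) ^ n * a n) sums a 0" using sums_single[of 0 a] by simp
    from sums_unique2[OF this fa[of 0]] show ?thesis using f0 by simp
  qed
  have x0: "x 0 = 0" by (simp add: x_def a0)
  have \<phi>le: "norm (\<Sum>n. q ^ n * x n) \<le> 1" if "norm q \<le> 1" for q
  proof -
    have rq: "r * norm q \<le> r" using that r mult_left_mono[of "norm q" 1 r] by simp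
    have "norm (f (r *\<^sub>R q)) \<le> artanh (r * norm q)"
      using norm_le_artanh[OF reg f0 bl, of "r *\<^sub>R q"] rq r by simp
    also have "\<dots> \<le> L" unfolding L_def using rq r by (intro artanh_mono) auto
    finally have "norm (\<phi> q) \<le> 1" using L0 by (simp add: \<phi>_def)
    then show ?thesis using \<phi>x[OF that] by (simp add: sums_iff)
  qed
  have growth: "(norm q)\<^sup>2 * ((\<alpha> - norm q) / (1 - \<alpha> * norm q)) \<le> inner q (\<phi> q)" if "norm q < 1" for q
    using rescaled_inner_ge[OF that] by (simp add: \<phi>_def \<alpha>_def L_def)
  have no_pair: False
    if "norm p < \<rho>" "norm q < \<rho>" "p \<noteq> q" "p \<noteq> 0" "\<phi> p = \<phi> q" for p q
  proof -
    have n1: "norm p < 1" "norm q < 1" using that \<rho> by auto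
    define t where "t = norm p"
    have t: "0 < t" "t < \<rho>" using that by (auto simp: t_def)
    have at: "0 < 1 - \<alpha> * t"
    proof -
      have "\<alpha> * t < 1 * 1" using \<alpha> t \<rho> by (intro mult_strict_mono) auto
      then show ?thesis by simp
    qed
    have a\<rho>: "0 < 1 - \<alpha> * \<rho>"
    proof -
      have "\<alpha> * \<rho> < 1 * 1" using \<alpha> \<rho> by (intro mult_strict_mono) auto
      then show ?thesis by simp
    qed
    have "norm (\<phi> p) \<le> norm p * norm q"
      by (rule equal_values_norm_le[OF x x0 \<phi>le n1 that(3) \<phi>x]) (use \<phi>x[of q] n1 that(5) in auto)
    also have "\<dots> \<le> t * \<rho>"
      unfolding t_def using that(2) by (intro mult_left_mono) auto
    finally have up: "norm (\<phi> p) \<le> t * \<rho>" .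
    have "\<rho> * (1 - \<alpha> * t) < \<alpha> - t"
    proof -
      have "t * (1 - \<alpha> * \<rho>) < \<rho> * (1 - \<alpha> * \<rho>)" using t a\<rho> by simp
      then show ?thesis unfolding \<alpha>\<rho>[symmetric] by (simp add: algebra_simps)
    qed
    then have "\<rho> < (\<alpha> - t) / (1 - \<alpha> * t)" using at by (simp add: pos_less_divide_eq)
    then have "t\<^sup>2 * \<rho> < t\<^sup>2 * ((\<alpha> - t) / (1 - \<alpha> * t))" using t by (intro mult_strict_left_mono) auto
    also have "\<dots> \<le> inner p (\<phi> p)" using growth[OF n1(1)] by (simp add: t_def)
    also have "\<dots> \<le> t * norm (\<phi> p)" unfolding t_def by (rule norm_cauchy_schwarz)
    also have "\<dots> \<le> t * (t * \<rho>)" using up t by (intro mult_left_mono) auto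
    finally show False by (simp add: power2_eq_square)
  qed
  show "inj_on f (ball 0 (r * landau_radius r))"
  proof (rule inj_onI)
    fix p q assume pq: "p \<in> ball 0 (r * landau_radius r)" "q \<in> ball 0 (r * landau_radius r)" and eq: "f p = f q"
    define p' q' where "p' = (1 / r) *\<^sub>R p" and "q' = (1 / r) *\<^sub>R q"
    have n: "norm p' < \<rho>" "norm q' < \<rho>" using pq r by (simp_all add: p'_def q'_def \<rho>_def field_simps)
    have e: "\<phi> p' = \<phi> q'" using r eq by (simp add: \<phi>_def p'_def q'_def)
    have "p' = q'"
    proof (rule ccontr)
      assume ne: "p' \<noteq> q'"
      then consider "p' \<noteq> 0" | "q' \<noteq> 0" by auto
      then show False using no_pair[OF n ne _ e] no_pair[OF n(2,1) ne[symmetric] _ e[symmetric]] by blast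
    qed
    then show "p = q" using r by (simp add: p'_def q'_def)
  qed
  show "ball 0 (artanh r * (landau_radius r)\<^sup>2) \<subseteq> f ` ball 0 (r * landau_radius r)"
  proof
    fix y :: quat assume "y \<in> ball 0 (artanh r * (landau_radius r)\<^sup>2)"
    then have y: "norm ((1 / L) *\<^sub>R y) < \<rho>\<^sup>2" using L0 by (simp add: L_def \<rho>_def field_simps)
    have a\<rho>: "0 < 1 - \<alpha> * \<rho>"
    proof -
      have "\<alpha> * \<rho> < 1 * 1" using \<alpha> \<rho> by (intro mult_strict_mono) auto
      then show ?thesis by simp
    qed
    have "continuous_on (cball 0 1) (\<lambda>q. \<Sum>n. q ^ n * x n)"
      by (rule continuous_on_quat_power_series) (use x in auto)
    then have "continuous_on (cball 0 1) \<phi>"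
      by (rule continuous_on_eq) (use \<phi>x in \<open>simp add: sums_iff\<close>)
    then have cont: "continuous_on (cball 0 \<rho>) \<phi>"
      by (rule continuous_on_subset) (use \<rho> in auto)
    have ge: "\<rho> * \<rho>\<^sup>2 \<le> inner q (\<phi> q)" if "norm q = \<rho>" for q
    proof -
      have "(\<alpha> - \<rho>) / (1 - \<alpha> * \<rho>) = \<rho>" unfolding \<alpha>\<rho> using a\<rho> by simp
      then show ?thesis using growth[of q] that \<rho> by (simp add: power2_eq_square mult_ac)
    qed
    obtain q where q: "norm q < \<rho>" "\<phi> q = (1 / L) *\<^sub>R y"
      by (rule covering_from_inner_ge[OF cont \<rho>(1) ge y])
    have "f (r *\<^sub>R q) = y" using q(2) L0 by (simp add: \<phi>_def)
    moreover have "r *\<^sub>R q \<in> ball 0 (r * landau_radius r)" using q(1) r by (simp add: \<rho>_def)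
    ultimately show "y \<in> f ` ball 0 (r * landau_radius r)" by blast
  qed
qed

end

section \<open>The theorem\<close>

lemma half_ln_eq_artanh: "1 / 2 * ln ((1 + r) / (1 - r)) = artanh (r :: real)"
  by (simp add: artanh_def)

lemma bloch_radius_dom_eq: "bloch_radius_dom = (SUP r\<in>{0<..<1}. r * landau_radius r)"
  unfolding bloch_radius_dom_def
proof (rule SUP_cong)
  fix r :: real assume "r \<in> {0<..<1}"
  moreover have "1 / 4 * (ln ((1 + r) / (1 - r)))\<^sup>2 = (artanh r)\<^sup>2"
    by (simp add: artanh_def power2_eq_square)
  ultimately show "1 / 2 * ln ((1 + r) / (1 - r)) - sqrt (1 / 4 * (ln ((1 + r) / (1 - r)))\<^sup>2 - r\<^sup>2) = r * landau_radius r"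
    unfolding half_ln_eq_artanh by (simp add: landau_radius_def)
qed simp

lemma bloch_radius_img_eq: "bloch_radius_img = (SUP r\<in>{0<..<1}. artanh r * (landau_radius r)\<^sup>2)"
  unfolding bloch_radius_img_def
proof (rule SUP_cong)
  fix r :: real assume r: "r \<in> {0<..<1}"
  have 1: "1 / 4 * (ln ((1 + r) / (1 - r)))\<^sup>2 = (artanh r)\<^sup>2"
    by (simp add: artanh_def power2_eq_square)
  have 2: "1 / (2 * r\<^sup>2) * ln ((1 + r) / (1 - r)) = artanh r / r\<^sup>2"
    by (simp add: artanh_def)
  show "1 / (2 * r\<^sup>2) * ln ((1 + r) / (1 - r)) *
      (1 / 2 * ln ((1 + r) / (1 - r)) - sqrt (1 / 4 * (ln ((1 + r) / (1 - r)))\<^sup>2 - r\<^sup>2))\<^sup>2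
     = artanh r * (landau_radius r)\<^sup>2"
    unfolding half_ln_eq_artanh 1 2 using r by (simp add: landau_radius_def power_divide)
qed simp

lemma bdd_above_dom: "bdd_above ((\<lambda>r. r * landau_radius r) ` {0<..<1})"
  using dom_radius_lt by (intro bdd_aboveI2[of _ _ "3552495 / 10000000"]) (simp add: less_imp_le)

lemma bdd_above_img: "bdd_above ((\<lambda>r. artanh r * (landau_radius r)\<^sup>2) ` {0<..<1})"
  using img_radius_lt by (intro bdd_aboveI2[of _ _ "230845 / 1000000"]) (simp add: less_imp_le)

lemma bloch_radius_dom_approx: "\<bar>bloch_radius_dom - 0.3552\<bar> < 0.00005"
proof -
  have "bloch_radius_dom \<le> 3552495 / 10000000"
    unfolding bloch_radius_dom_eq using dom_radius_lt by (intro cSUP_least) (auto simp: less_imp_le)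
  moreover have "7 / 10 * landau_radius (7 / 10) \<le> bloch_radius_dom"
    unfolding bloch_radius_dom_eq by (intro cSUP_upper bdd_above_dom) auto
  ultimately have "35515 / 100000 < bloch_radius_dom" "bloch_radius_dom < 35525 / 100000"
    using dom_radius_ge by linarith+
  then show ?thesis unfolding abs_less_iff by simp
qed

lemma bloch_radius_img_approx: "\<bar>bloch_radius_img - 0.2308\<bar> < 0.00005"
proof -
  have "bloch_radius_img \<le> 230845 / 1000000"
    unfolding bloch_radius_img_eq using img_radius_lt by (intro cSUP_least) (auto simp: less_imp_le)
  moreover have "artanh (11 / 19) * (landau_radius (11 / 19))\<^sup>2 \<le> bloch_radius_img"
    unfolding bloch_radius_img_eq by (intro cSUP_upper bdd_above_img) auto
  ultimately have "23075 / 100000 < bloch_radius_img" "bloch_radius_img < 23085 / 100000"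
    using img_radius_ge by linarith+
  then show ?thesis unfolding abs_less_iff by simp
qed

theorem theorem1p2:
  fixes f :: "quat \<Rightarrow> quat"
  assumes "slice_regular_on (ball 0 1) f"
    and "f 0 = 0"
    and "slice_deriv f 0 = 1"
    and "bloch_norm f \<le> 1"
  shows "(\<forall>q\<in>ball 0 (1 / sqrt 3).
            qRe (slice_deriv f q) \<ge> (1 - sqrt 3 * norm q) / (1 - norm q / sqrt 3) ^ 3) \<and>
         (\<forall>I\<in>imag_sphere. inj_on f (slice (ball 0 (1 / sqrt 3)) I)) \<and>
         inj_on f (ball 0 bloch_radius_dom) \<and>
         ball 0 bloch_radius_img \<subseteq> f ` ball 0 bloch_radius_dom \<and>
         \<bar>bloch_radius_dom - 0.3552\<bar> < 0.00005 \<and>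
         \<bar>bloch_radius_img - 0.2308\<bar> < 0.00005 \<and>
         ball 0 (sqrt 3 / 4) \<subseteq> f ` ball 0 (1 / sqrt 3)"
proof (intro conjI ballI)
  fix q :: quat assume "q \<in> ball 0 (1 / sqrt 3)"
  then show "qRe (slice_deriv f q) \<ge> (1 - sqrt 3 * norm q) / (1 - norm q / sqrt 3) ^ 3"
    by (intro slice_deriv_Re_ge assms) simp
next
  fix I assume I: "I \<in> imag_sphere"
  show "inj_on f (slice (ball 0 (1 / sqrt 3)) I)"
  proof (rule slice_inj[OF assms(1) I])
    fix q :: quat assume q: "norm q < 1 / sqrt 3"
    then have sq: "sqrt 3 * norm q < 1" by (simp add: field_simps)
    moreover have "norm q / sqrt 3 \<le> sqrt 3 * norm q" by (simp add: field_simps)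
    ultimately have "0 < 1 - sqrt 3 * norm q" "0 < 1 - norm q / sqrt 3" by linarith+
    then have "0 < (1 - sqrt 3 * norm q) / (1 - norm q / sqrt 3) ^ 3"
      by (intro divide_pos_pos zero_less_power)
    also have "\<dots> \<le> qRe (slice_deriv f q)"
      by (intro slice_deriv_Re_ge assms) (use q in simp)
    finally show "0 < qRe (slice_deriv f q)" .
  qed simp
next
  show "inj_on f (ball 0 bloch_radius_dom)"
  proof (rule inj_onI)
    fix p q assume pq: "p \<in> ball 0 bloch_radius_dom" "q \<in> ball 0 bloch_radius_dom" "f p = f q"
    then have "max (norm p) (norm q) < (SUP r\<in>{0<..<1}. r * landau_radius r)"
      by (simp add: bloch_radius_dom_eq)
    then obtain r where r: "r \<in> {0<..<1}" "max (norm p) (norm q) < r * landau_radius r"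
      using less_cSUP_iff[of "{0<..<1::real}" "\<lambda>r. r * landau_radius r" "max (norm p) (norm q)"] bdd_above_dom
      by (auto simp del: max_less_iff_conj)
    then show "p = q"
      using landau_injective[OF assms, of r] pq(3) by (auto dest: inj_onD)
  qed
next
  show "ball 0 bloch_radius_img \<subseteq> f ` ball 0 bloch_radius_dom"
  proof
    fix y :: quat assume "y \<in> ball 0 bloch_radius_img"
    then have "norm y < (SUP r\<in>{0<..<1}. artanh r * (landau_radius r)\<^sup>2)"
      by (simp add: bloch_radius_img_eq)
    then obtain r where r: "r \<in> {0<..<1}" "norm y < artanh r * (landau_radius r)\<^sup>2"
      using less_cSUP_iff[of "{0<..<1::real}" "\<lambda>r. artanh r * (landau_radius r)\<^sup>2" "norm y"] bdd_above_img
      by auto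
    then have "y \<in> f ` ball 0 (r * landau_radius r)"
      using landau_covering[OF assms, of r] by auto
    moreover have "r * landau_radius r \<le> bloch_radius_dom"
      unfolding bloch_radius_dom_eq using r by (intro cSUP_upper bdd_above_dom)
    ultimately show "y \<in> f ` ball 0 bloch_radius_dom" by fastforce
  qed
next
  show "\<bar>bloch_radius_dom - 0.3552\<bar> < 0.00005" by (rule bloch_radius_dom_approx)
next
  show "\<bar>bloch_radius_img - 0.2308\<bar> < 0.00005" by (rule bloch_radius_img_approx)
next
  show "ball 0 (sqrt 3 / 4) \<subseteq> f ` ball 0 (1 / sqrt 3)"
  proof
    fix y :: quat assume "y \<in> ball 0 (sqrt 3 / 4)"
    then have y: "norm y < sqrt 3 / 4" by simp
    obtain a where sma: "\<And>r. 0 \<le> r \<Longrightarrow> r < 1 \<Longrightarrow> summable (\<lambda>n. norm (a n) * r ^ n)"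
      and fa: "\<And>q. norm q < 1 \<Longrightarrow> (\<lambda>n. q ^ n * a n) sums f q"
      using slice_regular_power_series[OF assms(1)] by blast
    have s: "1 / sqrt 3 < 1" by simp
    have "continuous_on (cball 0 (1 / sqrt 3)) (\<lambda>q. \<Sum>n. q ^ n * a n)"
      by (intro continuous_on_quat_power_series sma) (use s in auto)
    then have cont: "continuous_on (cball 0 (1 / sqrt 3)) f"
    proof (rule continuous_on_eq)
      fix q :: quat assume "q \<in> cball 0 (1 / sqrt 3)"
      then have "norm q \<le> 1 / sqrt 3" by simp
      then have "norm q < 1" using s by linarith
      from fa[OF this] show "(\<Sum>n. q ^ n * a n) = f q" by (rule sums_unique[symmetric])
    qed
    obtain q where "norm q < 1 / sqrt 3" "f q = y"
    proof (rule covering_from_inner_ge[OF cont _ _ y])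
      show "1 / sqrt 3 * (sqrt 3 / 4) \<le> inner q (f q)" if "norm q = 1 / sqrt 3" for q
        using inner_ge_bonk_circle[OF assms that] that by simp
    qed auto
    then show "y \<in> f ` ball 0 (1 / sqrt 3)" by auto
  qed
qed

end
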